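(* (a) Let $d,m\in\mathbb N$ and let $\rho_{m|d}$ be the restriction of $\rho_m:\mathbb Q[\overline X]\to\mathbb Q_{\mathrm{cl}}(\mathfrak S_m)$ to the subspace $\mathbb Q^{\le d}[\overline X]$ of polynomials of weight $\le d$. The image of $\rho_{m|d}$ is the subspace $$\mathbb Q_{\mathrm{cl}}^{\le d}(\mathfrak S_m)=\big\langle \chi_{V_\lambda}\ :\ |\lambda|=m \text{ and } w(\lambda)\le d\big\rangle_{\mathbb Q},$$ and $\ker(\rho_{m|d})=0$ if and only if $d\le m/2$. (b) Let $P\in\mathbb Q[\overline X]$. (i) The scalar product $\langle\langle 1\,|\,P\rangle\rangle_{\mathfrak S_m}$ is constant for $m\ge\deg_w(P)$. (ii) For every $m$, the scalar product $\langle\langle \chi_{V_\lambda}\,|\,P\rangle\rangle_{\mathfrak S_m}$ vanishes for every partition $\lambda$ of $m$ such that $w(\lambda)>\deg_w(P)$. (iii) Let $W_m$ be a representation of $\mathfrak S_m$. If $\rho_m(P)=\chi_{W_m}$, then $\deg_w(P)\ge w(W_m)$. (c) Let $W_m=\bigoplus_{\lambda\vdash m}V_\lambda^{\,n_\lambda}$ be a representation of $\mathfrak S_m$. The polynomial $$\mathbf X_{W_m}:=\sum_{\lambda\vdash m}n_\lambda\,\mathbf X_\lambda\in\mathbb Q[X_1,\dots,X_{m-1}],$$ where $\mathbf X_\lambda$ is the Frobenius polynomial for $\chi_{V_\lambda}$, satisfies $$\rho_m(\mathbf X_{W_m})=\chi_{W_m}\quad\text{and}\quad \deg_w(\mathbf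 X_{W_m})=w(W_m),$$ and it is the only polynomial satisfying simultaneously these two equalities if and only if $w(W_m)\le m/2$.
   Context: $\mathbb N=\{0,1,2,\dots\}$. $\mathfrak S_m$ is the symmetric group on $\{1,\dots,m\}$; representations are finite dimensional over $\mathbb Q$; $\chi_W$ is the character of $W$. For a partition $\lambda\vdash m$, $V_\lambda$ is the associated simple $\mathfrak S_m$-module ($V_{(m)}$ is trivial). $\mathbb Q_{\mathrm{cl}}(\mathfrak S_m)$ is the algebra of class functions $\mathfrak S_m\to\mathbb Q$, with scalar product $\langle\langle f_1|f_2\rangle\rangle_{\mathfrak S_m}=\frac1{|\mathfrak S_m|}\sum_{g}f_1(g)f_2(g^{-1})$. $\mathbb Q[\overline X]=\mathbb Q[X_1,X_2,\dots]$, and $\rho_m:\mathbb Q[\overline X]\to\mathbb Q_{\mathrm{cl}}(\mathfrak S_m)$ is the algebra homomorphism sending $X_i$ to $g\mapsto X_i(g)$, the number of $i$-cycles in the disjoint cycle decomposition of $g\in\mathfrak S_m$ (fixed points are $1$-cycles). In scalar products, $P$ stands for $\rho_m(P)$. By convention $\mathbb Q[X_1,\dots,X_k]=\mathbb Q$ if $k\le0$. The weight $\deg_w(P)$ of $P\in\mathbb Q[\overline X]$ is its weighted degree with $\deg_w(X_i)=i$ (and $\deg_w(0)=-\infty$). For a partition $\lambda=(\lambda_1\ge\lambda_2\ge\dots\ge\lambda_\ell>0)$, its socle is $\underline\lambda=(\lambda_2,\dots,\lambda_\ell)$ and its weight is $w(\lambda)=|\underline\lambda|=\lambda_2+\dots+\lambda_\ell$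 (and $w(\emptyset)=0$). The weight $w(W_m)$ of an $\mathfrak S_m$-module $W_m\cong\bigoplus_{\mu\vdash m}V_\mu^{\,n_\mu}$ is $\sup\{w(\mu): n_\mu\ne0\}$ ($-\infty$ if $W_m=0$). Frobenius polynomial: for $\lambda=(\lambda_1\ge\dots\ge\lambda_\ell>0)\vdash m$, Frobenius' formula says that $\chi_{V_\lambda}(g)$ is the coefficient of $y_1^{\lambda_1+\ell-1}y_2^{\lambda_2+\ell-2}\cdots y_\ell^{\lambda_\ell}$ in $\prod_{i<j}(y_i-y_j)\prod_{d\ge1}(y_1^d+\dots+y_\ell^d)^{X_d(g)}$. By homogeneity one may set $y_1=1$, and $\mathbf X_\lambda\in\mathbb Q[\overline X]$ is then the coefficient of $y_2^{\lambda_2+\ell-2}y_3^{\lambda_3+\ell-3}\cdots y_\ell^{\lambda_\ell}$ in the formal power series $$\prod_{2\le i<j\le\ell}(y_i-y_j)\ \prod_{j=2}^{\ell}(1-y_j)\ \prod_{d\ge1}\big(1+y_2^d+\dots+y_\ell^d\big)^{X_d},$$ where $(1+p)^{X_d}=\sum_{k\ge0}\binom{X_d}{k}p^k$. (So $\mathbf X_{(m)}=1$; for $m=0$ put $\mathbf X_\emptyset=1$.) *)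

theory Defs
  imports
    "HOL-Library.Poly_Mapping"
    "HOL-Library.Function_Algebras"
    "HOL-Library.Extended_Real"
    "HOL-Combinatorics.Permutations"
    "HOL-Combinatorics.Orbits"
begin

abbreviation sym :: "nat \<Rightarrow> (nat \<Rightarrow> nat) set" where
  "sym m \<equiv> {g. g permutes {1..m}}"

text \<open>
  Functions on \<open>sym m\<close> (class functions, elements of the group algebra) are represented by
  functions on all of \<open>nat \<Rightarrow> nat\<close> that vanish outside \<open>sym m\<close>. Addition and zero are the pointwise
  ones of \<open>HOL-Library.Function_Algebras\<close>.
\<close>

type_synonym pfun = "(nat \<Rightarrow> nat) \<Rightarrow> rat"

definition pfun_scale :: "rat \<Rightarrow> pfun \<Rightarrow> pfun" where
  "pfun_scale c f = (\<lambda>g. c * f g)"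

definition scalar_prod :: "nat \<Rightarrow> pfun \<Rightarrow> pfun \<Rightarrow> rat" where
  "scalar_prod m f1 f2 = (1 / of_nat (card (sym m))) * (\<Sum>g\<in>sym m. f1 g * f2 (inv g))"

text \<open>For a fixed point \<open>x\<close> one has \<open>orbit g x = {x}\<close>, so fixed points are counted as 1-cycles.\<close>

definition cycle_count :: "nat \<Rightarrow> nat \<Rightarrow> (nat \<Rightarrow> nat) \<Rightarrow> nat" where
  "cycle_count m i g = card {C \<in> orbit g ` {1..m}. card C = i}"

text \<open>
  Monomials are finitely supported exponent functions. The index \<open>k :: nat\<close> of such a
  function stands for the variable \<open>X\<^sub>k\<^sub>+\<^sub>1\<close>, so that the type is exactly the polynomial ring in
  \<open>X\<^sub>1, X\<^sub>2, \<dots>\<close>.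
\<close>

type_synonym qpoly = "(nat \<Rightarrow>\<^sub>0 nat) \<Rightarrow>\<^sub>0 rat"

definition qvar :: "nat \<Rightarrow> qpoly" where
  "qvar i = Poly_Mapping.single (Poly_Mapping.single (i - 1) 1) 1"  \<comment> \<open>\<open>X\<^sub>i\<close>, for \<open>i \<ge> 1\<close>\<close>

definition qconst :: "rat \<Rightarrow> qpoly" where
  "qconst c = Poly_Mapping.single 0 c"

text \<open>Here \<open>a i\<close> is the value substituted for \<open>X\<^sub>i\<close>.\<close>

definition qeval :: "(nat \<Rightarrow> rat) \<Rightarrow> qpoly \<Rightarrow> rat" where
  "qeval a P =
     (\<Sum>t\<in>Poly_Mapping.keys P. Poly_Mapping.lookup P t * (\<Prod>k\<in>Poly_Mapping.keys t. a (Suc k) ^ Poly_Mapping.lookup t k))"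

definition monom_weight :: "(nat \<Rightarrow>\<^sub>0 nat) \<Rightarrow> nat" where
  "monom_weight t = (\<Sum>k\<in>Poly_Mapping.keys t. Suc k * Poly_Mapping.lookup t k)"

text \<open>The supremum of the empty set in \<^typ>\<open>ereal\<close> is \<open>-\<infinity>\<close>, the weight of the zero polynomial.\<close>

definition deg_w :: "qpoly \<Rightarrow> ereal" where
  "deg_w P = (SUP t\<in>Poly_Mapping.keys P. ereal (real (monom_weight t)))"

definition polys_weight_le :: "nat \<Rightarrow> qpoly set" where
  "polys_weight_le d = {P. deg_w P \<le> ereal (real d)}"

definition polys_in_vars :: "nat \<Rightarrow> qpoly set" where
  "polys_in_vars n = {P. \<forall>t\<in>Poly_Mapping.keys P. \<forall>k\<in>Poly_Mapping.keys t. Suc k \<le> n}"  \<comment> \<open>polynomials in \<open>X\<^sub>1, \<dots>, X\<^sub>n\<close>\<close>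

definition rho :: "nat \<Rightarrow> qpoly \<Rightarrow> pfun" where
  "rho m P = (\<lambda>g. if g \<in> sym m then qeval (\<lambda>i. of_nat (cycle_count m i g)) P else 0)"

record 'v rep =
  rep_scale :: "rat \<Rightarrow> 'v \<Rightarrow> 'v"
  rep_space :: "'v set"
  rep_act :: "(nat \<Rightarrow> nat) \<Rightarrow> 'v \<Rightarrow> 'v"

definition is_rep :: "nat \<Rightarrow> 'v::ab_group_add rep \<Rightarrow> bool" where
  "is_rep m W \<longleftrightarrow>
     vector_space (rep_scale W) \<and>
     (\<exists>B. finite B \<and> module.span (rep_scale W) B = rep_space W) \<and>
     (\<forall>g\<in>sym m. \<forall>x\<in>rep_space W. rep_act W g x \<in> rep_space W) \<and>
     (\<forall>g\<in>sym m. \<forall>x\<in>rep_space W. \<forall>y\<in>rep_space W.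
        rep_act W g (x + y) = rep_act W g x + rep_act W g y) \<and>
     (\<forall>g\<in>sym m. \<forall>c. \<forall>x\<in>rep_space W.
        rep_act W g (rep_scale W c x) = rep_scale W c (rep_act W g x)) \<and>
     (\<forall>x\<in>rep_space W. rep_act W id x = x) \<and>
     (\<forall>g\<in>sym m. \<forall>h\<in>sym m. \<forall>x\<in>rep_space W.
        rep_act W (g \<circ> h) x = rep_act W g (rep_act W h x))"

definition rep_iso :: "nat \<Rightarrow> 'v::ab_group_add rep \<Rightarrow> 'w::ab_group_add rep \<Rightarrow> bool" where
  "rep_iso m V W \<longleftrightarrow>
     (\<exists>\<phi>. bij_betw \<phi> (rep_space V) (rep_space W) \<and>
       (\<forall>x\<in>rep_space V. \<forall>y\<in>rep_space V. \<phi> (x + y) = \<phi> x + \<phi> y) \<and>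
       (\<forall>c. \<forall>x\<in>rep_space V. \<phi> (rep_scale V c x) = rep_scale W c (\<phi> x)) \<and>
       (\<forall>g\<in>sym m. \<forall>x\<in>rep_space V. \<phi> (rep_act V g x) = rep_act W g (\<phi> x)))"

definition trace_on :: "(rat \<Rightarrow> 'v \<Rightarrow> 'v) \<Rightarrow> 'v::ab_group_add set \<Rightarrow> ('v \<Rightarrow> 'v) \<Rightarrow> rat" where
  "trace_on scale V f =
     (let B = (SOME B. \<not> module.dependent scale B \<and> module.span scale B = V)
      in \<Sum>b\<in>B. module.representation scale B (f b) b)"

definition character :: "nat \<Rightarrow> 'v::ab_group_add rep \<Rightarrow> pfun" where
  "character m W =
     (\<lambda>g. if g \<in> sym m then trace_on (rep_scale W) (rep_space W) (rep_act W g) else 0)"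

definition partitions :: "nat \<Rightarrow> nat list set" where
  "partitions m = {\<mu>. sorted_wrt (\<ge>) \<mu> \<and> 0 \<notin> set \<mu> \<and> sum_list \<mu> = m}"

definition weight :: "nat list \<Rightarrow> nat" where
  "weight \<mu> = sum_list (tl \<mu>)"

text \<open>
  The simple module of \<open>\<mu>\<close> is the left ideal generated by the Young symmetrizer
  \<open>c = a b\<close> of the tableau in which the numbers \<open>1, \<dots>, m\<close> are entered row by row. Rows and
  columns are indexed from 0.
\<close>

definition tab_entry :: "nat list \<Rightarrow> nat \<Rightarrow> nat \<Rightarrow> nat" where
  "tab_entry \<mu> i j = sum_list (take i \<mu>) + j + 1"

definition tab_row :: "nat list \<Rightarrow> nat \<Rightarrow> nat set" where
  "tab_row \<mu> i = {tab_entry \<mu> i j | j. i < length \<mu> \<and> j < \<mu> ! i}"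

definition tab_col :: "nat list \<Rightarrow> nat \<Rightarrow> nat set" where
  "tab_col \<mu> j = {tab_entry \<mu> i j | i. i < length \<mu> \<and> j < \<mu> ! i}"

definition row_group :: "nat list \<Rightarrow> (nat \<Rightarrow> nat) set" where
  "row_group \<mu> = {p \<in> sym (sum_list \<mu>). \<forall>i. p ` tab_row \<mu> i = tab_row \<mu> i}"

definition col_group :: "nat list \<Rightarrow> (nat \<Rightarrow> nat) set" where
  "col_group \<mu> = {q \<in> sym (sum_list \<mu>). \<forall>j. q ` tab_col \<mu> j = tab_col \<mu> j}"

definition group_algebra :: "nat \<Rightarrow> pfun set" where
  "group_algebra m = {x. \<forall>g. g \<notin> sym m \<longrightarrow> x g = 0}"

definition conv :: "nat \<Rightarrow> pfun \<Rightarrow> pfun \<Rightarrow> pfun" where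
  "conv m x y = (\<lambda>g. \<Sum>h\<in>sym m. x h * y (inv h \<circ> g))"

definition row_symmetrizer :: "nat list \<Rightarrow> pfun" where
  "row_symmetrizer \<mu> = (\<lambda>g. if g \<in> row_group \<mu> then 1 else 0)"

definition col_antisymmetrizer :: "nat list \<Rightarrow> pfun" where
  "col_antisymmetrizer \<mu> = (\<lambda>g. if g \<in> col_group \<mu> then of_int (sign g) else 0)"

definition young_symmetrizer :: "nat list \<Rightarrow> pfun" where
  "young_symmetrizer \<mu> =
     conv (sum_list \<mu>) (row_symmetrizer \<mu>) (col_antisymmetrizer \<mu>)"

text \<open>Left multiplication by the group element \<open>g\<close> is \<open>x \<mapsto> (h \<mapsto> x (g\<inverse>h))\<close>.\<close>

definition simple_rep :: "nat list \<Rightarrow> pfun rep" where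
  "simple_rep \<mu> =
     \<lparr>rep_scale = pfun_scale,
      rep_space = (\<lambda>x. conv (sum_list \<mu>) x (young_symmetrizer \<mu>)) ` group_algebra (sum_list \<mu>),
      rep_act = (\<lambda>g x h. x (inv g \<circ> h))\<rparr>"

abbreviation simple_char :: "nat list \<Rightarrow> pfun" where
  "simple_char \<mu> \<equiv> character (sum_list \<mu>) (simple_rep \<mu>)"

text \<open>
  The external direct sum of \<open>n \<mu>\<close> copies of the simple module of \<open>\<mu>\<close>, for \<open>\<mu>\<close> running over the
  partitions of \<open>m\<close>: the component with index \<open>(\<mu>, i)\<close> is the \<open>i\<close>-th copy.
\<close>

definition sum_of_simples :: "nat \<Rightarrow> (nat list \<Rightarrow> nat) \<Rightarrow> (nat list \<times> nat \<Rightarrow> pfun) rep" where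
  "sum_of_simples m n =
     \<lparr>rep_scale = (\<lambda>c F k. pfun_scale c (F k)),
      rep_space = {F. \<forall>\<mu> i. if \<mu> \<in> partitions m \<and> i < n \<mu>
                            then F (\<mu>, i) \<in> rep_space (simple_rep \<mu>) else F (\<mu>, i) = 0},
      rep_act = (\<lambda>g F k. rep_act (simple_rep (fst k)) g (F k))\<rparr>"

definition multiplicity :: "nat \<Rightarrow> 'v::ab_group_add rep \<Rightarrow> nat list \<Rightarrow> nat" where
  "multiplicity m W =
     (THE n. (\<forall>\<mu>. \<mu> \<notin> partitions m \<longrightarrow> n \<mu> = 0) \<and> rep_iso m W (sum_of_simples m n))"

definition rep_weight :: "nat \<Rightarrow> 'v::ab_group_add rep \<Rightarrow> ereal" where
  "rep_weight m W =
     (SUP \<mu>\<in>{\<mu> \<in> partitions m. multiplicity m W \<mu> \<noteq> 0}. ereal (real (weight \<mu>)))"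

text \<open>
  Polynomials in \<open>y\<^sub>2, y\<^sub>3, \<dots>\<close> with coefficients in \<^typ>\<open>qpoly\<close>; here an index \<open>j\<close> of an exponent
  function stands for \<open>y\<^sub>j\<close>, without shift.
\<close>

type_synonym ypoly = "(nat \<Rightarrow>\<^sub>0 nat) \<Rightarrow>\<^sub>0 qpoly"

definition yvar :: "nat \<Rightarrow> ypoly" where
  "yvar j = Poly_Mapping.single (Poly_Mapping.single j 1) 1"

definition yconst :: "qpoly \<Rightarrow> ypoly" where
  "yconst P = Poly_Mapping.single 0 P"

definition qbinom :: "qpoly \<Rightarrow> nat \<Rightarrow> qpoly" where
  "qbinom P k = qconst (1 / fact k) * (\<Prod>i<k. P - of_nat i)"

text \<open>
  The formal power series is the coefficientwise limit of the polynomials obtained by truncating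
  the product over \<open>d \<ge> 1\<close> and the binomial series at \<open>N\<close>. Each coefficient is eventually constant
  in \<open>N\<close>, because \<open>(y\<^sub>2\<^sup>d + \<dots> + y\<^sub>\<ell>\<^sup>d)\<^sup>k\<close> is homogeneous of degree \<open>d k\<close>.
\<close>

definition frob_truncated :: "nat \<Rightarrow> nat \<Rightarrow> ypoly" where
  "frob_truncated l N =
     (\<Prod>(i, j)\<in>{(i, j). 2 \<le> i \<and> i < j \<and> j \<le> l}. yvar i - yvar j) *
     (\<Prod>j=2..l. 1 - yvar j) *
     (\<Prod>d=1..N. \<Sum>k\<le>N. yconst (qbinom (qvar d) k) * (\<Sum>j=2..l. yvar j ^ d) ^ k)"

definition frob_coeff :: "nat \<Rightarrow> (nat \<Rightarrow>\<^sub>0 nat) \<Rightarrow> qpoly" where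
  "frob_coeff l \<alpha> = (THE c. \<forall>\<^sub>F N in sequentially. Poly_Mapping.lookup (frob_truncated l N) \<alpha> = c)"

text \<open>The part \<open>\<mu>\<^sub>j\<close> is the list entry \<open>\<mu> ! (j - 1)\<close>.\<close>

definition frob_poly :: "nat list \<Rightarrow> qpoly" where
  "frob_poly \<mu> =
     (let l = length \<mu>
      in frob_coeff l (\<Sum>j=2..l. Poly_Mapping.single j (\<mu> ! (j - 1) + l - j)))"

definition rep_poly :: "nat \<Rightarrow> 'v::ab_group_add rep \<Rightarrow> qpoly" where
  "rep_poly m W = (\<Sum>\<mu>\<in>partitions m. of_nat (multiplicity m W \<mu>) * frob_poly \<mu>)"

end

theory Submission
  imports Defs "HOL-Computational_Algebra.Polynomial" "HOL-Library.Multiset"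
begin

text \<open>
  Everything rests on one fact: the Frobenius polynomial of a partition \<open>\<mu>\<close> of \<open>m\<close> has weight at most \<open>weight \<mu>\<close> and maps to
  the irreducible character of \<open>\<mu>\<close> (\<open>frob_poly_weight\<close>, \<open>rho_frob_poly_own\<close>), and the irreducible characters are orthonormal.

  Characters are computed from the Young symmetrizer \<open>c = a b\<close>. From \<open>c x c = \<kappa> c\<close> and \<open>c\<^sup>2 = n c\<close> with \<open>n \<noteq> 0\<close> one gets, by
  writing down a spanning family with coordinate forms for the left ideal of \<open>c\<close>, that the character at \<open>g\<close> is the sum of
  \<open>c (h\<^sup>-\<^sup>1 g\<^sup>-\<^sup>1 h) / n\<close> over \<open>h\<close>. Orthonormality is then an identity in the group algebra (\<open>simple_char_orthonormal\<close>).

  Frobenius' formula is proved without decomposing permutation modules. The product of power sums \<open>\<Prod> p\<^sub>d ^ X\<^sub>d(g)\<close> is the generating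
  function of the colourings of \<open>{1..m}\<close> fixed by \<open>g\<close>, sorted by the number of letters of each colour. Let \<open>\<omega>\<close> be the
  coefficient that the formula claims to be the character \<open>\<chi>\<close>. Counting fixed pairs of colourings
  turns \<open>\<langle>\<omega>|\<omega>\<rangle>\<close> into an alternating count of contingency tables, which Pieri's rule evaluates to 1; a
  transposition argument on tableaux gives \<open>\<langle>\<chi>|\<omega>\<rangle> = 1\<close>. As also \<open>\<langle>\<chi>|\<chi>\<rangle> = 1\<close>, the sum of squares of \<open>\<chi> - \<omega>\<close> is 0.

  The rest is counting. Functions of the cycle type form a space of dimension at most the number of partitions of \<open>m\<close>, so the
  characters are a basis of it (\<open>cycle_fun_expansion\<close>). Partitions of \<open>m\<close> of weight at most \<open>d\<close> correspond to socles of size at most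
  \<open>d\<close>, hence to monomials of weight at most \<open>d\<close>, exactly when \<open>2 d \<le> m\<close>. For such \<open>m\<close> the Frobenius polynomials are a
  basis of the polynomials of weight at most \<open>d\<close>, which gives the injectivity in (a); for \<open>2 d > m\<close> there are too many monomials.
  Using this basis for \<open>m = 2 d + 1\<close> and evaluating it on another symmetric group, (b)(i) and (b)(ii) become statements on
  colourings in which at most \<open>d\<close> letters avoid one distinguished colour: the average counts possible colour
  multiplicities, and a character whose first row is shorter than that colour class is killed by its stabilizer.

  Finally, expanding the indicator of the identity in characters writes 1 as a combination of conjugates of Young
  symmetrizers. Therefore a representation \<open>V\<close> is the direct sum of the left ideals of \<open>c\<^sub>\<mu>\<close>, each repeated \<open>dim (c\<^sub>\<mu> V)\<close> times
  (\<open>decomposition\<close>), its character determines the multiplicities, and (b)(iii) and (c) follow.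
\<close>

section \<open>The Vandermonde product\<close>

lemma permutes_lessThan_increasing_is_id:
  fixes w :: "nat \<Rightarrow> nat"
  assumes w: "w permutes {..<l}" and inc: "\<And>j. Suc j < l \<Longrightarrow> w j < w (Suc j)"
  shows "w = id"
proof (rule permutes_natset_ge[OF w])
  show "\<forall>i\<in>{..<l}. i \<le> w i"
  proof
    fix i assume "i \<in> {..<l}"
    then show "i \<le> w i"
    proof (induction i)
      case (Suc i)
      then show ?case using inc[of i] by force
    qed simp
  qed
qed

lemma sum_sign_unitriangular:
  fixes F :: "nat \<Rightarrow> nat \<Rightarrow> 'a::comm_ring_1"
  assumes diag: "\<And>k. k < l \<Longrightarrow> F k k = 1" and low: "\<And>k i. i < k \<Longrightarrow> F k i = 0"
  shows "(\<Sum>u | u permutes {..<l}. of_int (sign u) * (\<Prod>i<l. F (u i) i)) = 1"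
proof -
  have "(\<Sum>u | u permutes {..<l}. of_int (sign u) * (\<Prod>i<l. F (u i) i))
      = (\<Sum>u \<in> {id}. of_int (sign u) * (\<Prod>i<l. F (u i) i))"
  proof (rule sum.mono_neutral_right)
    show "\<forall>u\<in>{u. u permutes {..<l}} - {id}. of_int (sign u) * (\<Prod>i<l. F (u i) i) = 0"
    proof
      fix u assume u: "u \<in> {u. u permutes {..<l}} - {id}"
      then obtain i where "i < l" "i < u i"
        using permutes_natset_le[of u "{..<l}"] by (force simp: not_le)
      then have "(\<Prod>i<l. F (u i) i) = 0"
        using low by (intro prod_zero) auto
      then show "of_int (sign u) * (\<Prod>i<l. F (u i) i) = 0" by simp
    qed
  qed (auto simp: finite_permutations permutes_id)
  also have "\<dots> = 1" using diag by simp
  finally show ?thesis .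
qed

lemma double_zero_imp_zero:
  fixes x :: "'a::{idom,ring_char_0}"
  assumes "x = - x" shows "x = 0"
proof -
  have "2 * x = 0" using assms by (metis add.right_inverse mult_2)
  then show ?thesis by simp
qed

lemma sign_compose_transpose:
  assumes "w permutes S" "finite S" "a \<noteq> b"
  shows "sign (w \<circ> transpose a b) = - sign w"
proof -
  have "permutation w" using assms permutes_imp_permutation by blast
  then show ?thesis using assms by (simp add: sign_compose permutation_swap_id sign_swap_id)
qed

lemma sum_sign_repeated_column:
  fixes F :: "nat \<Rightarrow> nat \<Rightarrow> 'a::{idom,ring_char_0}"
  assumes ab: "a < l" "b < l" "a \<noteq> b" "\<phi> a = \<phi> b"
  shows "(\<Sum>w | w permutes {..<l}. of_int (sign w) * (\<Prod>j<l. F (w j) (\<phi> j))) = 0" (is "?S = 0")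
proof -
  let ?t = "transpose a b"
  have t: "?t permutes {..<l}" using ab by (intro permutes_swap_id) auto
  have "?S = (\<Sum>w | w permutes {..<l}. of_int (sign (w \<circ> ?t)) * (\<Prod>j<l. F ((w \<circ> ?t) j) (\<phi> j)))"
    by (rule sum_permutations_compose_right[OF t])
  also have "\<dots> = (\<Sum>w | w permutes {..<l}. - (of_int (sign w) * (\<Prod>j<l. F (w j) (\<phi> j))))"
  proof (rule sum.cong)
    fix w assume "w \<in> {w. w permutes {..<l}}"
    then have s: "sign (w \<circ> ?t) = - sign w"
      using ab by (intro sign_compose_transpose[of w "{..<l}"]) auto
    have "(\<Prod>j<l. F ((w \<circ> ?t) j) (\<phi> j)) = (\<Prod>j<l. F ((w \<circ> ?t) j) (\<phi> (?t j)))"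
      by (intro prod.cong) (auto simp: transpose_def ab)
    also have "\<dots> = (\<Prod>j<l. F (w j) (\<phi> j))"
      using prod.permute[OF t, of "\<lambda>j. F (w j) (\<phi> j)"] by (simp add: o_def)
    finally show "of_int (sign (w \<circ> ?t)) * (\<Prod>j<l. F ((w \<circ> ?t) j) (\<phi> j)) = - (of_int (sign w) * (\<Prod>j<l. F (w j) (\<phi> j)))"
      using s by simp
  qed simp
  also have "\<dots> = - ?S" by (simp add: sum_negf)
  finally show ?thesis by (rule double_zero_imp_zero)
qed

lemma sum_sign_permuted_columns:
  fixes F :: "nat \<Rightarrow> nat \<Rightarrow> 'a::{idom,ring_char_0}"
  assumes diag: "\<And>k. k < l \<Longrightarrow> F k k = 1" and low: "\<And>k i. i < k \<Longrightarrow> F k i = 0"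
    and \<phi>: "\<phi> permutes {..<l}"
  shows "(\<Sum>w | w permutes {..<l}. of_int (sign w) * (\<Prod>j<l. F (w j) (\<phi> j))) = of_int (sign \<phi>)"
proof -
  have "(\<Sum>w | w permutes {..<l}. of_int (sign w) * (\<Prod>j<l. F (w j) (\<phi> j)))
      = (\<Sum>u | u permutes {..<l}. of_int (sign (u \<circ> \<phi>)) * (\<Prod>j<l. F ((u \<circ> \<phi>) j) (\<phi> j)))"
    by (rule sum_permutations_compose_right[OF \<phi>])
  also have "\<dots> = (\<Sum>u | u permutes {..<l}. of_int (sign \<phi>) * (of_int (sign u) * (\<Prod>j<l. F (u j) j)))"
  proof (rule sum.cong)
    fix u assume "u \<in> {u. u permutes {..<l}}"
    then have s: "sign (u \<circ> \<phi>) = sign u * sign \<phi>"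
      using \<phi> by (intro sign_compose) (auto intro: permutes_imp_permutation[of "{..<l}"])
    have "(\<Prod>j<l. F ((u \<circ> \<phi>) j) (\<phi> j)) = (\<Prod>j<l. F (u j) j)"
      using prod.permute[OF \<phi>, of "\<lambda>j. F (u j) j"] by (simp add: o_def)
    then show "of_int (sign (u \<circ> \<phi>)) * (\<Prod>j<l. F ((u \<circ> \<phi>) j) (\<phi> j)) = of_int (sign \<phi>) * (of_int (sign u) * (\<Prod>j<l. F (u j) j))"
      using s by simp
  qed simp
  also have "\<dots> = of_int (sign \<phi>)"
    using sum_sign_unitriangular[of l F, OF diag low] by (simp flip: sum_distrib_left)
  finally show ?thesis .
qed

lemma coeff_prod_linear_factors:
  fixes z :: "nat \<Rightarrow> 'a::idom"
  shows "degree (\<Prod>i\<in>S. [:- z i, 1:]) = card S" "lead_coeff (\<Prod>i\<in>S. [:- z i, 1:]) = 1"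
proof -
  show deg: "degree (\<Prod>i\<in>S. [:- z i, 1:]) = card S"
    by (simp add: degree_prod_eq_sum_degree)
  show "lead_coeff (\<Prod>i\<in>S. [:- z i, 1:]) = 1"
    unfolding lead_coeff_prod by simp
qed

text \<open>
  The right-hand side is the determinant of the powers \<open>z\<^sub>j ^ (l - 1 - k)\<close>. Replacing the power with index \<open>k\<close> by the monic polynomial
  \<open>\<Prod>\<^sub>i\<^sub>>\<^sub>k (z - z\<^sub>i)\<close> of the same degree does not change it, since the change of basis is unitriangular, but makes the matrix triangular.
\<close>

lemma vandermonde_expansion:
  fixes z :: "nat \<Rightarrow> 'a::{idom,ring_char_0}"
  shows "(\<Prod>(i, j)\<in>{(i, j). i < j \<and> j < l}. z i - z j)
       = (\<Sum>w | w permutes {..<l}. of_int (sign w) * (\<Prod>j<l. z j ^ (l - 1 - w j)))"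
proof -
  define p where "p k = (\<Prod>i\<in>{k<..<l}. [:- z i, 1:])" for k
  define F where "F k i = (if i < l \<and> k < l then coeff (p k) (l - 1 - i) else 0)" for k i
  have degp: "degree (p k) = l - 1 - k" and leadp: "lead_coeff (p k) = 1" for k
    unfolding p_def using coeff_prod_linear_factors[of z "{k<..<l}"] by simp_all
  have diag: "F k k = 1" if "k < l" for k
    using leadp[of k] degp[of k] that by (simp add: F_def)
  have low: "F k i = 0" if "i < k" for k i
    using degp[of k] that by (auto simp: F_def intro!: coeff_eq_0)
  have poly_p: "poly (p k) x = (\<Sum>i<l. F k i * x ^ (l - 1 - i))" if "k < l" for k x
  proof -
    have "poly (p k) x = (\<Sum>i\<le>l - 1. coeff (p k) i * x ^ i)"
      unfolding poly_altdef using degp[of k] by (intro sum.mono_neutral_left) (auto simp: coeff_eq_0)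
    also have "\<dots> = (\<Sum>i<l. coeff (p k) i * x ^ i)"
      using that by (intro sum.cong) auto
    also have "\<dots> = (\<Sum>i<l. F k i * x ^ (l - 1 - i))"
      by (subst sum.nat_diff_reindex[symmetric]) (use that in \<open>simp add: F_def\<close>)
    finally show ?thesis .
  qed
  let ?P = "\<lambda>\<phi>. \<Prod>j<l. z j ^ (l - 1 - \<phi> j)"
  let ?E = "PiE {..<l} (\<lambda>_. {..<l})"
  have "(\<Sum>w | w permutes {..<l}. of_int (sign w) * (\<Prod>j<l. poly (p (w j)) (z j)))
      = (\<Sum>w | w permutes {..<l}. \<Sum>\<phi>\<in>?E. ?P \<phi> * (of_int (sign w) * (\<Prod>j<l. F (w j) (\<phi> j))))"
  proof (rule sum.cong)
    fix w assume "w \<in> {w. w permutes {..<l}}"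
    then have "w j < l" if "j < l" for j using permutes_in_image[of w "{..<l}" j] that by simp
    then have "(\<Prod>j<l. poly (p (w j)) (z j)) = (\<Prod>j<l. \<Sum>i<l. F (w j) i * z j ^ (l - 1 - i))"
      by (intro prod.cong) (auto simp: poly_p)
    also have "\<dots> = (\<Sum>\<phi>\<in>?E. \<Prod>j<l. F (w j) (\<phi> j) * z j ^ (l - 1 - \<phi> j))"
      by (subst prod_sum_PiE) auto
    finally show "of_int (sign w) * (\<Prod>j<l. poly (p (w j)) (z j)) = (\<Sum>\<phi>\<in>?E. ?P \<phi> * (of_int (sign w) * (\<Prod>j<l. F (w j) (\<phi> j))))"
      by (simp add: sum_distrib_left prod.distrib algebra_simps)
  qed simp
  also have "\<dots> = (\<Sum>\<phi>\<in>?E. ?P \<phi> * (\<Sum>w | w permutes {..<l}. of_int (sign w) * (\<Prod>j<l. F (w j) (\<phi> j))))"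
    by (subst sum.swap) (simp add: sum_distrib_left)
  also have "\<dots> = (\<Sum>\<phi>\<in>(\<lambda>w. restrict w {..<l}) ` {w. w permutes {..<l}}. ?P \<phi> * (\<Sum>w | w permutes {..<l}. of_int (sign w) * (\<Prod>j<l. F (w j) (\<phi> j))))"
  proof (rule sum.mono_neutral_right)
    show "\<forall>\<phi>\<in>?E - (\<lambda>w. restrict w {..<l}) ` {w. w permutes {..<l}}.
       ?P \<phi> * (\<Sum>w | w permutes {..<l}. of_int (sign w) * (\<Prod>j<l. F (w j) (\<phi> j))) = 0"
    proof
      fix \<phi> assume \<phi>: "\<phi> \<in> ?E - (\<lambda>w. restrict w {..<l}) ` {w. w permutes {..<l}}"
      have "\<not> inj_on \<phi> {..<l}"
      proof
        assume inj: "inj_on \<phi> {..<l}"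
        define w where "w j = (if j < l then \<phi> j else j)" for j
        have "\<phi> ` {..<l} = {..<l}" using \<phi> inj by (intro endo_inj_surj) auto
        then have "bij_betw w {..<l} {..<l}"
          using inj by (auto simp: bij_betw_def w_def inj_on_def)
        then have "w permutes {..<l}" by (rule bij_imp_permutes) (simp add: w_def)
        moreover have "\<phi> = restrict w {..<l}" using \<phi> by (auto simp: w_def fun_eq_iff PiE_def extensional_def)
        ultimately show False using \<phi> by auto
      qed
      then obtain a b where "a < l" "b < l" "a \<noteq> b" "\<phi> a = \<phi> b" by (auto simp: inj_on_def)
      then show "?P \<phi> * (\<Sum>w | w permutes {..<l}. of_int (sign w) * (\<Prod>j<l. F (w j) (\<phi> j))) = 0"
        by (simp add: sum_sign_repeated_column)
    qed
    show "(\<lambda>w. restrict w {..<l}) ` {w. w permutes {..<l}} \<subseteq> ?E"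
    proof (clarify, rule restrict_PiE_iff[THEN iffD2], clarify)
      fix w j assume "w permutes {..<l}" "j < l"
      then show "w j < l" using permutes_in_image[of w "{..<l}" j] by simp
    qed
  qed (auto intro: finite_PiE)
  also have "\<dots> = (\<Sum>u | u permutes {..<l}. ?P u * of_int (sign u))"
  proof (subst sum.reindex)
    show "inj_on (\<lambda>w. restrict w {..<l}) {w. w permutes {..<l}}"
      by (rule inj_onI, rule ext) (metis lessThan_iff mem_Collect_eq permutes_def restrict_apply')
    have "(\<Sum>w | w permutes {..<l}. of_int (sign w) * (\<Prod>j<l. F (w j) (restrict u {..<l} j))) = (of_int (sign u) :: 'a)"
      if "u permutes {..<l}" for u
      using sum_sign_permuted_columns[of l F u, OF diag low that] by simp
    then show "sum ((\<lambda>\<phi>. ?P \<phi> * (\<Sum>w | w permutes {..<l}. of_int (sign w) * (\<Prod>j<l. F (w j) (\<phi> j)))) \<circ> (\<lambda>w. restrict w {..<l})) {w. w permutes {..<l}} = (\<Sum>u | u permutes {..<l}. ?P u * of_int (sign u))"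
      by (intro sum.cong) (auto simp: o_def)
  qed
  finally have expand: "(\<Sum>w | w permutes {..<l}. of_int (sign w) * (\<Prod>j<l. poly (p (w j)) (z j)))
      = (\<Sum>u | u permutes {..<l}. of_int (sign u) * ?P u)" by (simp add: mult.commute)
  have "(\<Sum>w | w permutes {..<l}. of_int (sign w) * (\<Prod>j<l. poly (p (w j)) (z j)))
     = (\<Sum>w \<in> {id}. of_int (sign w) * (\<Prod>j<l. poly (p (w j)) (z j)))"
  proof (rule sum.mono_neutral_right)
    show "\<forall>w\<in>{w. w permutes {..<l}} - {id}. of_int (sign w) * (\<Prod>j<l. poly (p (w j)) (z j)) = 0"
    proof
      fix w assume w: "w \<in> {w. w permutes {..<l}} - {id}"
      then obtain j where "j < l" "w j < j"
        using permutes_natset_ge[of w "{..<l}"] by (force simp: not_le)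
      then have "poly (p (w j)) (z j) = 0"
        by (auto simp: p_def poly_prod intro!: prod_zero)
      then have "(\<Prod>j<l. poly (p (w j)) (z j)) = 0"
        using \<open>j < l\<close> by (intro prod_zero) auto
      then show "of_int (sign w) * (\<Prod>j<l. poly (p (w j)) (z j)) = 0" by simp
    qed
  qed (auto simp: finite_permutations permutes_id)
  also have "\<dots> = (\<Prod>j<l. \<Prod>i\<in>{j<..<l}. z j - z i)"
    by (simp add: p_def poly_prod)
  also have "\<dots> = (\<Prod>(i, j)\<in>(SIGMA i:{..<l}. {i<..<l}). z i - z j)"
    by (subst prod.Sigma) auto
  also have "(SIGMA i:{..<l}. {i<..<l}) = {(i, j). i < j \<and> j < l}" by auto
  finally show ?thesis using expand by simp
qed


section \<open>Alternating sums of contingency tables\<close>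

definition staircase :: "nat \<Rightarrow> nat \<Rightarrow> int" where
  "staircase l j = int (l - 1 - j)"

text \<open>
  The coefficient of \<open>z\<^sup>\<beta>\<close> in the Vandermonde product. Exponents are integers, so that an exponent vector with
  a negative entry simply has coefficient 0 and differences need no side conditions.
\<close>

definition alternant_coeff :: "nat \<Rightarrow> (nat \<Rightarrow> int) \<Rightarrow> int" where
  "alternant_coeff l \<beta> = (\<Sum>w | w permutes {..<l}. if \<beta> = staircase l \<circ> w then sign w else 0)"

definition compositions :: "nat \<Rightarrow> int \<Rightarrow> (nat \<Rightarrow> int) set" where
  "compositions l r = {c. (\<forall>j. 0 \<le> c j) \<and> (\<forall>j\<ge>l. c j = 0) \<and> (\<Sum>j<l. c j) = r}"

text \<open>
  The coefficient of \<open>z\<^sup>\<gamma>\<close> in the Vandermonde product times the complete homogeneous symmetric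
  polynomials of degrees \<open>\<alpha> 0, \<dots>, \<alpha> (k - 1)\<close>.
\<close>

primrec alternant_h_coeff :: "nat \<Rightarrow> (nat \<Rightarrow> int) \<Rightarrow> nat \<Rightarrow> (nat \<Rightarrow> int) \<Rightarrow> int" where
  "alternant_h_coeff l \<alpha> 0 \<gamma> = alternant_coeff l \<gamma>"
| "alternant_h_coeff l \<alpha> (Suc k) \<gamma> = (\<Sum>c\<in>compositions l (\<alpha> k). alternant_h_coeff l \<alpha> k (\<gamma> - c))"

lemma staircase_strict: "\<lbrakk>i < j; j < l\<rbrakk> \<Longrightarrow> staircase l j < staircase l i"
  by (simp add: staircase_def)

lemma finite_compositions: "finite (compositions l r)"
proof -
  let ?B = "PiE_dflt {..<l} 0 (\<lambda>_. {0..r})"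
  have "c j \<le> r" if c: "c \<in> compositions l r" and "j < l" for c j
  proof -
    have "c j \<le> (\<Sum>j<l. c j)"
      using c that(2) by (intro member_le_sum) (auto simp: compositions_def)
    then show ?thesis using c by (simp add: compositions_def)
  qed
  then have "compositions l r \<subseteq> (\<lambda>f j. if j < l then f j else 0) ` PiE {..<l} (\<lambda>_. {0..r})"
    by (intro subsetI, rule_tac x="restrict x {..<l}" in image_eqI) (auto simp: compositions_def)
  then show ?thesis by (rule finite_subset) (auto intro: finite_PiE)
qed

lemma alternant_coeff_swap:
  assumes ab: "a < l" "b < l" "a \<noteq> b"
  shows "alternant_coeff l (\<beta> \<circ> transpose a b) = - alternant_coeff l \<beta>"
proof -
  let ?t = "transpose a b"
  have t: "?t permutes {..<l}" using ab by (intro permutes_swap_id) auto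
  have tt: "f \<circ> ?t \<circ> ?t = f" for f :: "nat \<Rightarrow> 'x" by (simp add: comp_assoc)
  have "alternant_coeff l (\<beta> \<circ> ?t) = (\<Sum>w | w permutes {..<l}. if \<beta> \<circ> ?t = staircase l \<circ> (w \<circ> ?t) then sign (w \<circ> ?t) else 0)"
    unfolding alternant_coeff_def by (rule sum_permutations_compose_right[OF t])
  also have "\<dots> = (\<Sum>w | w permutes {..<l}. - (if \<beta> = staircase l \<circ> w then sign w else 0))"
  proof (rule sum.cong)
    fix w assume "w \<in> {w. w permutes {..<l}}"
    then have s: "sign (w \<circ> ?t) = - sign w"
      using ab by (intro sign_compose_transpose[of w "{..<l}"]) auto
    have "\<beta> \<circ> ?t = staircase l \<circ> (w \<circ> ?t) \<longleftrightarrow> \<beta> = staircase l \<circ> w"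
      by (metis comp_assoc tt)
    then show "(if \<beta> \<circ> ?t = staircase l \<circ> (w \<circ> ?t) then sign (w \<circ> ?t) else 0) = - (if \<beta> = staircase l \<circ> w then sign w else 0)"
      using s by simp
  qed simp
  finally show ?thesis by (simp add: alternant_coeff_def sum_negf)
qed

lemma compositions_permute:
  assumes "t permutes {..<l}" "c \<in> compositions l r"
  shows "c \<circ> t \<in> compositions l r"
proof -
  have "(\<Sum>j<l. c (t j)) = (\<Sum>j<l. c j)"
    using sum.permute[OF assms(1), of c] by (simp add: o_def)
  then show ?thesis using assms by (auto simp: compositions_def permutes_def)
qed

lemma alternant_h_coeff_swap:
  assumes ab: "a < l" "b < l" "a \<noteq> b"
  shows "alternant_h_coeff l \<alpha> k (\<gamma> \<circ> transpose a b) = - alternant_h_coeff l \<alpha> k \<gamma>"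
proof (induction k arbitrary: \<gamma>)
  case 0
  then show ?case by (simp only: alternant_h_coeff.simps alternant_coeff_swap[OF ab])
next
  case (Suc k)
  let ?t = "transpose a b"
  have t: "?t permutes {..<l}" using ab by (intro permutes_swap_id) auto
  have "(\<Sum>c\<in>compositions l (\<alpha> k). alternant_h_coeff l \<alpha> k ((\<gamma> \<circ> ?t) - c))
      = (\<Sum>c\<in>compositions l (\<alpha> k). alternant_h_coeff l \<alpha> k ((\<gamma> - c) \<circ> ?t))"
    by (rule sum.reindex_bij_witness[where i = "\<lambda>c. c \<circ> ?t" and j = "\<lambda>c. c \<circ> ?t"])
       (auto simp: compositions_permute[OF t] comp_assoc intro!: arg_cong[where f="alternant_h_coeff l \<alpha> k"])
  then show ?case by (simp only: alternant_h_coeff.simps Suc sum_negf)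
qed

text \<open>
  Pieri's rule: swapping the entries \<open>a\<close> and \<open>a + 1\<close> of \<open>\<gamma> - c\<close> at the first \<open>a\<close> violating the interlacing condition is an involution
  on the violating \<open>c\<close>, because the condition at smaller indices does not see these entries of \<open>c\<close>; it changes the sign of the summand.
\<close>

lemma alternant_h_coeff_interlacing:
  fixes \<gamma> :: "nat \<Rightarrow> int"
  assumes dec: "\<And>j. Suc j < l \<Longrightarrow> \<gamma> (Suc j) < \<gamma> j"
  shows "alternant_h_coeff l \<alpha> (Suc k) \<gamma> =
    (\<Sum>c | c \<in> compositions l (\<alpha> k) \<and> (\<forall>a. Suc a < l \<longrightarrow> \<gamma> (Suc a) < \<gamma> a - c a). alternant_h_coeff l \<alpha> k (\<gamma> - c))"
proof -
  let ?T = "alternant_h_coeff l \<alpha> k"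
  let ?C = "compositions l (\<alpha> k)"
  define bad where "bad c a \<longleftrightarrow> Suc a < l \<and> \<gamma> a - c a \<le> \<gamma> (Suc a)" for c a
  define B where "B = {c \<in> ?C. \<exists>a. bad c a}"
  define \<Phi> where "\<Phi> c = (let a = LEAST a. bad c a in \<gamma> - ((\<gamma> - c) \<circ> transpose a (Suc a)))" for c
  have step: "\<Phi> c \<in> B \<and> \<Phi> (\<Phi> c) = c \<and> ?T (\<gamma> - \<Phi> c) = - ?T (\<gamma> - c)" if c: "c \<in> B" for c
  proof -
    define a where "a = (LEAST a. bad c a)"
    have bad: "bad c a" unfolding a_def using c by (auto simp: B_def intro: LeastI)
    have least: "\<not> bad c x" if "x < a" for x using not_less_Least that unfolding a_def by blast
    define c' where "c' = \<gamma> - ((\<gamma> - c) \<circ> transpose a (Suc a))"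
    have \<Phi>c: "\<Phi> c = c'" by (simp add: \<Phi>_def c'_def a_def Let_def)
    have al: "Suc a < l" using bad by (simp add: bad_def)
    have t: "transpose a (Suc a) permutes {..<l}" using al by (intro permutes_swap_id) auto
    have cC: "c \<in> ?C" using c by (simp add: B_def)
    have c'a: "c' a = \<gamma> a - \<gamma> (Suc a) + c (Suc a)" "c' (Suc a) = \<gamma> (Suc a) - \<gamma> a + c a"
      by (simp_all add: c'_def)
    have c'o: "c' j = c j" if "j \<noteq> a" "j \<noteq> Suc a" for j
      using that by (simp add: c'_def transpose_def)
    have nonneg: "0 \<le> c' j" for j
      using c'a c'o[of j] cC bad dec[OF al] by (cases "j = a"; cases "j = Suc a") (auto simp: compositions_def bad_def add_nonneg_nonneg)
    have "(\<Sum>j<l. c' j) = (\<Sum>j<l. \<gamma> j) - (\<Sum>j<l. (\<gamma> - c) (transpose a (Suc a) j))"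
      by (simp add: c'_def sum_subtractf)
    also have "(\<Sum>j<l. (\<gamma> - c) (transpose a (Suc a) j)) = (\<Sum>j<l. (\<gamma> - c) j)"
      using sum.permute[OF t, of "\<gamma> - c"] by (simp add: o_def)
    finally have "(\<Sum>j<l. c' j) = (\<Sum>j<l. c j)" by (simp add: sum_subtractf)
    then have c'C: "c' \<in> ?C" using nonneg c'o cC al by (auto simp: compositions_def)
    have bad': "bad c' a" using cC al c'a by (auto simp: bad_def compositions_def)
    have least': "\<not> bad c' x" if "x < a" for x
      using least[OF that] c'o[of x] that by (auto simp: bad_def)
    have La: "(LEAST a. bad c' a) = a"
      by (rule Least_equality) (use bad' least' in \<open>auto simp: not_less[symmetric]\<close>)
    have gc': "\<gamma> - c' = (\<gamma> - c) \<circ> transpose a (Suc a)" by (simp add: c'_def)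
    have "\<Phi> c' = \<gamma> - ((\<gamma> - c') \<circ> transpose a (Suc a))" by (simp add: \<Phi>_def La Let_def)
    also have "\<dots> = c" unfolding gc' by (simp add: comp_assoc)
    finally have "\<Phi> c' = c" .
    moreover have "?T (\<gamma> - c') = - ?T (\<gamma> - c)"
      unfolding gc' using al by (intro alternant_h_coeff_swap) auto
    ultimately show ?thesis using c'C bad' by (auto simp: \<Phi>c B_def)
  qed
  have "(\<Sum>c\<in>B. ?T (\<gamma> - c)) = (\<Sum>c\<in>B. - ?T (\<gamma> - c))"
    by (rule sum.reindex_bij_witness[where i = \<Phi> and j = \<Phi>]) (use step in auto)
  then have zero: "(\<Sum>c\<in>B. ?T (\<gamma> - c)) = 0" by (simp add: sum_negf)
  have "alternant_h_coeff l \<alpha> (Suc k) \<gamma> = (\<Sum>c\<in>B. ?T (\<gamma> - c)) + (\<Sum>c\<in>?C - B. ?T (\<gamma> - c))"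
    using sum.subset_diff[of B ?C "\<lambda>c. ?T (\<gamma> - c)"] finite_compositions by (simp add: B_def add.commute)
  also have "?C - B = {c \<in> ?C. \<forall>a. Suc a < l \<longrightarrow> \<gamma> (Suc a) < \<gamma> a - c a}"
    by (auto simp: B_def bad_def not_le)
  finally show ?thesis unfolding zero by (simp only: add_0_left)
qed

lemma alternant_coeff_decreasing:
  assumes dec: "\<And>j. Suc j < l \<Longrightarrow> \<gamma> (Suc j) < \<gamma> j" and nz: "alternant_coeff l \<gamma> \<noteq> 0"
  shows "\<gamma> = staircase l"
proof -
  obtain w where w: "w permutes {..<l}" and \<gamma>: "\<gamma> = staircase l \<circ> w"
  proof -
    obtain w where "w \<in> {w. w permutes {..<l}}" "(if \<gamma> = staircase l \<circ> w then sign w else 0) \<noteq> 0"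
      using sum.not_neutral_contains_not_neutral[OF nz[unfolded alternant_coeff_def]] .
    then show thesis using that by (metis mem_Collect_eq)
  qed
  have "w j < w (Suc j)" if "Suc j < l" for j
    using dec[OF that] \<gamma> by (auto simp: staircase_def)
  then have "w = id" by (rule permutes_lessThan_increasing_is_id[OF w])
  then show ?thesis using \<gamma> by simp
qed

lemma staircase_permute_eq_iff:
  assumes w: "w permutes {..<l}"
  shows "staircase l = staircase l \<circ> w \<longleftrightarrow> w = id"
proof
  assume eq: "staircase l = staircase l \<circ> w"
  show "w = id"
  proof
    fix j show "w j = id j"
    proof (cases "j < l")
      case True
      then have "w j < l" using permutes_in_image[OF w] by simp
      moreover have "staircase l j = staircase l (w j)" using eq by (metis comp_apply)
      ultimately show ?thesis using True by (simp add: staircase_def)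
    qed (use w in \<open>simp add: permutes_def\<close>)
  qed
qed simp

lemma alternant_coeff_staircase: "alternant_coeff l (staircase l) = 1"
proof -
  have "alternant_coeff l (staircase l) = (\<Sum>w | w permutes {..<l}. if w = id then 1 else 0)"
    unfolding alternant_coeff_def by (intro sum.cong) (auto simp: staircase_permute_eq_iff)
  also have "\<dots> = 1" by (simp add: sum.delta' finite_permutations permutes_id)
  finally show ?thesis .
qed

text \<open>
  Interlacing lets each homogeneous factor enlarge only one row beyond those enlarged before. So after \<open>k\<close> factors the rows from \<open>k\<close>
  on are still those of the staircase, all boxes added by the first \<open>i\<close> factors lie in the first \<open>i\<close> rows, and later factors only add boxes.
\<close>

lemma alternant_h_coeff_nonzero:
  fixes \<gamma> :: "nat \<Rightarrow> int"
  assumes "\<And>j. Suc j < l \<Longrightarrow> \<gamma> (Suc j) < \<gamma> j" and "alternant_h_coeff l \<alpha> k \<gamma> \<noteq> 0"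
  shows "(\<forall>j. k \<le> j \<and> j < l \<longrightarrow> \<gamma> j = staircase l j) \<and>
    (\<Sum>j<l. \<gamma> j) = (\<Sum>j<l. staircase l j) + (\<Sum>j<k. \<alpha> j) \<and>
    (\<forall>i\<le>k. i \<le> l \<longrightarrow> (\<Sum>j<i. staircase l j + \<alpha> j) \<le> (\<Sum>j<i. \<gamma> j))"
  using assms
proof (induction k arbitrary: \<gamma>)
  case 0
  then have "\<gamma> = staircase l" using alternant_coeff_decreasing[of l \<gamma>] by simp
  then show ?case by simp
next
  case (Suc k)
  note dec = Suc.prems(1)
  obtain c where c: "c \<in> compositions l (\<alpha> k)" and good: "\<And>a. Suc a < l \<Longrightarrow> \<gamma> (Suc a) < \<gamma> a - c a"
    and nz: "alternant_h_coeff l \<alpha> k (\<gamma> - c) \<noteq> 0"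
  proof -
    have "(\<Sum>c | c \<in> compositions l (\<alpha> k) \<and> (\<forall>a. Suc a < l \<longrightarrow> \<gamma> (Suc a) < \<gamma> a - c a). alternant_h_coeff l \<alpha> k (\<gamma> - c)) \<noteq> 0"
      using Suc.prems(2) alternant_h_coeff_interlacing[of l \<gamma> \<alpha> k, OF dec] by (simp only: not_False_eq_True)
    then show thesis using that sum.not_neutral_contains_not_neutral by blast
  qed
  have c0: "0 \<le> c j" for j using c by (simp add: compositions_def)
  have decB: "(\<gamma> - c) (Suc j) < (\<gamma> - c) j" if "Suc j < l" for j
    using good[OF that] c0[of "Suc j"] by simp
  note IH = Suc.IH[OF decB nz]
  have top: "\<gamma> j = staircase l j" if j: "Suc k \<le> j" "j < l" for j
  proof -
    obtain i where i: "j = Suc i" "k \<le> i" using j by (cases j) auto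
    have "staircase l i = \<gamma> i - c i" "staircase l j = \<gamma> j - c j" using IH i j by auto
    with good[of i] c0[of j] i j show ?thesis by (auto simp: staircase_def of_nat_diff)
  qed
  have tot: "(\<Sum>j<l. \<gamma> j) = (\<Sum>j<l. staircase l j) + (\<Sum>j<Suc k. \<alpha> j)"
    using IH c by (simp add: compositions_def sum_subtractf)
  have "(\<Sum>j<i. staircase l j + \<alpha> j) \<le> (\<Sum>j<i. \<gamma> j)" if i: "i \<le> Suc k" "i \<le> l" for i
  proof (cases "i = Suc k")
    case False
    then have "(\<Sum>j<i. staircase l j + \<alpha> j) \<le> (\<Sum>j<i. (\<gamma> - c) j)" using IH i by simp
    also have "\<dots> \<le> (\<Sum>j<i. \<gamma> j)" using c0 by (intro sum_mono) simp
    finally show ?thesis .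
  next
    case True
    have split: "(\<Sum>j<l. f j) = (\<Sum>j<i. f j) + (\<Sum>j\<in>{i..<l}. f j)" for f :: "nat \<Rightarrow> int"
      using i by (metis sum.atLeastLessThan_concat lessThan_atLeast0 le0)
    have "(\<Sum>j\<in>{i..<l}. \<gamma> j) = (\<Sum>j\<in>{i..<l}. staircase l j)"
      using top True by (intro sum.cong) auto
    then show ?thesis using tot split[of \<gamma>] split[of "staircase l"] True by (simp add: sum.distrib)
  qed
  with top tot show ?case by blast
qed

text \<open>
  For weakly decreasing degrees there is exactly one way to fill the diagram: factor \<open>k\<close> must supply the whole row \<open>k\<close>.
\<close>

lemma alternant_h_coeff_self:
  fixes \<mu> :: "nat \<Rightarrow> int"
  assumes mono: "\<And>i j. i \<le> j \<Longrightarrow> \<mu> j \<le> \<mu> i" and nonneg: "\<And>j. 0 \<le> \<mu> j" and "k \<le> l"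
  shows "alternant_h_coeff l \<mu> k (\<lambda>j. staircase l j + (if j < k then \<mu> j else 0)) = 1"
  using \<open>k \<le> l\<close>
proof (induction k)
  case 0
  then show ?case using alternant_coeff_staircase by simp
next
  case (Suc k)
  define \<gamma> where "\<gamma> k j = staircase l j + (if j < k then \<mu> j else 0)" for k j
  have dec: "\<gamma> k (Suc j) < \<gamma> k j" if "Suc j < l" for j k
    using staircase_strict[of j "Suc j" l] that mono[of j "Suc j"] nonneg[of j] by (auto simp: \<gamma>_def)
  define e where "e j = (if j = k then \<mu> k else 0)" for j
  let ?G = "{c. c \<in> compositions l (\<mu> k) \<and> (\<forall>a. Suc a < l \<longrightarrow> \<gamma> (Suc k) (Suc a) < \<gamma> (Suc k) a - c a)}"
  have \<gamma>e: "\<gamma> (Suc k) - e = \<gamma> k" by (auto simp: fun_eq_iff \<gamma>_def e_def)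
  have "(\<Sum>j<l. e j) = \<mu> k" using Suc.prems by (simp add: e_def)
  then have "e \<in> compositions l (\<mu> k)"
    using nonneg Suc.prems by (auto simp: compositions_def e_def)
  moreover have "\<gamma> (Suc k) (Suc a) < \<gamma> (Suc k) a - e a" if "Suc a < l" for a
    using staircase_strict[of a "Suc a" l] that mono[of a "Suc a"] nonneg[of a]
    by (auto simp: \<gamma>_def e_def)
  ultimately have eG: "e \<in> ?G" by blast
  have "alternant_h_coeff l \<mu> (Suc k) (\<gamma> (Suc k)) = (\<Sum>c\<in>?G. alternant_h_coeff l \<mu> k (\<gamma> (Suc k) - c))"
    by (rule alternant_h_coeff_interlacing) (rule dec)
  also have "\<dots> = (\<Sum>c\<in>{e}. alternant_h_coeff l \<mu> k (\<gamma> (Suc k) - c))"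
  proof (rule sum.mono_neutral_right)
    show "\<forall>c\<in>?G - {e}. alternant_h_coeff l \<mu> k (\<gamma> (Suc k) - c) = 0"
    proof (rule ballI, rule ccontr)
      fix c assume c: "c \<in> ?G - {e}" and nz: "alternant_h_coeff l \<mu> k (\<gamma> (Suc k) - c) \<noteq> 0"
      then have c0: "0 \<le> c j" and ctop: "j \<ge> l \<Longrightarrow> c j = 0" and csum: "(\<Sum>j<l. c j) = \<mu> k" for j by (auto simp: compositions_def)
      have decB: "(\<gamma> (Suc k) - c) (Suc j) < (\<gamma> (Suc k) - c) j" if "Suc j < l" for j
        using c that c0[of "Suc j"] by fastforce
      from alternant_h_coeff_nonzero[OF decB nz]
      have tail: "\<gamma> (Suc k) j - c j = staircase l j" if "k \<le> j" "j < l" for j using that by simp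
      have ck: "c k = \<mu> k" using tail[of k] Suc.prems by (simp add: \<gamma>_def)
      have "(\<Sum>j<l. c j) = c k + (\<Sum>j\<in>{..<l} - {k}. c j)"
        using Suc.prems by (intro sum.remove) auto
      then have "(\<Sum>j\<in>{..<l} - {k}. c j) = 0" using csum ck by simp
      then have "c j = 0" if "j < l" "j \<noteq> k" for j
        using c0 that by (subst (asm) sum_nonneg_eq_0_iff) auto
      then have "c j = e j" for j using ck ctop[of j] Suc.prems by (cases "j < l") (auto simp: e_def)
      then show False using c by auto
    qed
  qed (use eG finite_compositions in auto)
  also have "\<dots> = 1" using Suc \<gamma>e by (simp add: \<gamma>_def[abs_def])
  finally show ?case by (simp add: \<gamma>_def[abs_def])
qed

lemma staircase_permuted_partial_sums:
  assumes w: "w permutes {..<l}"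
    and ge: "\<And>i. i \<le> l \<Longrightarrow> (\<Sum>j<i. staircase l j) \<le> (\<Sum>j<i. staircase l (w j))"
  shows "w = id"
proof -
  have eq: "i < l \<Longrightarrow> w i = i" for i
  proof (induction i rule: less_induct)
    case (less i)
    then have IH: "w j = j" if "j < i" for j using that by simp
    have "(\<Sum>j<i. staircase l (w j)) = (\<Sum>j<i. staircase l j)" using IH by simp
    then have "staircase l i \<le> staircase l (w i)" using ge[of "Suc i"] less.prems by simp
    moreover have wi: "w i < l" using permutes_in_image[OF w] less.prems by simp
    ultimately have "w i \<le> i" using less.prems by (auto simp: staircase_def)
    moreover have "\<not> w i < i"
      using IH permutes_inj[OF w] by (metis injD less_irrefl)
    ultimately show ?case by simp
  qed
  show ?thesis using eq w by (auto simp: fun_eq_iff permutes_def)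
qed

text \<open>
  By the dominance bound a permutation \<open>w\<close> contributes only if the partial sums of the permuted staircase are as large as those of
  the staircase itself, which forces \<open>w = id\<close>. In terms of Schur functions the lemma says \<open>\<langle>s\<^sub>\<mu>|s\<^sub>\<mu>\<rangle> = 1\<close>, with one
  of the two factors expanded by the Jacobi-Trudi formula.
\<close>

lemma alternating_table_sum:
  fixes \<mu> :: "nat \<Rightarrow> int"
  assumes mono: "\<And>i j. i \<le> j \<Longrightarrow> \<mu> j \<le> \<mu> i" and nonneg: "\<And>j. 0 \<le> \<mu> j" and top: "\<And>j. l \<le> j \<Longrightarrow> \<mu> j = 0"
  defines "\<gamma> \<equiv> \<mu> + staircase l"
  shows "(\<Sum>w | w permutes {..<l}. sign w * alternant_h_coeff l (\<gamma> - (staircase l \<circ> w)) l \<gamma>) = 1"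
proof -
  have dec: "\<gamma> (Suc j) < \<gamma> j" if "Suc j < l" for j
    using staircase_strict[of j "Suc j" l] that mono[of j "Suc j"] by (auto simp: \<gamma>_def)
  have "(\<Sum>w | w permutes {..<l}. sign w * alternant_h_coeff l (\<gamma> - (staircase l \<circ> w)) l \<gamma>)
     = (\<Sum>w \<in> {id}. sign w * alternant_h_coeff l (\<gamma> - (staircase l \<circ> w)) l \<gamma>)"
  proof (rule sum.mono_neutral_right)
    show "\<forall>w\<in>{w. w permutes {..<l}} - {id}. sign w * alternant_h_coeff l (\<gamma> - (staircase l \<circ> w)) l \<gamma> = 0"
    proof (rule ballI, rule ccontr)
      fix w assume w: "w \<in> {w. w permutes {..<l}} - {id}"
        and nz: "sign w * alternant_h_coeff l (\<gamma> - (staircase l \<circ> w)) l \<gamma> \<noteq> 0"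
      have "(\<Sum>j<i. staircase l j + (\<gamma> - (staircase l \<circ> w)) j) \<le> (\<Sum>j<i. \<gamma> j)" if "i \<le> l" for i
        using alternant_h_coeff_nonzero[of l \<gamma> "\<gamma> - (staircase l \<circ> w)" l, OF dec] nz that by auto
      then have "w = id" using w
        by (intro staircase_permuted_partial_sums[of w l]) (auto simp: sum.distrib sum_subtractf)
      with w show False by simp
    qed
  qed (auto simp: finite_permutations permutes_id)
  also have "\<dots> = alternant_h_coeff l \<mu> l \<gamma>" by (simp add: \<gamma>_def)
  also have "alternant_h_coeff l \<mu> l \<gamma> = 1"
  proof -
    have "\<gamma> = (\<lambda>j. staircase l j + (if j < l then \<mu> j else 0))"
      using top by (auto simp: \<gamma>_def fun_eq_iff)
    then show ?thesis using alternant_h_coeff_self[of \<mu> l l, OF mono nonneg] by simp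
  qed
  finally show ?thesis .
qed

lemma alternant_h_coeff_unroll:
  "alternant_h_coeff l \<alpha> k \<gamma> = (\<Sum>M\<in>PiE {..<k} (\<lambda>i. compositions l (\<alpha> i)). alternant_coeff l (\<gamma> - (\<Sum>i<k. M i)))"
proof (induction k arbitrary: \<gamma>)
  case (Suc k)
  let ?P = "PiE {..<k} (\<lambda>i. compositions l (\<alpha> i))"
  have "(\<Sum>M\<in>PiE {..<Suc k} (\<lambda>i. compositions l (\<alpha> i)). alternant_coeff l (\<gamma> - (\<Sum>i<Suc k. M i)))
     = (\<Sum>(c, M)\<in>compositions l (\<alpha> k) \<times> ?P. alternant_coeff l (\<gamma> - (\<Sum>i<Suc k. (M(k := c)) i)))"
    unfolding lessThan_Suc PiE_insert_eq
  proof (subst sum.reindex)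
    show "inj_on (\<lambda>(y, g). g(k := y)) (compositions l (\<alpha> k) \<times> ?P)"
      by (rule inj_combinator) simp
  qed (simp add: o_def case_prod_unfold)
  also have "\<dots> = (\<Sum>(c, M)\<in>compositions l (\<alpha> k) \<times> ?P. alternant_coeff l (\<gamma> - c - (\<Sum>i<k. M i)))"
    by (intro sum.cong) (auto simp: algebra_simps)
  also have "\<dots> = (\<Sum>c\<in>compositions l (\<alpha> k). alternant_h_coeff l \<alpha> k (\<gamma> - c))"
    by (simp only: Suc sum.cartesian_product)
  finally show ?case by (simp only: alternant_h_coeff.simps)
qed simp

section \<open>The group algebra of the symmetric group\<close>

definition star :: "pfun \<Rightarrow> pfun" where
  "star x = (\<lambda>g. x (inv g))"

text \<open>
  The set \<open>{1..m}\<close> and its symmetric group are kept as constants, so that membership in them is not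
  rewritten into inequalities and \<open>permutes\<close>.
\<close>

definition letters :: "nat \<Rightarrow> nat set" where
  "letters m = {1..m}"

definition perms :: "nat \<Rightarrow> (nat \<Rightarrow> nat) set" where
  "perms m = {g. g permutes letters m}"

lemma sym_perms: "sym m = perms m"
  by (simp add: perms_def letters_def)

lemma finite_letters [simp]: "finite (letters m)" and card_letters [simp]: "card (letters m) = m"
  by (simp_all add: letters_def)

lemma perms_permutes: "g \<in> perms m \<longleftrightarrow> g permutes letters m"
  by (simp add: perms_def)

lemma conv_eq: "conv m x y = (\<lambda>g. \<Sum>h\<in>perms m. x h * y (inv h \<circ> g))"
  unfolding conv_def sym_perms ..

lemma group_algebra_eq: "group_algebra m = {x. \<forall>g. g \<notin> perms m \<longrightarrow> x g = 0}"
  unfolding group_algebra_def sym_perms ..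

text \<open>
  Row and column groups are the stabilizers of the colourings of the letters by their row and by their column.
\<close>

definition stab :: "nat \<Rightarrow> (nat \<Rightarrow> 'c) \<Rightarrow> (nat \<Rightarrow> nat) set" where
  "stab m f = {p \<in> perms m. \<forall>x\<in>letters m. f (p x) = f x}"

lemma finite_sym [simp]: "finite (perms m)"
  by (simp add: perms_def finite_permutations)

lemma sym_id [simp]: "id \<in> perms m"
  by (simp add: perms_def permutes_id)

lemma sym_comp [simp]: "\<lbrakk>g \<in> perms m; h \<in> perms m\<rbrakk> \<Longrightarrow> g \<circ> h \<in> perms m"
  by (simp add: perms_def permutes_compose)

lemma sym_inv [simp]: "g \<in> perms m \<Longrightarrow> inv g \<in> perms m"
  by (simp add: perms_def permutes_inv)

lemma sym_inv_comp [simp]: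
  assumes "g \<in> perms m"
  shows "inv g \<circ> g = id" "g \<circ> inv g = id" "inv (inv g) = g"
  using assms permutes_inv_o[of g "letters m"] permutes_inv_inv[of g "letters m"]
  by (auto simp: perms_def)

lemma sym_inv_apply: "g \<in> perms m \<Longrightarrow> inv g (g x) = x" "g \<in> perms m \<Longrightarrow> g (inv g x) = x"
  using permutes_inverses[of g "letters m"] by (auto simp: perms_def)

lemma sym_inv_comp_assoc [simp]:
  assumes "g \<in> perms m"
  shows "inv g \<circ> (g \<circ> h) = h" "g \<circ> (inv g \<circ> h) = h" "h \<circ> inv g \<circ> g = h" "h \<circ> g \<circ> inv g = h"
  using sym_inv_apply[OF assms] by (auto simp: fun_eq_iff)

lemma sym_inv_distrib:
  "\<lbrakk>g \<in> perms m; h \<in> perms m\<rbrakk> \<Longrightarrow> inv (g \<circ> h) = inv h \<circ> inv g"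
  by (auto simp: perms_def intro!: o_inv_distrib permutes_bij)

lemma sym_mem: "g \<in> perms m \<Longrightarrow> g x \<in> letters m \<longleftrightarrow> x \<in> letters m"
  using permutes_in_image[of g "letters m"] by (simp add: perms_def)

lemma sym_comp_cancel:
  assumes "p \<in> perms m" shows "p \<circ> g \<in> perms m \<longleftrightarrow> g \<in> perms m" "g \<circ> p \<in> perms m \<longleftrightarrow> g \<in> perms m"
proof -
  have "inv p \<circ> (p \<circ> g) \<in> perms m" if "p \<circ> g \<in> perms m"
    using sym_comp[OF sym_inv[OF assms] that] .
  then show "p \<circ> g \<in> perms m \<longleftrightarrow> g \<in> perms m" using assms by auto
  have "g \<circ> p \<circ> inv p \<in> perms m" if "g \<circ> p \<in> perms m"
    using sym_comp[OF that sym_inv[OF assms]] .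
  then show "g \<circ> p \<in> perms m \<longleftrightarrow> g \<in> perms m" using assms by auto
qed

lemma permutation_sym: "g \<in> perms m \<Longrightarrow> permutation g"
  using permutes_imp_permutation[of "letters m"] by (simp add: perms_def)

lemma sign_comp_sym: "\<lbrakk>g \<in> perms m; h \<in> perms m\<rbrakk> \<Longrightarrow> sign (g \<circ> h) = sign g * sign h"
  by (simp add: sign_compose permutation_sym)

lemma sign_inv_sym: "g \<in> perms m \<Longrightarrow> sign (inv g) = sign g"
  by (simp add: sign_inverse permutation_sym)

lemma transpose_sym: "\<lbrakk>x \<in> letters m; y \<in> letters m\<rbrakk> \<Longrightarrow> transpose x y \<in> perms m"
  by (simp add: permutes_swap_id perms_def)

lemma sum_sym_left: "g \<in> perms m \<Longrightarrow> (\<Sum>h\<in>perms m. f (g \<circ> h)) = (\<Sum>h\<in>perms m. f h)"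
  by (rule sum.reindex_bij_witness[where i = "\<lambda>h. inv g \<circ> h" and j = "\<lambda>h. g \<circ> h"]) auto

lemma sum_sym_right: "g \<in> perms m \<Longrightarrow> (\<Sum>h\<in>perms m. f (h \<circ> g)) = (\<Sum>h\<in>perms m. f h)"
  by (rule sum.reindex_bij_witness[where i = "\<lambda>h. h \<circ> inv g" and j = "\<lambda>h. h \<circ> g"]) auto

lemma sum_sym_inv: "(\<Sum>h\<in>perms m. f (inv h)) = (\<Sum>h\<in>perms m. f h)"
  by (rule sum.reindex_bij_witness[where i = inv and j = inv]) auto

lemma card_sym: "card (perms m) = fact m"
  by (simp add: perms_def card_permutations)

lemma stabI: "\<lbrakk>p \<in> perms m; \<And>x. x \<in> letters m \<Longrightarrow> f (p x) = f x\<rbrakk> \<Longrightarrow> p \<in> stab m f"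
  by (simp add: stab_def)

lemma stabD: "\<lbrakk>p \<in> stab m f; x \<in> letters m\<rbrakk> \<Longrightarrow> f (p x) = f x"
  by (simp add: stab_def)

lemma stab_sym: "p \<in> stab m f \<Longrightarrow> p \<in> perms m"
  by (simp add: stab_def)

lemma finite_stab [simp]: "finite (stab m f)"
  by (rule finite_subset[of _ "perms m"]) (auto simp: stab_def)

lemma stab_id [simp]: "id \<in> stab m f"
  by (simp add: stab_def)

lemma stab_inv [simp]:
  assumes "p \<in> stab m f" shows "inv p \<in> stab m f"
proof (rule stabI)
  have p: "p \<in> perms m" using assms by (rule stab_sym)
  then show "inv p \<in> perms m" by simp
  fix x assume "x \<in> letters m"
  then have "inv p x \<in> letters m" using sym_mem[OF sym_inv[OF p]] by blast
  then have "f (p (inv p x)) = f (inv p x)" using stabD[OF assms] by blast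
  then show "f (inv p x) = f x" by (simp add: sym_inv_apply[OF p])
qed

lemma stab_comp [simp]:
  assumes "p \<in> stab m f" "q \<in> stab m f" shows "p \<circ> q \<in> stab m f"
proof (rule stabI)
  show "p \<circ> q \<in> perms m" using assms stab_sym sym_comp by blast
  fix x assume x: "x \<in> letters m"
  then have "q x \<in> letters m" using sym_mem[OF stab_sym[OF assms(2)]] by blast
  then show "f ((p \<circ> q) x) = f x" by (simp add: stabD[OF assms(1)] stabD[OF assms(2)] x)
qed

lemma stab_comp_cancel [simp]:
  assumes "p \<in> stab m f" shows "p \<circ> g \<in> stab m f \<longleftrightarrow> g \<in> stab m f" "g \<circ> p \<in> stab m f \<longleftrightarrow> g \<in> stab m f"
proof -
  have p: "p \<in> perms m" using assms by (rule stab_sym)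
  have "inv p \<circ> (p \<circ> g) \<in> stab m f" if "p \<circ> g \<in> stab m f"
    using stab_comp[OF stab_inv[OF assms] that] .
  then show "p \<circ> g \<in> stab m f \<longleftrightarrow> g \<in> stab m f" using assms p by auto
  have "g \<circ> p \<circ> inv p \<in> stab m f" if "g \<circ> p \<in> stab m f"
    using stab_comp[OF that stab_inv[OF assms]] .
  then show "g \<circ> p \<in> stab m f \<longleftrightarrow> g \<in> stab m f" using assms p by auto
qed

lemma transpose_stab:
  assumes "x \<in> letters m" "y \<in> letters m" "f x = f y" shows "transpose x y \<in> stab m f"
  using assms transpose_sym[of x m y] by (intro stabI) (auto simp: transpose_def)

declare stab_sym [simp]

lemma conv_assoc: "conv m (conv m x y) z = conv m x (conv m y z)"
proof
  fix g
  have "conv m (conv m x y) z g = (\<Sum>h\<in>perms m. \<Sum>k\<in>perms m. x k * y (inv k \<circ> h) * z (inv h \<circ> g))"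
    by (simp add: conv_eq sum_distrib_right)
  also have "\<dots> = (\<Sum>k\<in>perms m. \<Sum>h\<in>perms m. x k * y (inv k \<circ> h) * z (inv h \<circ> g))"
    by (rule sum.swap)
  also have "\<dots> = (\<Sum>k\<in>perms m. \<Sum>h\<in>perms m. x k * y h * z (inv h \<circ> (inv k \<circ> g)))"
  proof (rule sum.cong[OF refl])
    fix k assume k: "k \<in> perms m"
    have "(\<Sum>h\<in>perms m. x k * y (inv k \<circ> h) * z (inv h \<circ> g))
        = (\<Sum>h\<in>perms m. x k * y (inv k \<circ> (k \<circ> h)) * z (inv (k \<circ> h) \<circ> g))"
      using sum_sym_left[OF k, of "\<lambda>h. x k * y (inv k \<circ> h) * z (inv h \<circ> g)"] by (simp only:)
    also have "\<dots> = (\<Sum>h\<in>perms m. x k * y h * z (inv h \<circ> (inv k \<circ> g)))"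
      using k by (intro sum.cong) (auto simp: sym_inv_distrib comp_assoc)
    finally show "(\<Sum>h\<in>perms m. x k * y (inv k \<circ> h) * z (inv h \<circ> g)) = (\<Sum>h\<in>perms m. x k * y h * z (inv h \<circ> (inv k \<circ> g)))" .
  qed
  also have "\<dots> = conv m x (conv m y z) g"
    by (simp add: conv_eq sum_distrib_left mult.assoc)
  finally show "conv m (conv m x y) z g = conv m x (conv m y z) g" .
qed

lemma conv_at_id: "conv m x y id = (\<Sum>h\<in>perms m. x h * y (inv h))"
  by (simp add: conv_eq)

lemma conv_at_id_commute: "conv m x y id = conv m y x id"
proof -
  have "conv m x y id = (\<Sum>h\<in>perms m. x (inv h) * y (inv (inv h)))"
    unfolding conv_at_id using sum_sym_inv[of "\<lambda>h. x h * y (inv h)"] by (simp only:)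
  also have "\<dots> = conv m y x id"
    unfolding conv_at_id by (intro sum.cong) (auto simp: mult.commute)
  finally show ?thesis .
qed

lemma conv_group_algebra: "y \<in> group_algebra m \<Longrightarrow> conv m x y \<in> group_algebra m"
  unfolding group_algebra_eq conv_eq
  by (auto simp: sym_comp_cancel intro!: sum.neutral)

lemma conv_left_translate:
  assumes p: "p \<in> perms m" and inv: "\<And>h. h \<in> perms m \<Longrightarrow> x (p \<circ> h) = s * x h"
  shows "conv m x y (p \<circ> g) = s * conv m x y g"
proof -
  have "conv m x y (p \<circ> g) = (\<Sum>h\<in>perms m. x (p \<circ> h) * y (inv (p \<circ> h) \<circ> (p \<circ> g)))"
    unfolding conv_eq using sum_sym_left[OF p, of "\<lambda>h. x h * y (inv h \<circ> (p \<circ> g))"] by (simp only:)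
  also have "\<dots> = (\<Sum>h\<in>perms m. s * (x h * y (inv h \<circ> g)))"
  proof (rule sum.cong[OF refl])
    fix h assume h: "h \<in> perms m"
    have "inv (p \<circ> h) \<circ> (p \<circ> g) = inv h \<circ> (inv p \<circ> (p \<circ> g))"
      using sym_inv_distrib[OF p h] by (simp add: comp_assoc)
    also have "\<dots> = inv h \<circ> g" using p by simp
    finally show "x (p \<circ> h) * y (inv (p \<circ> h) \<circ> (p \<circ> g)) = s * (x h * y (inv h \<circ> g))"
      using inv[OF h] by simp
  qed
  finally show ?thesis by (simp add: conv_eq sum_distrib_left)
qed

lemma conv_right_translate:
  assumes q: "q \<in> perms m" and inv: "\<And>h. y (h \<circ> q) = s * y h"
  shows "conv m x y (g \<circ> q) = s * conv m x y g"
  unfolding conv_eq sum_distrib_left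
  by (intro sum.cong) (auto simp: inv simp flip: comp_assoc)

text \<open>
  The coefficient of the identity in \<open>y y\<^sup>*\<close> is the sum of the squares of the coefficients of \<open>y\<close>.
\<close>

lemma conv_self_star_zero:
  assumes "conv m y (star y) id = 0" "g \<in> perms m" shows "y g = 0"
proof -
  have "conv m y (star y) id = (\<Sum>h\<in>perms m. (y h)\<^sup>2)"
    unfolding conv_at_id star_def
    by (intro sum.cong) (auto simp: power2_eq_square)
  then have "(\<Sum>h\<in>perms m. (y h)\<^sup>2) = 0" using assms by simp
  then have "\<forall>h\<in>perms m. (y h)\<^sup>2 = 0" by (subst (asm) sum_nonneg_eq_0_iff) auto
  then have "(y g)\<^sup>2 = 0" using assms by blast
  then show ?thesis by simp
qed

lemma star_conv:
  assumes g: "g \<in> perms m"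
  shows "star (conv m x y) g = conv m (star y) (star x) g"
proof -
  have "star (conv m x y) g = (\<Sum>h\<in>perms m. x (inv g \<circ> h) * y (inv (inv g \<circ> h) \<circ> inv g))"
    unfolding star_def conv_eq
    using sum_sym_left[OF sym_inv[OF g], of "\<lambda>h. x h * y (inv h \<circ> inv g)"] by (simp only:)
  also have "\<dots> = (\<Sum>h\<in>perms m. star y h * star x (inv h \<circ> g))"
  proof (rule sum.cong[OF refl])
    fix h assume h: "h \<in> perms m"
    have "inv (inv g \<circ> h) \<circ> inv g = inv h" "inv (inv h \<circ> g) = inv g \<circ> h"
      using sym_inv_distrib[of "inv g" m h] sym_inv_distrib[of "inv h" m g] g h
      by (simp_all)
    then show "x (inv g \<circ> h) * y (inv (inv g \<circ> h) \<circ> inv g) = star y h * star x (inv h \<circ> g)"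
      by (simp add: star_def)
  qed
  finally show ?thesis by (simp add: conv_eq)
qed

section \<open>Young symmetrizers\<close>

definition row_elt :: "nat \<Rightarrow> (nat \<Rightarrow> nat) \<Rightarrow> pfun" where
  "row_elt m r g = (if g \<in> stab m r then 1 else 0)"

definition col_elt :: "nat \<Rightarrow> (nat \<Rightarrow> nat) \<Rightarrow> pfun" where
  "col_elt m k g = (if g \<in> stab m k then of_int (sign g) else 0)"

lemma row_elt_left: "p \<in> stab m r \<Longrightarrow> row_elt m r (p \<circ> g) = row_elt m r g"
  and row_elt_right: "p \<in> stab m r \<Longrightarrow> row_elt m r (g \<circ> p) = row_elt m r g"
  by (simp_all add: row_elt_def)

lemma col_elt_left: "q \<in> stab m k \<Longrightarrow> col_elt m k (q \<circ> g) = of_int (sign q) * col_elt m k g"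
  and col_elt_right: "q \<in> stab m k \<Longrightarrow> col_elt m k (g \<circ> q) = of_int (sign q) * col_elt m k g"
  using sign_comp_sym[of q m g] sign_comp_sym[of g m q] by (auto simp: col_elt_def)

lemma col_elt_group_algebra: "col_elt m k \<in> group_algebra m"
  by (auto simp: group_algebra_eq col_elt_def)

lemma star_row_elt: "g \<in> perms m \<Longrightarrow> star (row_elt m r) g = row_elt m r g"
  using stab_inv[of g m r] stab_inv[of "inv g" m r] sym_inv_comp(3)[of g m] unfolding star_def row_elt_def by metis

lemma star_col_elt: "g \<in> perms m \<Longrightarrow> star (col_elt m k) g = col_elt m k g"
  using stab_inv[of g m k] stab_inv[of "inv g" m k] sym_inv_comp(3)[of g m] sign_inv_sym[of g m] unfolding star_def col_elt_def by metis

lemma conv_row_elt_absorb: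
  assumes "\<And>p. p \<in> stab m r \<Longrightarrow> y (p \<circ> g) = y g"
  shows "conv m (row_elt m r) y g = of_nat (card (stab m r)) * y g"
proof -
  have "conv m (row_elt m r) y g = (\<Sum>h\<in>stab m r. y (inv h \<circ> g))"
    unfolding conv_eq row_elt_def
    by (rule sum.mono_neutral_cong_right) auto
  also have "\<dots> = (\<Sum>h\<in>stab m r. y g)" using assms by (intro sum.cong) auto
  finally show ?thesis by simp
qed

lemma conv_col_elt_absorb:
  assumes g: "g \<in> perms m" and y: "\<And>q. q \<in> stab m k \<Longrightarrow> y (g \<circ> q) = of_int (sign q) * y g"
  shows "conv m y (col_elt m k) g = of_nat (card (stab m k)) * y g"
proof -
  have "conv m y (col_elt m k) g = (\<Sum>u\<in>perms m. y (g \<circ> u) * col_elt m k (inv (g \<circ> u) \<circ> g))"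
    unfolding conv_eq using sum_sym_left[OF g, of "\<lambda>h. y h * col_elt m k (inv h \<circ> g)"] by (simp only:)
  also have "\<dots> = (\<Sum>u\<in>stab m k. y g)"
  proof (rule sum.mono_neutral_cong_right)
    have e: "inv (g \<circ> u) \<circ> g = inv u" if "u \<in> perms m" for u
      using sym_inv_distrib[OF g that] g by (simp add: comp_assoc)
    have s: "inv u \<in> stab m k \<longleftrightarrow> u \<in> stab m k" if "u \<in> perms m" for u
      using stab_inv[of u m k] stab_inv[of "inv u" m k] sym_inv_comp(3)[OF that] by metis
    show "\<forall>u\<in>perms m - stab m k. y (g \<circ> u) * col_elt m k (inv (g \<circ> u) \<circ> g) = 0"
      using e s by (auto simp: col_elt_def)
    show "y (g \<circ> u) * col_elt m k (inv (g \<circ> u) \<circ> g) = y g" if "u \<in> stab m k" for u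
      using e[of u] s[of u] that y[OF that] sign_inv_sym[of u m] by (simp add: col_elt_def flip: of_int_mult)
  qed auto
  finally show ?thesis by simp
qed

lemma down_closed_eq_lessThan_card:
  assumes "finite S" "\<And>i j :: nat. j \<in> S \<Longrightarrow> i < j \<Longrightarrow> i \<in> S"
  shows "S = {..<card S}"
proof (cases "S = {}")
  case False
  have "S = {..Max S}"
    using assms(2)[OF Max_in[OF assms(1) False]] Max_in[OF assms(1) False] Max_ge[OF assms(1)] by (auto simp: le_less)
  then show ?thesis by (metis card_atMost lessThan_Suc_atMost)
qed simp

text \<open>
  A filling of a diagram with the letters: \<open>r x\<close> and \<open>k x\<close> are the row and the column of the cell containing \<open>x\<close>, and the
  cells of a column lie directly below each other starting in row 0.
\<close>

locale tableau =
  fixes m :: nat and r k :: "nat \<Rightarrow> nat"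
  assumes cell_inj: "\<lbrakk>x \<in> letters m; y \<in> letters m; r x = r y; k x = k y\<rbrakk> \<Longrightarrow> x = y"
    and stacked: "\<lbrakk>x \<in> letters m; i < r x\<rbrakk> \<Longrightarrow> \<exists>y\<in>letters m. r y = i \<and> k y = k x"
begin

definition column_inj :: "(nat \<Rightarrow> 'c) \<Rightarrow> bool" where
  "column_inj F \<longleftrightarrow> (\<forall>x\<in>letters m. \<forall>y\<in>letters m. k x = k y \<longrightarrow> F x = F y \<longrightarrow> x = y)"

definition height :: "nat \<Rightarrow> nat" where
  "height c = card {x \<in> letters m. k x = c}"

lemma bij_column: "bij_betw r {x \<in> letters m. k x = c} {..<height c}"
proof -
  let ?K = "{x \<in> letters m. k x = c}"
  have inj: "inj_on r ?K" using cell_inj by (auto simp: inj_on_def)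
  have "i \<in> r ` ?K" if "j \<in> r ` ?K" "i < j" for i j
    using that stacked by fastforce
  then have "r ` ?K = {..<card (r ` ?K)}"
    by (intro down_closed_eq_lessThan_card) auto
  then show ?thesis
    using inj by (simp add: bij_betw_def height_def card_image)
qed

lemma card_column_rows_less:
  "card {x \<in> letters m. k x = c \<and> r x < i} = min i (height c)"
proof -
  have "bij_betw r {x \<in> letters m. k x = c \<and> r x < i} ({..<height c} \<inter> {..<i})"
    using bij_column[of c] by (auto simp: bij_betw_def inj_on_def)
  then have "card {x \<in> letters m. k x = c \<and> r x < i} = card ({..<height c} \<inter> {..<i})"
    by (rule bij_betw_same_card)
  also have "{..<height c} \<inter> {..<i} = {..<min i (height c)}" by auto
  finally show ?thesis by simp
qed

lemma card_by_columns:
  "card {x \<in> letters m. P x} = (\<Sum>c\<in>k ` letters m. card {x \<in> letters m. k x = c \<and> P x})"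
proof -
  have "{x \<in> letters m. P x} = (\<Union>c\<in>k ` letters m. {x \<in> letters m. k x = c \<and> P x})" by auto
  then show ?thesis by (simp only:) (subst card_UN_disjoint, auto)
qed

lemma card_column_colours_le:
  assumes "column_inj F" "finite K"
  shows "card {x \<in> letters m. k x = c \<and> F x \<in> K} \<le> card {x \<in> letters m. k x = c \<and> r x < card K}"
proof -
  have "inj_on F {x \<in> letters m. k x = c \<and> F x \<in> K}"
    using assms(1) by (auto simp: column_inj_def inj_on_def)
  then have "card {x \<in> letters m. k x = c \<and> F x \<in> K} \<le> card K"
    using assms(2) by (intro card_inj_on_le[of F]) auto
  moreover have "card {x \<in> letters m. k x = c \<and> F x \<in> K} \<le> height c"
    unfolding height_def by (intro card_mono) auto
  ultimately show ?thesis by (simp add: card_column_rows_less)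
qed

text \<open>
  A column of height \<open>h\<close> without repeated colours contains at most \<open>min h |K|\<close> cells with colours in \<open>K\<close>, which is the number of its cells in the first \<open>|K|\<close> rows.
\<close>

lemma column_inj_dominance:
  assumes "column_inj F" "finite K"
  shows "card {x \<in> letters m. F x \<in> K} \<le> card {x \<in> letters m. r x < card K}"
  unfolding card_by_columns[of "\<lambda>x. F x \<in> K"] card_by_columns[of "\<lambda>x. r x < card K"]
  using card_column_colours_le[OF assms] by (intro sum_mono)

text \<open>
  Equality in the dominance bound holds in every column separately, so each column carries each of the colours
  \<open>0, \<dots>, h - 1\<close> once and can be sorted by a permutation in the column group.
\<close>

lemma column_inj_same_content:
  fixes F :: "nat \<Rightarrow> nat"
  assumes F: "column_inj F" and content: "\<And>i. card {x \<in> letters m. F x < i} = card {x \<in> letters m. r x < i}"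
  obtains q where "q \<in> stab m k" "\<And>x. x \<in> letters m \<Longrightarrow> F x = r (q x)"
proof -
  have col_eq: "card {x \<in> letters m. k x = c \<and> F x < i} = min i (height c)" if "c \<in> k ` letters m" for c i
  proof -
    have "card {x \<in> letters m. k x = c \<and> F x < i} = card {x \<in> letters m. k x = c \<and> r x < i}"
    proof -
      have eq: "(\<Sum>c\<in>k ` letters m. card {x \<in> letters m. k x = c \<and> F x < i}) = (\<Sum>c\<in>k ` letters m. card {x \<in> letters m. k x = c \<and> r x < i})"
        using content[of i] by (simp only: card_by_columns[of "\<lambda>x. F x < i"] card_by_columns[of "\<lambda>x. r x < i"])
      have le: "card {x \<in> letters m. k x = d \<and> F x < i} \<le> card {x \<in> letters m. k x = d \<and> r x < i}" for d
        using card_column_colours_le[OF F, of "{..<i}" d] by simp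
      show ?thesis using sum_mono_inv[OF eq le that] by simp
    qed
    then show ?thesis by (simp add: card_column_rows_less)
  qed
  have ex: "\<exists>y\<in>letters m. k y = k x \<and> r y = F x" if x: "x \<in> letters m" for x
  proof -
    let ?h = "height (k x)"
    have "{y \<in> letters m. k y = k x \<and> F y < ?h} = {y \<in> letters m. k y = k x}"
      by (rule card_subset_eq) (use col_eq[of "k x" ?h] x in \<open>auto simp: height_def\<close>)
    then have "F x < ?h" using x by blast
    then have "F x \<in> r ` {y \<in> letters m. k y = k x}" using bij_column[of "k x"] by (simp add: bij_betw_def)
    then show ?thesis by force
  qed
  define q where "q x = (if x \<in> letters m then SOME y. y \<in> letters m \<and> k y = k x \<and> r y = F x else x)" for x
  have q: "q x \<in> letters m \<and> k (q x) = k x \<and> r (q x) = F x" if x: "x \<in> letters m" for x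
  proof -
    have "\<exists>y. y \<in> letters m \<and> k y = k x \<and> r y = F x" using ex[OF x] by blast
    from someI_ex[OF this] show ?thesis using x by (simp add: q_def)
  qed
  have inj: "inj_on q (letters m)"
    using q F unfolding inj_on_def column_inj_def by metis
  have "q ` letters m = letters m" using q inj by (intro endo_inj_surj) auto
  then have "bij_betw q (letters m) (letters m)" using inj by (simp add: bij_betw_def)
  then have "q permutes letters m" by (rule bij_imp_permutes) (auto simp: q_def)
  then have "q \<in> stab m k" using q by (intro stabI) (auto simp: perms_def)
  then show thesis using that q by metis
qed

lemma column_inj_factor:
  assumes g: "g \<in> perms m" and F: "column_inj (r \<circ> g)"
  obtains p q where "p \<in> stab m r" "q \<in> stab m k" "g = p \<circ> q"
proof -
  have "card {x \<in> letters m. (r \<circ> g) x < i} = card {x \<in> letters m. r x < i}" for i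
  proof (rule bij_betw_same_card[of g])
    show "bij_betw g {x \<in> letters m. (r \<circ> g) x < i} {x \<in> letters m. r x < i}"
      by (rule bij_betwI[where g = "inv g"]) (auto simp: sym_inv_apply[OF g] sym_mem[OF g] sym_mem[OF sym_inv[OF g]])
  qed
  from column_inj_same_content[OF F this]
  obtain q where q: "q \<in> stab m k" "\<And>x. x \<in> letters m \<Longrightarrow> (r \<circ> g) x = r (q x)" by blast
  have qs: "q \<in> perms m" using q by simp
  have "r ((g \<circ> inv q) x) = r x" if "x \<in> letters m" for x
  proof -
    have "inv q x \<in> letters m" using sym_mem[OF sym_inv[OF qs]] that by blast
    from q(2)[OF this] show ?thesis by (simp add: sym_inv_apply[OF qs])
  qed
  then have "g \<circ> inv q \<in> stab m r" using g qs sym_comp[OF g sym_inv[OF qs]] by (intro stabI) auto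
  moreover have "g = (g \<circ> inv q) \<circ> q" using qs by simp
  ultimately show thesis using that q by blast
qed

lemma stab_rows_columns:
  assumes "p \<in> stab m r" "p \<in> stab m k" shows "p = id"
proof
  fix x show "p x = id x"
  proof (cases "x \<in> letters m")
    case True
    then have "p x \<in> letters m" using sym_mem[OF stab_sym[OF assms(1)]] by blast
    then show ?thesis using cell_inj[of "p x" x] True stabD[OF assms(1)] stabD[OF assms(2)] by simp
  next
    case False
    then show ?thesis using stab_sym[OF assms(1)] permutes_not_in[of p "letters m" x] by (simp add: perms_def)
  qed
qed

definition symmetrizer :: pfun where
  "symmetrizer = conv m (row_elt m r) (col_elt m k)"

lemma symmetrizer_left: "p \<in> stab m r \<Longrightarrow> symmetrizer (p \<circ> g) = symmetrizer g"
  unfolding symmetrizer_def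
  using conv_left_translate[of p m "row_elt m r" 1] by (simp add: row_elt_left)

lemma symmetrizer_right: "q \<in> stab m k \<Longrightarrow> symmetrizer (g \<circ> q) = of_int (sign q) * symmetrizer g"
  unfolding symmetrizer_def
  by (rule conv_right_translate) (simp_all add: col_elt_right)

lemma symmetrizer_group_algebra: "symmetrizer \<in> group_algebra m"
  unfolding symmetrizer_def by (intro conv_group_algebra col_elt_group_algebra)

lemma symmetrizer_id: "symmetrizer id = 1"
proof -
  have "symmetrizer id = (\<Sum>h\<in>{id}. row_elt m r h * col_elt m k (inv h))"
    unfolding symmetrizer_def conv_at_id
  proof (rule sum.mono_neutral_right)
    show "\<forall>h\<in>perms m - {id}. row_elt m r h * col_elt m k (inv h) = 0"
    proof
      fix h assume h: "h \<in> perms m - {id}"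
      then have "inv (inv h) = h" by (intro sym_inv_comp(3)[of h m]) simp
      then have "h \<in> stab m k" if "inv h \<in> stab m k" using stab_inv[OF that] by simp
      then show "row_elt m r h * col_elt m k (inv h) = 0"
        using stab_rows_columns[of h] h by (auto simp: row_elt_def col_elt_def)
    qed
  qed (auto simp: permutes_id)
  then show ?thesis by (simp add: row_elt_def col_elt_def)
qed

text \<open>
  If \<open>g\<close> sends two letters \<open>u, v\<close> of a column to the same colour, then \<open>g (u v) = (g u g v) g\<close>, where the transposition on the left
  changes the sign of \<open>y\<close> and the one on the right does not.
\<close>

lemma not_column_inj_vanish:
  fixes y :: "(nat \<Rightarrow> nat) \<Rightarrow> rat"
  assumes g: "g \<in> perms m" and nc: "\<not> column_inj (f \<circ> g)"
    and left: "\<And>p. p \<in> stab m f \<Longrightarrow> y (p \<circ> g) = y g"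
    and right: "\<And>q. q \<in> stab m k \<Longrightarrow> y (g \<circ> q) = of_int (sign q) * y g"
  shows "y g = 0"
proof -
  obtain u v where uv: "u \<in> letters m" "v \<in> letters m" "k u = k v" "f (g u) = f (g v)" "u \<noteq> v"
    using nc by (auto simp: column_inj_def)
  have q: "transpose u v \<in> stab m k" using uv by (intro transpose_stab) auto
  have p: "transpose (g u) (g v) \<in> stab m f"
    using uv g sym_mem[OF g, of u] sym_mem[OF g, of v] by (intro transpose_stab) auto
  have "inj g" using g permutes_inj by (auto simp: perms_def)
  then have "g \<circ> transpose u v = transpose (g u) (g v) \<circ> g"
    by (auto simp: fun_eq_iff transpose_def inj_eq)
  then have "y g = - y g" using left[OF p] right[OF q] uv by (simp add: sign_swap_id)
  then show ?thesis by simp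
qed

lemma symmetrizer_unique:
  assumes left: "\<And>p g. p \<in> stab m r \<Longrightarrow> y (p \<circ> g) = y g"
    and right: "\<And>q g. q \<in> stab m k \<Longrightarrow> y (g \<circ> q) = of_int (sign q) * y g"
    and g: "g \<in> perms m"
  shows "y g = y id * symmetrizer g"
proof (cases "column_inj (r \<circ> g)")
  case True
  then obtain p q where pq: "p \<in> stab m r" "q \<in> stab m k" "g = p \<circ> q"
    using column_inj_factor[OF g] by blast
  have "y g = of_int (sign q) * y id" using left[OF pq(1), of q] right[OF pq(2), of id] pq(3) by simp
  moreover have "symmetrizer g = of_int (sign q)"
    using symmetrizer_left[OF pq(1), of q] symmetrizer_right[OF pq(2), of id] pq(3) symmetrizer_id by simp
  ultimately show ?thesis by simp
next
  case False
  have "y g = 0" using not_column_inj_vanish[OF g False] left right by blast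
  moreover have "symmetrizer g = 0" using not_column_inj_vanish[OF g False, of symmetrizer] symmetrizer_left symmetrizer_right by blast
  ultimately show ?thesis by simp
qed

definition norm_const :: rat where
  "norm_const = conv m symmetrizer symmetrizer id"

lemma symmetrizer_sandwich:
  assumes "g \<in> perms m"
  shows "conv m symmetrizer (conv m x symmetrizer) g = conv m symmetrizer (conv m x symmetrizer) id * symmetrizer g"
proof (rule symmetrizer_unique[OF _ _ assms])
  show "conv m symmetrizer (conv m x symmetrizer) (p \<circ> g) = conv m symmetrizer (conv m x symmetrizer) g" if "p \<in> stab m r" for p g
    using conv_left_translate[of p m symmetrizer 1] symmetrizer_left that by simp
  show "conv m symmetrizer (conv m x symmetrizer) (g \<circ> q) = of_int (sign q) * conv m symmetrizer (conv m x symmetrizer) g" if "q \<in> stab m k" for q g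
    unfolding conv_assoc[symmetric]
    by (rule conv_right_translate) (use that symmetrizer_right in auto)
qed

lemma symmetrizer_square: "conv m symmetrizer symmetrizer = (\<lambda>g. norm_const * symmetrizer g)"
proof
  fix g show "conv m symmetrizer symmetrizer g = norm_const * symmetrizer g"
  proof (cases "g \<in> perms m")
    case True
    have "conv m symmetrizer symmetrizer g = conv m symmetrizer symmetrizer id * symmetrizer g"
    proof (rule symmetrizer_unique[OF _ _ True])
      show "conv m symmetrizer symmetrizer (p \<circ> g) = conv m symmetrizer symmetrizer g" if "p \<in> stab m r" for p g
        using conv_left_translate[of p m symmetrizer 1] symmetrizer_left that by simp
      show "conv m symmetrizer symmetrizer (g \<circ> q) = of_int (sign q) * conv m symmetrizer symmetrizer g" if "q \<in> stab m k" for q g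
        by (rule conv_right_translate) (use that symmetrizer_right in auto)
    qed
    then show ?thesis by (simp add: norm_const_def)
  next
    case False
    then show ?thesis
      using conv_group_algebra[OF symmetrizer_group_algebra, of symmetrizer] symmetrizer_group_algebra
      by (simp add: group_algebra_eq)
  qed
qed

lemma conv_cong:
  assumes "\<And>h. h \<in> perms m \<Longrightarrow> x h = x' h" "\<And>h. h \<in> perms m \<Longrightarrow> y h = y' h" "g \<in> perms m"
  shows "conv m x y g = conv m x' y' g"
  unfolding conv_eq using assms sym_comp[OF sym_inv] by (intro sum.cong) auto

text \<open>
  Over the rationals \<open>y y\<^sup>* = 0\<close> forces \<open>y = 0\<close>. Were \<open>c\<^sup>2 = 0\<close> for \<open>c = a b\<close>, then \<open>(a b a)\<^sup>2\<close>,
  a multiple of \<open>a b a b a\<close>, would vanish, hence \<open>a b a\<close>, hence \<open>c c\<^sup>*\<close>, hence \<open>c\<close>.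
\<close>

lemma norm_const_nonzero: "norm_const \<noteq> 0"
proof (rule notI)
  assume zero: "norm_const = 0"
  let ?a = "row_elt m r" and ?b = "col_elt m k"
  define y where "y = conv m symmetrizer ?a"
  have star_c: "star symmetrizer h = conv m ?b ?a h" if h: "h \<in> perms m" for h
  proof -
    have "star symmetrizer h = conv m (star ?b) (star ?a) h"
      unfolding symmetrizer_def by (rule star_conv[OF h])
    also have "\<dots> = conv m ?b ?a h" by (intro conv_cong star_col_elt star_row_elt h)
    finally show ?thesis .
  qed
  have star_y: "star y g = y g" if "g \<in> perms m" for g
  proof -
    have "star y g = conv m (star ?a) (star symmetrizer) g"
      unfolding y_def by (rule star_conv[OF that])
    also have "\<dots> = conv m ?a (conv m ?b ?a) g"
      by (rule conv_cong[OF star_row_elt star_c that])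
    finally show ?thesis by (simp add: y_def symmetrizer_def conv_assoc)
  qed
  have aa: "conv m ?a ?a = (\<lambda>g. of_nat (card (stab m r)) * ?a g)"
    by (rule ext, rule conv_row_elt_absorb) (simp add: row_elt_left)
  have scale: "conv m x (\<lambda>g. s * z g) = (\<lambda>g. s * conv m x z g)" for x z and s :: rat
    by (auto simp: conv_eq sum_distrib_left algebra_simps)
  have scale': "conv m (\<lambda>g. s * x g) z = (\<lambda>g. s * conv m x z g)" for x z and s :: rat
    by (auto simp: conv_eq sum_distrib_left algebra_simps)
  have "conv m y y = conv m symmetrizer (conv m (conv m ?a ?a) (conv m ?b ?a))"
    by (simp add: y_def symmetrizer_def conv_assoc)
  also have "\<dots> = (\<lambda>g. of_nat (card (stab m r)) * conv m (conv m symmetrizer symmetrizer) ?a g)"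
    unfolding aa scale scale' by (simp add: symmetrizer_def conv_assoc)
  also have "\<dots> = (\<lambda>g. 0)" unfolding symmetrizer_square zero by (simp add: conv_eq)
  finally have yy: "conv m y y = (\<lambda>g. 0)" .
  have y0: "y g = 0" if "g \<in> perms m" for g
  proof (rule conv_self_star_zero[OF _ that])
    have "conv m y (star y) id = conv m y y id" using star_y by (intro conv_cong) auto
    then show "conv m y (star y) id = 0" using yy by simp
  qed
  have "symmetrizer id = 0"
  proof (rule conv_self_star_zero[where y = symmetrizer and g = id and m = m])
    have "conv m symmetrizer (star symmetrizer) id = conv m symmetrizer (conv m ?b ?a) id"
      using star_c by (intro conv_cong) auto
    also have "\<dots> = conv m (\<lambda>g. of_nat (card (stab m k)) * symmetrizer g) ?a id"
      unfolding conv_assoc[symmetric]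
      by (intro conv_cong conv_col_elt_absorb) (auto simp: symmetrizer_right permutes_id)
    also have "\<dots> = of_nat (card (stab m k)) * y id" by (simp add: scale' y_def)
    finally show "conv m symmetrizer (star symmetrizer) id = 0" using y0[of id] by simp
  qed simp
  then show False using symmetrizer_id by simp
qed

end

text \<open>
  With \<open>c = a b\<close> and \<open>c' = a' b'\<close>, the product \<open>c x c'\<close> is invariant under the first row group and alternating under the
  second column group, so if it is nonzero the second shape dominates the first. It contains the factor \<open>b x a'\<close>, which
  gives dominance in the other direction.
\<close>

lemma tableau_product_nonzero:
  assumes T: "tableau m r k" and T': "tableau m r' k'"
    and g: "g \<in> perms m" and nz: "conv m (tableau.symmetrizer m r k) (conv m x (tableau.symmetrizer m r' k')) g \<noteq> 0"
  shows "card {x \<in> letters m. r x < i} = card {x \<in> letters m. r' x < i}"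
proof -
  have content: "card {x \<in> letters m. (f \<circ> h) x < i} = card {x \<in> letters m. f x < i}" if h: "h \<in> perms m" for f :: "nat \<Rightarrow> nat" and h
  proof (rule bij_betw_same_card[of h])
    show "bij_betw h {x \<in> letters m. (f \<circ> h) x < i} {x \<in> letters m. f x < i}"
      by (rule bij_betwI[where g = "inv h"]) (auto simp: sym_inv_apply[OF h] sym_mem[OF h] sym_mem[OF sym_inv[OF h]])
  qed
  have le: "card {x \<in> letters m. f x < i} \<le> card {x \<in> letters m. rr x < i}"
    if "tableau m rr kk" "h \<in> perms m" "tableau.column_inj m kk (f \<circ> h)" for f rr kk :: "nat \<Rightarrow> nat" and h
    using tableau.column_inj_dominance[OF that(1,3), of "{..<i}"] content[OF that(2), of f] by simp
  let ?c = "tableau.symmetrizer m r k" and ?c' = "tableau.symmetrizer m r' k'"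
  have "tableau.column_inj m k' (r \<circ> g)"
  proof (rule ccontr)
    assume nc: "\<not> tableau.column_inj m k' (r \<circ> g)"
    have "conv m ?c (conv m x ?c') g = 0"
    proof (rule tableau.not_column_inj_vanish[OF T' g nc])
      show "conv m ?c (conv m x ?c') (p \<circ> g) = conv m ?c (conv m x ?c') g" if "p \<in> stab m r" for p
        using conv_left_translate[of p m ?c 1] tableau.symmetrizer_left[OF T] that by simp
      show "conv m ?c (conv m x ?c') (g \<circ> q) = of_int (sign q) * conv m ?c (conv m x ?c') g" if "q \<in> stab m k'" for q
        unfolding conv_assoc[symmetric]
        by (rule conv_right_translate) (use that tableau.symmetrizer_right[OF T'] in auto)
    qed
    then show False using nz by simp
  qed
  then have 1: "card {x \<in> letters m. r x < i} \<le> card {x \<in> letters m. r' x < i}"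
    using le[OF T' g] by blast
  define z where "z = conv m (col_elt m k) (conv m x (row_elt m r'))"
  have "conv m ?c (conv m x ?c') = conv m (row_elt m r) (conv m z (col_elt m k'))"
    by (simp add: z_def tableau.symmetrizer_def[OF T] tableau.symmetrizer_def[OF T'] conv_assoc)
  then have "conv m (row_elt m r) (conv m z (col_elt m k')) g \<noteq> 0" using nz by simp
  moreover have "conv m (row_elt m r) (conv m z (col_elt m k')) g = 0" if "\<And>h. h \<in> perms m \<Longrightarrow> z h = 0"
  proof -
    have "conv m z y = (\<lambda>_. 0)" for y unfolding conv_eq using that by (intro ext sum.neutral) simp
    then show ?thesis by (simp add: conv_eq)
  qed
  ultimately obtain h where h: "h \<in> perms m" "z h \<noteq> 0" by blast
  have "tableau.column_inj m k (r' \<circ> inv h)"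
  proof (rule ccontr)
    assume nc: "\<not> tableau.column_inj m k (r' \<circ> inv h)"
    have "star z (inv h) = 0"
    proof (rule tableau.not_column_inj_vanish[OF T sym_inv[OF h(1)] nc])
      fix p assume p: "p \<in> stab m r'"
      have "z (h \<circ> inv p) = 1 * z h" unfolding z_def conv_assoc[symmetric]
        by (rule conv_right_translate) (use p row_elt_right[OF stab_inv[OF p]] in auto)
      moreover have "inv (p \<circ> inv h) = h \<circ> inv p" "inv (inv h) = h"
        using sym_inv_distrib[of p m "inv h"] p h by (simp_all)
      ultimately show "star z (p \<circ> inv h) = star z (inv h)" by (simp add: star_def)
    next
      fix q assume q: "q \<in> stab m k"
      have "z (inv q \<circ> h) = of_int (sign (inv q)) * z h" unfolding z_def
        by (rule conv_left_translate) (use q col_elt_left[OF stab_inv[OF q]] in auto)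
      moreover have "inv (inv h \<circ> q) = inv q \<circ> h" "inv (inv h) = h" "sign (inv q) = sign q"
        using sym_inv_distrib[of "inv h" m q] q h sign_inv_sym[of q m] by (simp_all)
      ultimately show "star z (inv h \<circ> q) = of_int (sign q) * star z (inv h)" by (simp add: star_def)
    qed
    then show False using h by (simp add: star_def)
  qed
  then have "card {x \<in> letters m. r' x < i} \<le> card {x \<in> letters m. r x < i}"
    using le[OF T sym_inv[OF h(1)]] by blast
  with 1 show ?thesis by simp
qed


section \<open>Tableaux of partitions\<close>

definition row_of :: "nat list \<Rightarrow> nat \<Rightarrow> nat" where
  "row_of \<mu> x = (LEAST i. x \<le> sum_list (take (Suc i) \<mu>))"

definition col_of :: "nat list \<Rightarrow> nat \<Rightarrow> nat" where
  "col_of \<mu> x = x - 1 - sum_list (take (row_of \<mu> x) \<mu>)"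

lemma sum_list_take_Suc:
  fixes \<mu> :: "nat list"
  shows "i < length \<mu> \<Longrightarrow> sum_list (take (Suc i) \<mu>) = sum_list (take i \<mu>) + \<mu> ! i"
  by (simp add: take_Suc_conv_app_nth)

lemma sum_list_take_mono:
  fixes \<mu> :: "nat list"
  assumes "i \<le> j" shows "sum_list (take i \<mu>) \<le> sum_list (take j \<mu>)"
  using take_add[of i "j - i" \<mu>] assms by simp

lemma sum_list_take_le:
  fixes \<mu> :: "nat list"
  shows "sum_list (take i \<mu>) \<le> sum_list \<mu>"
  using sum_list_take_mono[of i "max i (length \<mu>)" \<mu>] by simp

lemma row_of_less_iff:
  assumes "x \<in> letters (sum_list \<mu>)"
  shows "row_of \<mu> x < i \<longleftrightarrow> x \<le> sum_list (take i \<mu>)"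
proof -
  have "x \<le> sum_list (take (Suc (length \<mu>)) \<mu>)" using assms by (simp add: letters_def)
  then have R: "x \<le> sum_list (take (Suc (row_of \<mu> x)) \<mu>)" unfolding row_of_def by (rule LeastI)
  show ?thesis
  proof
    assume "row_of \<mu> x < i"
    then show "x \<le> sum_list (take i \<mu>)" using R sum_list_take_mono[of "Suc (row_of \<mu> x)" i \<mu>] by simp
  next
    assume x: "x \<le> sum_list (take i \<mu>)"
    then obtain j where "i = Suc j" using assms by (cases i) (auto simp: letters_def)
    then show "row_of \<mu> x < i" using x unfolding row_of_def by (simp add: Least_le less_Suc_eq_le)
  qed
qed

lemma tab_entry_row_col:
  assumes "x \<in> letters (sum_list \<mu>)"
  shows "row_of \<mu> x < length \<mu>" "col_of \<mu> x < \<mu> ! row_of \<mu> x" "tab_entry \<mu> (row_of \<mu> x) (col_of \<mu> x) = x"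
proof -
  let ?i = "row_of \<mu> x"
  show i: "?i < length \<mu>" using row_of_less_iff[OF assms, of "length \<mu>"] assms by (simp add: letters_def)
  have lo: "sum_list (take ?i \<mu>) < x" using row_of_less_iff[OF assms, of ?i] by simp
  have hi: "x \<le> sum_list (take ?i \<mu>) + \<mu> ! ?i"
    using row_of_less_iff[OF assms, of "Suc ?i"] sum_list_take_Suc[OF i] by simp
  show "col_of \<mu> x < \<mu> ! ?i" "tab_entry \<mu> ?i (col_of \<mu> x) = x"
    using lo hi by (auto simp: col_of_def tab_entry_def)
qed

lemma tab_entry_cell:
  assumes "i < length \<mu>" "j < \<mu> ! i"
  shows "tab_entry \<mu> i j \<in> letters (sum_list \<mu>)" "row_of \<mu> (tab_entry \<mu> i j) = i" "col_of \<mu> (tab_entry \<mu> i j) = j"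
proof -
  let ?x = "tab_entry \<mu> i j"
  have le: "?x \<le> sum_list (take (Suc i) \<mu>)" using assms sum_list_take_Suc[of i \<mu>] by (simp add: tab_entry_def)
  then show x: "?x \<in> letters (sum_list \<mu>)"
    using sum_list_take_le[of "Suc i" \<mu>] by (simp add: letters_def) (simp add: tab_entry_def)
  have "row_of \<mu> ?x < Suc i" using le row_of_less_iff[OF x] by blast
  moreover have "\<not> row_of \<mu> ?x < i" using row_of_less_iff[OF x, of i] by (simp add: tab_entry_def)
  ultimately show i: "row_of \<mu> ?x = i" by simp
  show "col_of \<mu> ?x = j" by (simp add: col_of_def i) (simp add: tab_entry_def)
qed

lemma tab_row_eq: "tab_row \<mu> i = {x \<in> letters (sum_list \<mu>). row_of \<mu> x = i}"
proof (intro set_eqI iffI)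
  fix x assume "x \<in> tab_row \<mu> i"
  then obtain j where "i < length \<mu>" "j < \<mu> ! i" "x = tab_entry \<mu> i j" by (auto simp: tab_row_def)
  then show "x \<in> {x \<in> letters (sum_list \<mu>). row_of \<mu> x = i}" using tab_entry_cell[of i \<mu> j] by simp
next
  fix x assume x: "x \<in> {x \<in> letters (sum_list \<mu>). row_of \<mu> x = i}"
  then show "x \<in> tab_row \<mu> i"
    unfolding tab_row_def using tab_entry_row_col[of x \<mu>] by force
qed

lemma tab_col_eq: "tab_col \<mu> j = {x \<in> letters (sum_list \<mu>). col_of \<mu> x = j}"
proof (intro set_eqI iffI)
  fix x assume "x \<in> tab_col \<mu> j"
  then obtain i where "i < length \<mu>" "j < \<mu> ! i" "x = tab_entry \<mu> i j" by (auto simp: tab_col_def)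
  then show "x \<in> {x \<in> letters (sum_list \<mu>). col_of \<mu> x = j}" using tab_entry_cell[of i \<mu> j] by simp
next
  fix x assume x: "x \<in> {x \<in> letters (sum_list \<mu>). col_of \<mu> x = j}"
  then show "x \<in> tab_col \<mu> j"
    unfolding tab_col_def using tab_entry_row_col[of x \<mu>] by force
qed

lemma permutes_fibres_iff:
  assumes "g \<in> perms m"
  shows "(\<forall>i. g ` {x \<in> letters m. f x = i} = {x \<in> letters m. f x = i}) \<longleftrightarrow> (\<forall>x\<in>letters m. f (g x) = f x)"
proof
  assume "\<forall>i. g ` {x \<in> letters m. f x = i} = {x \<in> letters m. f x = i}"
  then show "\<forall>x\<in>letters m. f (g x) = f x" by blast
next
  assume R: "\<forall>x\<in>letters m. f (g x) = f x"
  show "\<forall>i. g ` {x \<in> letters m. f x = i} = {x \<in> letters m. f x = i}"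
  proof
    fix i
    have "inj g" using assms permutes_inj by (auto simp: perms_def)
    then show "g ` {x \<in> letters m. f x = i} = {x \<in> letters m. f x = i}"
      using R sym_mem[OF assms] by (intro endo_inj_surj) (auto simp: inj_on_def inj_def)
  qed
qed

lemma row_group_eq: "row_group \<mu> = stab (sum_list \<mu>) (row_of \<mu>)"
  unfolding row_group_def tab_row_eq sym_perms stab_def
  by (intro Collect_cong conj_cong refl) (rule permutes_fibres_iff)

lemma col_group_eq: "col_group \<mu> = stab (sum_list \<mu>) (col_of \<mu>)"
  unfolding col_group_def tab_col_eq sym_perms stab_def
  by (intro Collect_cong conj_cong refl) (rule permutes_fibres_iff)

lemma tableau_partition:
  assumes "\<mu> \<in> partitions m"
  shows "tableau m (row_of \<mu>) (col_of \<mu>)"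
proof
  have m: "sum_list \<mu> = m" using assms unfolding partitions_def by blast
  fix x y assume "x \<in> letters m" "y \<in> letters m" "row_of \<mu> x = row_of \<mu> y" "col_of \<mu> x = col_of \<mu> y"
  then show "x = y" by (metis m tab_entry_row_col(3))
next
  have m: "sum_list \<mu> = m" using assms unfolding partitions_def by blast
  have dec: "sorted_wrt (\<ge>) \<mu>" using assms unfolding partitions_def by blast
  fix x i assume x: "x \<in> letters m" and i: "i < row_of \<mu> x"
  have x': "x \<in> letters (sum_list \<mu>)" using x m by simp
  have "\<mu> ! row_of \<mu> x \<le> \<mu> ! i"
    using sorted_wrt_nth_less[OF dec i] tab_entry_row_col(1)[OF x'] by blast
  then have "col_of \<mu> x < \<mu> ! i" "i < length \<mu>" using tab_entry_row_col(1,2)[OF x'] i by auto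
  from tab_entry_cell[OF this(2,1)] show "\<exists>y\<in>letters m. row_of \<mu> y = i \<and> col_of \<mu> y = col_of \<mu> x"
    using m by auto
qed

lemma young_symmetrizer_eq:
  assumes "\<mu> \<in> partitions m"
  shows "young_symmetrizer \<mu> = tableau.symmetrizer m (row_of \<mu>) (col_of \<mu>)"
proof -
  have m: "sum_list \<mu> = m" using assms by (simp add: partitions_def)
  have "row_symmetrizer \<mu> = row_elt m (row_of \<mu>)" "col_antisymmetrizer \<mu> = col_elt m (col_of \<mu>)"
    by (auto simp: row_symmetrizer_def col_antisymmetrizer_def row_elt_def col_elt_def row_group_eq col_group_eq m)
  then show ?thesis
    by (simp add: young_symmetrizer_def tableau.symmetrizer_def[OF tableau_partition[OF assms]] m)
qed

lemma card_row_of_less: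
  assumes "sum_list \<mu> = m"
  shows "card {x \<in> letters m. row_of \<mu> x < i} = sum_list (take i \<mu>)"
proof -
  have "{x \<in> letters m. row_of \<mu> x < i} = {1..sum_list (take i \<mu>)}"
    using row_of_less_iff[of _ \<mu> i] sum_list_take_le[of i \<mu>] assms by (auto simp: letters_def)
  then show ?thesis by simp
qed

lemma partitions_eqI:
  assumes \<mu>: "\<mu> \<in> partitions m" and \<nu>: "\<nu> \<in> partitions m'"
    and eq: "\<And>i. sum_list (take i \<mu>) = sum_list (take i \<nu>)"
  shows "\<mu> = \<nu>"
proof (rule nth_equalityI)
  have len: "length a \<le> length b"
    if "a \<in> partitions p" and e: "\<And>i. sum_list (take i a) = sum_list (take i b)" for a b p
  proof (rule ccontr)
    assume c: "\<not> length a \<le> length b"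
    then have "sum_list (take (Suc (length b)) a) = sum_list (take (length b) a) + a ! length b"
      by (intro sum_list_take_Suc) simp
    then have "a ! length b = 0" using e by simp
    moreover have "a ! length b \<in> set a" using c by (intro nth_mem) simp
    ultimately show False using that(1) by (auto simp: partitions_def)
  qed
  show l: "length \<mu> = length \<nu>"
    using len[OF \<mu> eq] len[OF \<nu> eq[symmetric]] by simp
  fix i assume "i < length \<mu>"
  then show "\<mu> ! i = \<nu> ! i"
    using l sum_list_take_Suc[of i \<mu>] sum_list_take_Suc[of i \<nu>] eq[of i] eq[of "Suc i"] by simp
qed

text \<open>
  This is the product of the hook lengths, by which the Young symmetrizer differs from an idempotent.
\<close>

definition hook_const :: "nat list \<Rightarrow> rat" where
  "hook_const \<mu> = conv (sum_list \<mu>) (young_symmetrizer \<mu>) (young_symmetrizer \<mu>) id"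

context
  fixes m \<mu> assumes \<mu>: "\<mu> \<in> partitions m"
begin

interpretation tableau m "row_of \<mu>" "col_of \<mu>" by (rule tableau_partition[OF \<mu>])

lemma sum_list_partition: "sum_list \<mu> = m"
  using \<mu> by (simp add: partitions_def)

lemma hook_const_eq: "hook_const \<mu> = norm_const"
  by (simp add: hook_const_def norm_const_def young_symmetrizer_eq[OF \<mu>] sum_list_partition)

lemma hook_const_nonzero: "hook_const \<mu> \<noteq> 0"
  using norm_const_nonzero by (simp add: hook_const_eq)

lemma young_symmetrizer_square:
  "conv m (young_symmetrizer \<mu>) (young_symmetrizer \<mu>) = (\<lambda>g. hook_const \<mu> * young_symmetrizer \<mu> g)"
  using symmetrizer_square by (simp add: young_symmetrizer_eq[OF \<mu>] hook_const_eq)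

lemma young_symmetrizer_group_algebra: "young_symmetrizer \<mu> \<in> group_algebra m"
  using symmetrizer_group_algebra by (simp add: young_symmetrizer_eq[OF \<mu>])

lemma young_symmetrizer_sandwich:
  "conv m (young_symmetrizer \<mu>) (conv m x (young_symmetrizer \<mu>))
    = (\<lambda>g. conv m (young_symmetrizer \<mu>) (conv m x (young_symmetrizer \<mu>)) id * young_symmetrizer \<mu> g)" (is "?L = ?R")
proof
  fix g show "?L g = ?R g"
  proof (cases "g \<in> perms m")
    case True
    then show ?thesis using symmetrizer_sandwich[OF True] by (simp add: young_symmetrizer_eq[OF \<mu>])
  next
    case False
    then show ?thesis
      using young_symmetrizer_group_algebra conv_group_algebra[OF conv_group_algebra[OF young_symmetrizer_group_algebra]]
      by (simp add: group_algebra_eq)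
  qed
qed

end

lemma young_symmetrizer_orthogonal:
  assumes \<mu>: "\<mu> \<in> partitions m" and \<nu>: "\<nu> \<in> partitions m" and ne: "\<mu> \<noteq> \<nu>"
  shows "conv m (young_symmetrizer \<mu>) (conv m x (young_symmetrizer \<nu>)) = (\<lambda>g. 0)" (is "?L = _")
proof
  fix g show "?L g = 0"
  proof (cases "g \<in> perms m")
    case True
    show ?thesis
    proof (rule ccontr)
      assume "?L g \<noteq> 0"
      then have "card {x \<in> letters m. row_of \<mu> x < i} = card {x \<in> letters m. row_of \<nu> x < i}" for i
        using tableau_product_nonzero[OF tableau_partition[OF \<mu>] tableau_partition[OF \<nu>] True]
        by (simp add: young_symmetrizer_eq[OF \<mu>] young_symmetrizer_eq[OF \<nu>])
      then have "\<mu> = \<nu>"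
        using card_row_of_less sum_list_partition[OF \<mu>] sum_list_partition[OF \<nu>] by (intro partitions_eqI[OF \<mu> \<nu>]) simp
      with ne show False by simp
    qed
  next
    case False
    then show ?thesis
      using conv_group_algebra[OF conv_group_algebra[OF young_symmetrizer_group_algebra[OF \<nu>]]]
      by (simp add: group_algebra_eq)
  qed
qed

section \<open>Traces and characters\<close>

lemma (in vector_space) linear_on_sum:
  assumes V: "subspace V" and add: "\<And>x y. x \<in> V \<Longrightarrow> y \<in> V \<Longrightarrow> f (x + y) = f x + (f y :: 'c::ab_group_add)"
    and fin: "finite I" and g: "\<And>i. i \<in> I \<Longrightarrow> g i \<in> V"
  shows "f (\<Sum>i\<in>I. g i) = (\<Sum>i\<in>I. f (g i))"
  using fin g
proof (induction I rule: finite_induct)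
  case empty
  have "f 0 = f 0 + f 0" using add[of 0 0] subspace_0[OF V] by simp
  then show ?case by simp
next
  case (insert i I)
  then show ?case using add[of "g i" "\<Sum>i\<in>I. g i"] subspace_sum[OF V, of I g] by simp
qed

text \<open>
  A family \<open>e\<close> spanning a space together with linear forms \<open>\<phi>\<close> such that \<open>v = \<Sum> \<phi>\<^sub>i(v) e\<^sub>i\<close> need not be a basis,
  but computes traces like one. The group elements multiplied by an idempotent form such a family of a left ideal.
\<close>

lemma (in vector_space) trace_on_frame:
  assumes V: "subspace V" and fin: "finite I" and e: "\<And>i. i \<in> I \<Longrightarrow> e i \<in> V"
    and \<phi>_add: "\<And>i x y. i \<in> I \<Longrightarrow> x \<in> V \<Longrightarrow> y \<in> V \<Longrightarrow> \<phi> i (x + y) = \<phi> i x + \<phi> i y"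
    and \<phi>_scale: "\<And>i c x. i \<in> I \<Longrightarrow> x \<in> V \<Longrightarrow> \<phi> i (scale c x) = c * \<phi> i x"
    and frame: "\<And>v. v \<in> V \<Longrightarrow> v = (\<Sum>i\<in>I. scale (\<phi> i v) (e i))"
    and f_in: "\<And>x. x \<in> V \<Longrightarrow> f x \<in> V"
    and f_add: "\<And>x y. x \<in> V \<Longrightarrow> y \<in> V \<Longrightarrow> f (x + y) = f x + f y"
    and f_scale: "\<And>c x. x \<in> V \<Longrightarrow> f (scale c x) = scale c (f x)"
  shows "(let B = (SOME B. \<not> dependent B \<and> span B = V) in \<Sum>b\<in>B. representation B (f b) b) = (\<Sum>i\<in>I. \<phi> i (f (e i)))"
proof -
  define B where "B = (SOME B. \<not> dependent B \<and> span B = V)"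
  have "\<exists>B. \<not> dependent B \<and> span B = V"
    by (metis basis_exists V span_subspace)
  then have B: "\<not> dependent B" "span B = V" unfolding B_def by (metis (mono_tags, lifting) someI_ex)+
  have BV: "B \<subseteq> V" using B span_superset by blast
  have "V \<subseteq> span (e ` I)"
  proof
    fix v assume "v \<in> V"
    then have "v = (\<Sum>i\<in>I. scale (\<phi> i v) (e i))" by (rule frame)
    moreover have "(\<Sum>i\<in>I. scale (\<phi> i v) (e i)) \<in> span (e ` I)"
      by (intro span_sum span_scale span_base) auto
    ultimately show "v \<in> span (e ` I)" by simp
  qed
  then have finB: "finite B"
    using independent_span_bound[of "e ` I" B] fin B BV by auto
  have rep: "v = (\<Sum>b\<in>B. scale (representation B v b) b)" if "v \<in> V" for v
    using sum_representation_eq[of B v B] B that finB by auto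
  have 1: "\<phi> i (f (e i)) = (\<Sum>b\<in>B. representation B (e i) b * \<phi> i (f b))" if i: "i \<in> I" for i
  proof -
    have sV: "scale c b \<in> V" if "b \<in> B" for b c using that BV subspace_scale[OF V] by auto
    have "f (e i) = f (\<Sum>b\<in>B. scale (representation B (e i) b) b)" using rep[OF e[OF i]] by simp
    also have "\<dots> = (\<Sum>b\<in>B. f (scale (representation B (e i) b) b))"
      by (rule linear_on_sum[OF V f_add finB sV])
    also have "\<dots> = (\<Sum>b\<in>B. scale (representation B (e i) b) (f b))"
      using f_scale BV by (intro sum.cong) auto
    finally have "\<phi> i (f (e i)) = \<phi> i (\<Sum>b\<in>B. scale (representation B (e i) b) (f b))" by simp
    also have "\<dots> = (\<Sum>b\<in>B. \<phi> i (scale (representation B (e i) b) (f b)))"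
      by (rule linear_on_sum[OF V \<phi>_add[OF i] finB]) (use BV f_in subspace_scale[OF V] in auto)
    also have "\<dots> = (\<Sum>b\<in>B. representation B (e i) b * \<phi> i (f b))"
      using \<phi>_scale[OF i] BV f_in by (intro sum.cong) auto
    finally show ?thesis .
  qed
  have 2: "representation B (f b) b = (\<Sum>i\<in>I. \<phi> i (f b) * representation B (e i) b)" if b: "b \<in> B" for b
  proof -
    have "representation B (f b) = representation B (\<Sum>i\<in>I. scale (\<phi> i (f b)) (e i))"
      using frame[OF f_in] b BV by auto
    also have "\<dots> = (\<lambda>b'. \<Sum>i\<in>I. representation B (scale (\<phi> i (f b)) (e i)) b')"
      using B e span_scale by (intro representation_sum) auto
    finally show ?thesis using B e by (simp add: representation_scale)
  qed
  have "(\<Sum>b\<in>B. representation B (f b) b) = (\<Sum>b\<in>B. \<Sum>i\<in>I. \<phi> i (f b) * representation B (e i) b)"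
    using 2 by simp
  also have "\<dots> = (\<Sum>i\<in>I. \<Sum>b\<in>B. \<phi> i (f b) * representation B (e i) b)" by (rule sum.swap)
  also have "\<dots> = (\<Sum>i\<in>I. \<phi> i (f (e i)))" using 1 by (simp add: mult.commute)
  finally show ?thesis by (simp add: B_def[symmetric] Let_def)
qed

lemma vector_space_pfun: "vector_space pfun_scale"
  by unfold_locales (auto simp: pfun_scale_def fun_eq_iff algebra_simps)

lemma conv_add_left: "conv m (x + y) z = conv m x z + conv m y z"
  by (auto simp: conv_eq fun_eq_iff algebra_simps sum.distrib)

lemma conv_scale_left: "conv m (\<lambda>g. s * x g) z = (\<lambda>g. s * conv m x z g)"
  by (auto simp: conv_eq sum_distrib_left algebra_simps)

lemma conv_scale_right: "conv m x (\<lambda>g. s * z g) = (\<lambda>g. s * conv m x z g)"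
  by (auto simp: conv_eq sum_distrib_left algebra_simps)

definition delta :: "(nat \<Rightarrow> nat) \<Rightarrow> pfun" where
  "delta g = (\<lambda>h. if h = g then 1 else 0)"

lemma conv_delta_left: "g \<in> perms m \<Longrightarrow> conv m (delta g) x = (\<lambda>h. x (inv g \<circ> h))"
  by (auto simp: conv_eq delta_def if_distrib[of "\<lambda>t. t * _"] sum.delta' cong: if_cong)

abbreviation simple_space :: "nat list \<Rightarrow> pfun set" where
  "simple_space \<mu> \<equiv> rep_space (simple_rep \<mu>)"

lemma subspace_group_algebra: "module.subspace pfun_scale (group_algebra m)"
proof -
  interpret vector_space pfun_scale by (rule vector_space_pfun)
  show ?thesis by (rule subspaceI) (auto simp: group_algebra_eq pfun_scale_def)
qed

lemma simple_space_iff: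
  assumes \<mu>: "\<mu> \<in> partitions m"
  shows "x \<in> simple_space \<mu> \<longleftrightarrow> x \<in> group_algebra m \<and> conv m x (young_symmetrizer \<mu>) = (\<lambda>g. hook_const \<mu> * x g)"
proof
  assume "x \<in> simple_space \<mu>"
  then obtain y where y: "x = conv m y (young_symmetrizer \<mu>)"
    by (auto simp: simple_rep_def sum_list_partition[OF \<mu>])
  have "conv m x (young_symmetrizer \<mu>) = conv m y (\<lambda>g. hook_const \<mu> * young_symmetrizer \<mu> g)"
    unfolding y conv_assoc young_symmetrizer_square[OF \<mu>] ..
  then show "x \<in> group_algebra m \<and> conv m x (young_symmetrizer \<mu>) = (\<lambda>g. hook_const \<mu> * x g)"
    using conv_group_algebra[OF young_symmetrizer_group_algebra[OF \<mu>]] by (simp add: y conv_scale_right)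
next
  assume x: "x \<in> group_algebra m \<and> conv m x (young_symmetrizer \<mu>) = (\<lambda>g. hook_const \<mu> * x g)"
  let ?y = "\<lambda>g. (1 / hook_const \<mu>) * x g"
  have "?y \<in> group_algebra m" using x by (auto simp: group_algebra_eq)
  moreover have "conv m ?y (young_symmetrizer \<mu>) = x"
    using x hook_const_nonzero[OF \<mu>] by (simp only: conv_scale_left) (auto simp: fun_eq_iff)
  ultimately show "x \<in> simple_space \<mu>"
    by (auto simp: simple_rep_def sum_list_partition[OF \<mu>] image_iff intro!: bexI[of _ ?y])
qed

lemma subspace_simple_space:
  assumes \<mu>: "\<mu> \<in> partitions m"
  shows "module.subspace pfun_scale (simple_space \<mu>)"
proof -
  interpret vector_space pfun_scale by (rule vector_space_pfun)
  show ?thesis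
  proof (rule subspaceI)
    show "0 \<in> simple_space \<mu>" by (simp add: simple_space_iff[OF \<mu>]) (auto simp: group_algebra_eq conv_eq)
    fix x y assume "x \<in> simple_space \<mu>" "y \<in> simple_space \<mu>"
    then show "x + y \<in> simple_space \<mu>"
      by (simp add: simple_space_iff[OF \<mu>] conv_add_left subspace_add[OF subspace_group_algebra]) (auto simp: algebra_simps)
  next
    fix c x assume x: "x \<in> simple_space \<mu>"
    then have "pfun_scale c x \<in> group_algebra m"
      by (simp add: simple_space_iff[OF \<mu>] subspace_scale[OF subspace_group_algebra])
    then show "pfun_scale c x \<in> simple_space \<mu>" using x
      by (simp add: simple_space_iff[OF \<mu>] conv_scale_left pfun_scale_def mult.left_commute)
  qed
qed

lemma simple_space_act:
  assumes \<mu>: "\<mu> \<in> partitions m" and g: "g \<in> perms m" and x: "x \<in> simple_space \<mu>"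
  shows "(\<lambda>h. x (inv g \<circ> h)) \<in> simple_space \<mu>"
proof -
  have xg: "x \<in> group_algebra m" and xc: "conv m x (young_symmetrizer \<mu>) = (\<lambda>g. hook_const \<mu> * x g)"
    using x simple_space_iff[OF \<mu>] by auto
  have e: "(\<lambda>h. x (inv g \<circ> h)) = conv m (delta g) x" by (simp add: conv_delta_left[OF g])
  show ?thesis unfolding e simple_space_iff[OF \<mu>]
    using conv_group_algebra[OF xg] by (simp add: conv_assoc xc conv_scale_right)
qed

lemma sum_apply_fun: "(\<Sum>i\<in>I. f i) x = (\<Sum>i\<in>I. f i x)"
  by (induction I rule: infinite_finite_induct) auto

definition frame_vec :: "nat list \<Rightarrow> (nat \<Rightarrow> nat) \<Rightarrow> pfun" where
  "frame_vec \<mu> h = (\<lambda>g. young_symmetrizer \<mu> (inv h \<circ> g) / hook_const \<mu>)"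

lemma frame_vec_simple_space:
  assumes \<mu>: "\<mu> \<in> partitions m" and h: "h \<in> perms m"
  shows "frame_vec \<mu> h \<in> simple_space \<mu>"
proof -
  interpret vector_space pfun_scale by (rule vector_space_pfun)
  have "young_symmetrizer \<mu> \<in> simple_space \<mu>"
    using young_symmetrizer_square[OF \<mu>] young_symmetrizer_group_algebra[OF \<mu>] by (simp add: simple_space_iff[OF \<mu>])
  from subspace_scale[OF subspace_simple_space[OF \<mu>] simple_space_act[OF \<mu> h this]]
  have "pfun_scale (1 / hook_const \<mu>) (\<lambda>g. young_symmetrizer \<mu> (inv h \<circ> g)) \<in> simple_space \<mu>" .
  then show ?thesis by (simp add: frame_vec_def pfun_scale_def)
qed

lemma frame_vec_expansion:
  assumes \<mu>: "\<mu> \<in> partitions m" and v: "v \<in> simple_space \<mu>"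
  shows "v = (\<Sum>h\<in>perms m. pfun_scale (v h) (frame_vec \<mu> h))"
proof
  fix g
  have "hook_const \<mu> * v g = (\<Sum>h\<in>perms m. v h * young_symmetrizer \<mu> (inv h \<circ> g))"
    using v unfolding simple_space_iff[OF \<mu>] conv_eq by metis
  then have "v g = (\<Sum>h\<in>perms m. v h * young_symmetrizer \<mu> (inv h \<circ> g)) / hook_const \<mu>"
    using hook_const_nonzero[OF \<mu>] by (simp add: field_simps)
  then show "v g = (\<Sum>h\<in>perms m. pfun_scale (v h) (frame_vec \<mu> h)) g"
    by (simp add: sum_divide_distrib sum_apply_fun pfun_scale_def frame_vec_def)
qed

lemma simple_char_outside: "g \<notin> perms m \<Longrightarrow> sum_list \<mu> = m \<Longrightarrow> simple_char \<mu> g = 0"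
  by (simp add: character_def sym_perms del: mem_Collect_eq) (simp add: perms_def letters_def)

lemma simple_char_formula:
  assumes \<mu>: "\<mu> \<in> partitions m" and g: "g \<in> perms m"
  shows "simple_char \<mu> g = (\<Sum>h\<in>perms m. young_symmetrizer \<mu> (inv h \<circ> (inv g \<circ> h))) / hook_const \<mu>"
proof -
  interpret vector_space pfun_scale by (rule vector_space_pfun)
  let ?f = "\<lambda>x h. x (inv g \<circ> h) :: rat"
  have "simple_char \<mu> g = trace_on pfun_scale (simple_space \<mu>) ?f"
    using g by (simp add: character_def sum_list_partition[OF \<mu>] sym_perms[symmetric] simple_rep_def)
  also have "\<dots> = (\<Sum>h\<in>perms m. ?f (frame_vec \<mu> h) h)"
    unfolding trace_on_def
    by (rule trace_on_frame[where \<phi> = "\<lambda>h x. x h", OF subspace_simple_space[OF \<mu>] finite_sym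
          frame_vec_simple_space[OF \<mu>] _ _ frame_vec_expansion[OF \<mu>] simple_space_act[OF \<mu> g]])
       (auto simp: pfun_scale_def)
  finally show ?thesis by (simp add: frame_vec_def sum_divide_distrib)
qed

definition class_fun :: "nat \<Rightarrow> pfun \<Rightarrow> bool" where
  "class_fun m f \<longleftrightarrow> (\<forall>g\<in>perms m. \<forall>h\<in>perms m. f (h \<circ> (g \<circ> inv h)) = f g)"

lemma scalar_prod_perms:
  "scalar_prod m f1 f2 = (1 / fact m) * (\<Sum>g\<in>perms m. f1 g * f2 (inv g))"
  unfolding scalar_prod_def sym_perms by (simp add: card_sym)

text \<open>
  A character is the average of a conjugated Young symmetrizer, so its product with a class function needs no averaging.
\<close>

lemma scalar_prod_simple_char:
  assumes \<mu>: "\<mu> \<in> partitions m" and f: "class_fun m f"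
  shows "scalar_prod m (simple_char \<mu>) f = (\<Sum>g\<in>perms m. young_symmetrizer \<mu> g * f g) / hook_const \<mu>"
proof -
  let ?c = "young_symmetrizer \<mu>"
  have "(\<Sum>g\<in>perms m. simple_char \<mu> g * f (inv g))
      = (\<Sum>g\<in>perms m. \<Sum>h\<in>perms m. ?c (inv h \<circ> (inv g \<circ> h)) * f (inv g)) / hook_const \<mu>"
    by (simp add: simple_char_formula[OF \<mu>] sum_divide_distrib sum_distrib_right)
  also have "(\<Sum>g\<in>perms m. \<Sum>h\<in>perms m. ?c (inv h \<circ> (inv g \<circ> h)) * f (inv g))
      = (\<Sum>g\<in>perms m. \<Sum>h\<in>perms m. ?c (inv h \<circ> (g \<circ> h)) * f g)"
    by (rule sum_sym_inv)
  also have "\<dots> = (\<Sum>h\<in>perms m. \<Sum>g\<in>perms m. ?c (inv h \<circ> (g \<circ> h)) * f g)"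
    by (rule sum.swap)
  also have "\<dots> = (\<Sum>h\<in>perms m. \<Sum>u\<in>perms m. ?c u * f u)"
  proof (rule sum.cong[OF refl])
    fix h assume h: "h \<in> perms m"
    show "(\<Sum>g\<in>perms m. ?c (inv h \<circ> (g \<circ> h)) * f g) = (\<Sum>u\<in>perms m. ?c u * f u)"
    proof (rule sum.reindex_bij_witness[where i = "\<lambda>u. h \<circ> (u \<circ> inv h)" and j = "\<lambda>g. inv h \<circ> (g \<circ> h)"])
      fix g assume g: "g \<in> perms m"
      show *: "h \<circ> ((inv h \<circ> (g \<circ> h)) \<circ> inv h) = g" using h by (simp add: comp_assoc)
      show "inv h \<circ> (g \<circ> h) \<in> perms m" using g h by simp
      have "f (h \<circ> ((inv h \<circ> (g \<circ> h)) \<circ> inv h)) = f (inv h \<circ> (g \<circ> h))"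
        using f g h unfolding class_fun_def by simp
      then show "?c (inv h \<circ> (g \<circ> h)) * f (inv h \<circ> (g \<circ> h)) = ?c (inv h \<circ> (g \<circ> h)) * f g" unfolding * by simp
    next
      fix u assume u: "u \<in> perms m"
      show "inv h \<circ> ((h \<circ> (u \<circ> inv h)) \<circ> h) = u" using h by (simp add: comp_assoc)
      show "h \<circ> (u \<circ> inv h) \<in> perms m" using u h by simp
    qed
  qed
  also have "\<dots> = fact m * (\<Sum>u\<in>perms m. ?c u * f u)" by (simp add: card_sym)
  finally show ?thesis by (simp add: scalar_prod_perms)
qed

lemma class_fun_simple_char:
  assumes \<mu>: "\<mu> \<in> partitions m"
  shows "class_fun m (simple_char \<mu>)"
  unfolding class_fun_def
proof (intro ballI)
  fix g k assume g: "g \<in> perms m" and k: "k \<in> perms m"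
  let ?c = "young_symmetrizer \<mu>"
  have "(\<Sum>h\<in>perms m. ?c (inv h \<circ> (inv (k \<circ> (g \<circ> inv k)) \<circ> h)))
      = (\<Sum>h\<in>perms m. ?c (inv (k \<circ> h) \<circ> (inv (k \<circ> (g \<circ> inv k)) \<circ> (k \<circ> h))))"
    using sum_sym_left[OF k, of "\<lambda>h. ?c (inv h \<circ> (inv (k \<circ> (g \<circ> inv k)) \<circ> h))"] by simp
  also have "\<dots> = (\<Sum>h\<in>perms m. ?c (inv h \<circ> (inv g \<circ> h)))"
  proof (rule sum.cong[OF refl])
    fix h assume h: "h \<in> perms m"
    have "inv (k \<circ> (g \<circ> inv k)) = k \<circ> (inv g \<circ> inv k)"
      using g k sym_inv_distrib[OF k, of "g \<circ> inv k"] sym_inv_distrib[OF g, of "inv k"] by (simp add: comp_assoc)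
    then show "?c (inv (k \<circ> h) \<circ> (inv (k \<circ> (g \<circ> inv k)) \<circ> (k \<circ> h))) = ?c (inv h \<circ> (inv g \<circ> h))"
      using g k h sym_inv_distrib[OF k h] by (simp add: comp_assoc)
  qed
  finally show "simple_char \<mu> (k \<circ> (g \<circ> inv k)) = simple_char \<mu> g"
    using g k by (simp add: simple_char_formula[OF \<mu>])
qed

text \<open>
  The product is the sum of the coefficients of \<open>h\<close> in \<open>c h d\<close>, divided by the two norms; \<open>c h d\<close> vanishes for different shapes, and is
  a multiple of \<open>c\<close> whose factor is read off at the identity for equal ones.
\<close>

lemma simple_char_orthonormal:
  assumes \<mu>: "\<mu> \<in> partitions m" and \<nu>: "\<nu> \<in> partitions m"
  shows "scalar_prod m (simple_char \<mu>) (simple_char \<nu>) = (if \<mu> = \<nu> then 1 else 0)"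
proof -
  let ?c = "young_symmetrizer \<mu>" and ?d = "young_symmetrizer \<nu>"
  have "scalar_prod m (simple_char \<mu>) (simple_char \<nu>)
      = (\<Sum>g\<in>perms m. \<Sum>h\<in>perms m. ?c g * ?d (inv h \<circ> (inv g \<circ> h))) / (hook_const \<mu> * hook_const \<nu>)"
    unfolding scalar_prod_simple_char[OF \<mu> class_fun_simple_char[OF \<nu>]]
    by (simp add: simple_char_formula[OF \<nu>] sum_divide_distrib sum_distrib_left mult.commute)
  also have "(\<Sum>g\<in>perms m. \<Sum>h\<in>perms m. ?c g * ?d (inv h \<circ> (inv g \<circ> h)))
      = (\<Sum>h\<in>perms m. conv m ?c (conv m (delta h) ?d) h)"
    by (subst sum.swap) (simp add: conv_delta_left, simp add: conv_eq)
  finally have sp: "scalar_prod m (simple_char \<mu>) (simple_char \<nu>)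
      = (\<Sum>h\<in>perms m. conv m ?c (conv m (delta h) ?d) h) / (hook_const \<mu> * hook_const \<nu>)" .
  show ?thesis
  proof (cases "\<mu> = \<nu>")
    case False
    then show ?thesis using sp young_symmetrizer_orthogonal[OF \<mu> \<nu>] by simp
  next
    case True
    have "conv m ?c (conv m (delta h) ?c) h = hook_const \<mu> * (?c h * ?c (inv h))" if h: "h \<in> perms m" for h
    proof -
      have "conv m ?c (conv m (delta h) ?c) id = conv m (conv m (delta h) ?c) ?c id"
        by (rule conv_at_id_commute)
      also have "\<dots> = hook_const \<mu> * ?c (inv h)"
        unfolding conv_assoc young_symmetrizer_square[OF \<mu>] conv_scale_right
        unfolding conv_delta_left[OF h] by simp
      finally show ?thesis
        using fun_cong[OF young_symmetrizer_sandwich[OF \<mu>, of "delta h"], of h] by simp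
    qed
    then have "(\<Sum>h\<in>perms m. conv m ?c (conv m (delta h) ?c) h) = hook_const \<mu> * (\<Sum>h\<in>perms m. ?c h * ?c (inv h))"
      by (simp add: sum_distrib_left)
    also have "(\<Sum>h\<in>perms m. ?c h * ?c (inv h)) = hook_const \<mu>"
      by (simp add: hook_const_def sum_list_partition[OF \<mu>] conv_at_id)
    finally show ?thesis using sp True hook_const_nonzero[OF \<mu>] by simp
  qed
qed

section \<open>Colourings\<close>

definition colourings :: "nat \<Rightarrow> 'c set \<Rightarrow> (nat \<Rightarrow> 'c) set" where
  "colourings m K = PiE (letters m) (\<lambda>_. K)"

definition colour_count :: "nat \<Rightarrow> (nat \<Rightarrow> 'c) \<Rightarrow> 'c \<Rightarrow> nat" where
  "colour_count m F k = card {x \<in> letters m. F x = k}"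

definition colour_counts :: "nat \<Rightarrow> 'c set \<Rightarrow> ('c \<Rightarrow> nat) set" where
  "colour_counts m K = {M. (\<forall>k. k \<notin> K \<longrightarrow> M k = 0) \<and> (\<Sum>k\<in>K. M k) = m}"

lemma finite_colourings [simp]: "finite K \<Longrightarrow> finite (colourings m K)"
  unfolding colourings_def by (intro finite_PiE) auto

lemma colourings_mem: "F \<in> colourings m K \<Longrightarrow> x \<in> letters m \<Longrightarrow> F x \<in> K"
  by (auto simp: colourings_def)

lemma sum_card_fibres:
  assumes "finite K" "finite X" "\<And>x. x \<in> X \<Longrightarrow> F x \<in> K"
  shows "(\<Sum>k\<in>K. card {x \<in> X. F x = k}) = card X"
proof -
  have "(\<Sum>k\<in>K. \<Sum>x\<in>{x \<in> X. F x = k}. 1) = (\<Sum>x\<in>X. 1 :: nat)"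
    using assms by (intro sum.group) auto
  then show ?thesis by simp
qed

lemma content_contents:
  assumes "finite K" "F \<in> colourings m K"
  shows "colour_count m F \<in> colour_counts m K"
proof -
  have "colour_count m F k = 0" if "k \<notin> K" for k
    using colourings_mem[OF assms(2)] that by (auto simp: colour_count_def)
  moreover have "(\<Sum>k\<in>K. colour_count m F k) = m"
    using sum_card_fibres[OF assms(1), of "letters m" F] colourings_mem[OF assms(2)]
    by (simp add: colour_count_def)
  ultimately show ?thesis by (simp add: colour_counts_def)
qed

lemma finite_contents [simp]:
  assumes "finite K" shows "finite (colour_counts m K)"
proof -
  have "colour_counts m K \<subseteq> (\<lambda>f k. if k \<in> K then f k else 0) ` PiE K (\<lambda>_. {..m})"
  proof
    fix M assume M: "M \<in> colour_counts m K"
    then have "M k \<le> m" if "k \<in> K" for k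
      using member_le_sum[of k K M] assms that by (auto simp: colour_counts_def)
    then show "M \<in> (\<lambda>f k. if k \<in> K then f k else 0) ` PiE K (\<lambda>_. {..m})"
      using M by (intro image_eqI[of _ _ "restrict M K"]) (auto simp: colour_counts_def)
  qed
  then show ?thesis using assms by (elim finite_subset) (auto intro: finite_PiE)
qed

text \<open>
  Numbering the letters of each colour refines a colouring to a bijection that depends on the colour multiplicities only
  through its range; two colourings with equal multiplicities are compared through it.
\<close>

lemma colouring_standardization:
  assumes "finite K" "\<And>x. x \<in> X \<Longrightarrow> F x \<in> K" "\<And>k. k \<in> K \<Longrightarrow> card {x \<in> X. F x = k} = M k" "finite X"
  obtains b where "bij_betw b X (Sigma K (\<lambda>k. {..<M k}))" "\<And>x. x \<in> X \<Longrightarrow> fst (b x) = F x"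
proof -
  have "\<exists>h. bij_betw h {x \<in> X. F x = k} {..<M k}" if "k \<in> K" for k
    using assms(3)[OF that] assms(4) by (intro finite_same_card_bij) auto
  then obtain h where h: "\<And>k. k \<in> K \<Longrightarrow> bij_betw (h k) {x \<in> X. F x = k} {..<M k}" by metis
  let ?b = "\<lambda>x. (F x, h (F x) x)"
  have "bij_betw ?b X (Sigma K (\<lambda>k. {..<M k}))"
  proof (rule bij_betw_imageI)
    show "inj_on ?b X"
    proof (rule inj_onI)
      fix x y assume xy: "x \<in> X" "y \<in> X" "?b x = ?b y"
      then show "x = y" using bij_betw_imp_inj_on[OF h[OF assms(2)[OF xy(1)]]] by (auto simp: inj_on_def)
    qed
    show "?b ` X = Sigma K (\<lambda>k. {..<M k})"
    proof (intro set_eqI iffI)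
      fix y assume "y \<in> ?b ` X"
      then show "y \<in> Sigma K (\<lambda>k. {..<M k})" using assms(2) h bij_betwE by fastforce
    next
      fix y assume "y \<in> Sigma K (\<lambda>k. {..<M k})"
      then obtain k i where y: "y = (k, i)" "k \<in> K" "i < M k" by auto
      then have "i \<in> h k ` {x \<in> X. F x = k}" using h[of k] by (simp add: bij_betw_def)
      then show "y \<in> ?b ` X" using y by auto
    qed
  qed
  then show thesis using that by simp
qed

lemma colouring_transport:
  assumes K: "finite K" and F: "F \<in> colourings m K" and G: "G \<in> colourings m K" and eq: "colour_count m F = colour_count m G"
  obtains s where "s \<in> perms m" "\<And>x. x \<in> letters m \<Longrightarrow> F x = G (s x)"
proof -
  let ?S = "Sigma K (\<lambda>k. {..<colour_count m F k})"
  obtain a where a: "bij_betw a (letters m) ?S" "\<And>x. x \<in> letters m \<Longrightarrow> fst (a x) = F x"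
    using colouring_standardization[OF K, of "letters m" F "colour_count m F"] colourings_mem[OF F] by (auto simp: colour_count_def)
  obtain b where b: "bij_betw b (letters m) ?S" "\<And>x. x \<in> letters m \<Longrightarrow> fst (b x) = G x"
    using colouring_standardization[OF K, of "letters m" G "colour_count m F"] colourings_mem[OF G] by (auto simp: colour_count_def eq)
  define s where "s x = (if x \<in> letters m then inv_into (letters m) b (a x) else x)" for x
  have "bij_betw (inv_into (letters m) b \<circ> a) (letters m) (letters m)"
    using a(1) b(1) by (intro bij_betw_trans[of a _ ?S] bij_betw_inv_into)
  then have "bij_betw s (letters m) (letters m)"
    by (rule bij_betw_cong[THEN iffD1, rotated]) (simp add: s_def)
  then have s: "s \<in> perms m" unfolding perms_def by (auto intro!: bij_imp_permutes simp: s_def)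
  have "F x = G (s x)" if x: "x \<in> letters m" for x
  proof -
    have "s x \<in> letters m" using sym_mem[OF s] x by blast
    moreover have "b (s x) = a x"
    proof -
      have "a x \<in> b ` letters m" using x a(1) b(1) by (simp add: bij_betw_def) blast
      then show ?thesis using x by (simp add: s_def f_inv_into_f)
    qed
    ultimately show ?thesis using a(2)[OF x] b(2) by metis
  qed
  then show thesis using that s by blast
qed

lemma content_surj:
  assumes K: "finite K" and M: "M \<in> colour_counts m K"
  obtains F where "F \<in> colourings m K" "colour_count m F = M"
proof -
  let ?S = "Sigma K (\<lambda>k. {..<M k})"
  have "card ?S = m" using K M by (simp add: colour_counts_def)
  then obtain b where b: "bij_betw b (letters m) ?S"
    using finite_same_card_bij[of "letters m" ?S] K by auto
  define F where "F = restrict (fst \<circ> b) (letters m)"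
  have "F \<in> colourings m K" using b bij_betwE by (fastforce simp: F_def colourings_def)
  moreover have "colour_count m F k = M k" for k
  proof -
    have "b ` {x \<in> letters m. F x = k} = {y \<in> ?S. fst y = k}"
    proof -
      have "b ` {x \<in> letters m. F x = k} = {y \<in> b ` letters m. fst y = k}" by (auto simp: F_def)
      then show ?thesis using b by (simp add: bij_betw_def)
    qed
    moreover have "inj_on b {x \<in> letters m. F x = k}" using b by (auto simp: bij_betw_def inj_on_def)
    ultimately have "colour_count m F k = card {y \<in> ?S. fst y = k}" unfolding colour_count_def using card_image by fastforce
    also have "{y \<in> ?S. fst y = k} = (if k \<in> K then {k} \<times> {..<M k} else {})" by auto
    finally show ?thesis using M by (auto simp: colour_counts_def)
  qed
  ultimately show thesis using that by blast
qed

text \<open>The colourings with given multiplicities form one orbit of the symmetric group; this is the orbit-stabilizer relation.\<close>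

lemma sum_card_stab_content:
  assumes K: "finite K" and M: "M \<in> colour_counts m K"
  shows "(\<Sum>F | F \<in> colourings m K \<and> colour_count m F = M. card (stab m F)) = fact m"
proof -
  obtain G where G: "G \<in> colourings m K" "colour_count m G = M" using content_surj[OF K M] .
  let ?X = "{F \<in> colourings m K. colour_count m F = M}"
  define act where "act s = restrict (G \<circ> s) (letters m)" for s :: "nat \<Rightarrow> nat"
  have act: "act s \<in> ?X" if s: "s \<in> perms m" for s
  proof -
    have "act s \<in> colourings m K"
      using colourings_mem[OF G(1)] sym_mem[OF s] by (auto simp: act_def colourings_def)
    moreover have "colour_count m (act s) k = M k" for k
    proof -
      have "bij_betw s {x \<in> letters m. act s x = k} {x \<in> letters m. G x = k}"
        by (rule bij_betwI[where g = "inv s"])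
           (auto simp: act_def sym_inv_apply[OF s] sym_mem[OF s] sym_mem[OF sym_inv[OF s]])
      then show ?thesis using bij_betw_same_card G(2) unfolding colour_count_def by blast
    qed
    ultimately show ?thesis by auto
  qed
  have fibre: "card {s \<in> perms m. act s = F} = card (stab m F)" if F: "F \<in> ?X" for F
  proof -
    have FK: "F \<in> colourings m K" using F by simp
    obtain t where t: "t \<in> perms m" "\<And>x. x \<in> letters m \<Longrightarrow> F x = G (t x)"
      using colouring_transport[OF K FK G(1)] F G(2) by auto
    have iff: "act s = F \<longleftrightarrow> (\<forall>x\<in>letters m. G (s x) = F x)" for s
      using FK by (auto simp: act_def fun_eq_iff colourings_def PiE_def extensional_def)
    have "bij_betw (\<lambda>s. inv t \<circ> s) {s \<in> perms m. act s = F} (stab m F)"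
    proof (rule bij_betwI[where g = "\<lambda>s. t \<circ> s"])
      show "(\<lambda>s. inv t \<circ> s) \<in> {s \<in> perms m. act s = F} \<rightarrow> stab m F"
      proof (intro Pi_I stabI)
        fix s x assume s: "s \<in> {s \<in> perms m. act s = F}" and x: "x \<in> letters m"
        have sx: "inv t (s x) \<in> letters m" using x s sym_mem[of s m x] sym_mem[OF sym_inv[OF t(1)]] by auto
        show "F ((inv t \<circ> s) x) = F x"
          using t(2)[OF sx] s x iff[of s] by (simp add: sym_inv_apply[OF t(1)])
      qed (use t in auto)
      show "(\<lambda>s. t \<circ> s) \<in> stab m F \<rightarrow> {s \<in> perms m. act s = F}"
      proof
        fix s assume s: "s \<in> stab m F"
        have "G (t (s x)) = F x" if "x \<in> letters m" for x
          using t(2)[of "s x"] sym_mem[OF stab_sym[OF s], of x] stabD[OF s that] that by simp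
        then show "t \<circ> s \<in> {s \<in> perms m. act s = F}" using s t(1) iff by simp
      qed
    qed (use t in auto)
    then show ?thesis by (rule bij_betw_same_card)
  qed
  have "(\<Sum>F\<in>?X. card {s \<in> perms m. act s = F}) = card (perms m)"
    using K act by (intro sum_card_fibres) auto
  then show ?thesis using fibre by (simp add: card_sym)
qed

lemma sum_colourings_stab:
  fixes \<phi> :: "('c \<Rightarrow> nat) \<Rightarrow> rat"
  assumes K: "finite K"
  shows "(\<Sum>F\<in>colourings m K. of_nat (card (stab m F)) * \<phi> (colour_count m F)) = fact m * (\<Sum>M\<in>colour_counts m K. \<phi> M)"
proof -
  have "(\<Sum>M\<in>colour_counts m K. \<Sum>F\<in>{F \<in> colourings m K. colour_count m F = M}. of_nat (card (stab m F)) * \<phi> (colour_count m F))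
     = (\<Sum>F\<in>colourings m K. of_nat (card (stab m F)) * \<phi> (colour_count m F))"
    using K content_contents[OF K] by (intro sum.group) auto
  moreover have "(\<Sum>F\<in>{F \<in> colourings m K. colour_count m F = M}. of_nat (card (stab m F)) * \<phi> (colour_count m F)) = fact m * \<phi> M"
    if M: "M \<in> colour_counts m K" for M
  proof -
    have "(\<Sum>F\<in>{F \<in> colourings m K. colour_count m F = M}. of_nat (card (stab m F)) * \<phi> (colour_count m F))
      = of_nat (\<Sum>F\<in>{F \<in> colourings m K. colour_count m F = M}. card (stab m F)) * \<phi> M"
      by (simp add: sum_distrib_right)
    then show ?thesis using sum_card_stab_content[OF K M] by simp
  qed
  ultimately show ?thesis by (simp add: sum_distrib_left)
qed

lemma sum_perms_colourings:
  assumes "finite K"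
  shows "(\<Sum>g\<in>perms m. f g * (\<Sum>F | F \<in> colourings m K \<and> g \<in> stab m F. \<phi> F)) = (\<Sum>F\<in>colourings m K. \<phi> F * (\<Sum>g\<in>stab m F. f g :: rat))"
proof -
  have "(\<Sum>g\<in>perms m. f g * (\<Sum>F | F \<in> colourings m K \<and> g \<in> stab m F. \<phi> F))
     = (\<Sum>g\<in>perms m. \<Sum>F\<in>colourings m K. if g \<in> stab m F then \<phi> F * f g else 0)"
    using assms by (auto simp: sum_distrib_left sum.inter_filter mult.commute intro!: sum.cong)
  also have "\<dots> = (\<Sum>F\<in>colourings m K. \<Sum>g\<in>perms m. if g \<in> stab m F then \<phi> F * f g else 0)"
    by (rule sum.swap)
  also have "\<dots> = (\<Sum>F\<in>colourings m K. \<Sum>g\<in>stab m F. \<phi> F * f g)"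
    by (intro sum.cong refl sum.mono_neutral_cong_right) auto
  finally show ?thesis by (simp add: sum_distrib_left)
qed

section \<open>Cycles\<close>

lemma perms_orbit:
  assumes g: "g \<in> perms m" and x: "x \<in> letters m"
  shows "x \<in> orbit g x" "orbit g x \<subseteq> letters m" "finite (orbit g x)"
    "y \<in> orbit g x \<Longrightarrow> orbit g y = orbit g x"
proof -
  have p: "permutation g" using g by (rule permutation_sym)
  show s: "x \<in> orbit g x" using p by (rule permutation_self_in_orbit)
  show sub: "orbit g x \<subseteq> letters m" using permutes_orbit_subset[of g "letters m" x] g x by (simp add: perms_def)
  then show "finite (orbit g x)" using finite_letters finite_subset by blast
  show "orbit g y = orbit g x" if "y \<in> orbit g x"
    using orbit_swap[OF s that] that orbit_trans by (metis subsetI subset_antisym)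
qed

lemma stab_iff_orbit_constant:
  assumes g: "g \<in> perms m"
  shows "g \<in> stab m F \<longleftrightarrow> (\<forall>x\<in>letters m. \<forall>y\<in>orbit g x. F y = F x)"
proof
  assume st: "g \<in> stab m F"
  show "\<forall>x\<in>letters m. \<forall>y\<in>orbit g x. F y = F x"
  proof (intro ballI)
    fix x y assume x: "x \<in> letters m" and "y \<in> orbit g x"
    from this(2) show "F y = F x"
    proof induction
      case base then show ?case using stabD[OF st x] .
    next
      case (step y)
      then show ?case using stabD[OF st, of y] perms_orbit(2)[OF g x] by auto
    qed
  qed
next
  assume "\<forall>x\<in>letters m. \<forall>y\<in>orbit g x. F y = F x"
  then show "g \<in> stab m F" using g orbit.base[of g] by (intro stabI) blast+
qed

text \<open>
  Expanding the product chooses a colour for each cycle, and a colouring is fixed by \<open>g\<close> if and only if it is constant on cycles.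
\<close>

lemma prod_cycles_power_sums:
  fixes z :: "'c \<Rightarrow> 'a::comm_semiring_1"
  assumes g: "g \<in> perms m" and K: "finite K"
  shows "(\<Prod>C\<in>orbit g ` letters m. \<Sum>j\<in>K. z j ^ card C)
       = (\<Sum>F | F \<in> colourings m K \<and> g \<in> stab m F. \<Prod>x\<in>letters m. z (F x))"
proof -
  let ?O = "orbit g ` letters m"
  let ?i = "\<lambda>F. restrict (\<lambda>C. F (SOME x. x \<in> C)) ?O"
  let ?j = "\<lambda>f. restrict (\<lambda>x. f (orbit g x)) (letters m)"
  have pick: "(SOME x. x \<in> C) \<in> C" "(SOME x. x \<in> C) \<in> letters m" "orbit g (SOME x. x \<in> C) = C" if "C \<in> ?O" for C
  proof -
    obtain x where x: "x \<in> letters m" "C = orbit g x" using \<open>C \<in> ?O\<close> by auto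
    show a: "(SOME x. x \<in> C) \<in> C" using perms_orbit(1)[OF g x(1)] x(2) by (intro someI[of "\<lambda>x. x \<in> C" x]) simp
    show "(SOME x. x \<in> C) \<in> letters m" using a perms_orbit(2)[OF g x(1)] x(2) by blast
    show "orbit g (SOME x. x \<in> C) = C" using a perms_orbit(4)[OF g x(1)] x(2) by blast
  qed
  have "(\<Prod>C\<in>?O. \<Sum>j\<in>K. z j ^ card C) = (\<Sum>f\<in>PiE ?O (\<lambda>_. K). \<Prod>C\<in>?O. z (f C) ^ card C)"
    using K by (intro prod_sum_PiE) auto
  also have "\<dots> = (\<Sum>F | F \<in> colourings m K \<and> g \<in> stab m F. \<Prod>x\<in>letters m. z (F x))"
  proof (rule sum.reindex_bij_witness[where i = ?i and j = ?j])
    fix f assume f: "f \<in> PiE ?O (\<lambda>_. K)"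
    show "?i (?j f) = f"
    proof
      fix C show "?i (?j f) C = f C"
        using pick[of C] f by (cases "C \<in> ?O") (auto simp: PiE_def extensional_def)
    qed
    have "?j f \<in> colourings m K" using f by (auto simp: colourings_def)
    moreover have "g \<in> stab m (?j f)"
      unfolding stab_iff_orbit_constant[OF g]
    proof (intro ballI)
      fix x y assume x: "x \<in> letters m" and y: "y \<in> orbit g x"
      then have "y \<in> letters m" using perms_orbit(2)[OF g x] by blast
      then show "?j f y = ?j f x" using x perms_orbit(4)[OF g x y] by simp
    qed
    ultimately show "?j f \<in> {F \<in> colourings m K. g \<in> stab m F}" by simp
    have "(\<Prod>x\<in>letters m. z (?j f x)) = (\<Prod>C\<in>?O. \<Prod>x\<in>{x \<in> letters m. orbit g x = C}. z (?j f x))"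
      by (rule prod.group[symmetric]) auto
    also have "\<dots> = (\<Prod>C\<in>?O. z (f C) ^ card C)"
    proof (rule prod.cong[OF refl])
      fix C assume C: "C \<in> ?O"
      have "{x \<in> letters m. orbit g x = C} = C" using C perms_orbit[OF g] by blast
      moreover have "(\<Prod>x\<in>{x \<in> letters m. orbit g x = C}. z (?j f x)) = (\<Prod>x\<in>{x \<in> letters m. orbit g x = C}. z (f C))"
        by (intro prod.cong) auto
      ultimately show "(\<Prod>x\<in>{x \<in> letters m. orbit g x = C}. z (?j f x)) = z (f C) ^ card C" by simp
    qed
    finally show "(\<Prod>x\<in>letters m. z (?j f x)) = (\<Prod>C\<in>?O. z (f C) ^ card C)" .
  next
    fix F assume F: "F \<in> {F \<in> colourings m K. g \<in> stab m F}"
    then have const: "F y = F x" if "x \<in> letters m" "y \<in> orbit g x" for x y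
      using stab_iff_orbit_constant[OF g, of F] that by blast
    show "?j (?i F) = F"
    proof
      fix x show "?j (?i F) x = F x"
        using pick(1)[of "orbit g x"] const[of x] F by (cases "x \<in> letters m") (auto simp: colourings_def PiE_def extensional_def)
    qed
    show "?i F \<in> PiE ?O (\<lambda>_. K)" using pick(2) F colourings_mem[of F m K] by auto
  qed
  finally show ?thesis .
qed

lemma cycle_count_eq: "cycle_count m i g = card {C \<in> orbit g ` letters m. card C = i}"
  by (simp add: cycle_count_def letters_def)

lemma card_cycle_bounds:
  assumes g: "g \<in> perms m" and C: "C \<in> orbit g ` letters m"
  shows "1 \<le> card C" "card C \<le> m"
proof -
  obtain x where x: "x \<in> letters m" "C = orbit g x" using C by auto
  show "1 \<le> card C" using perms_orbit(1,3)[OF g x(1)] x(2) card_gt_0_iff[of C] by (auto simp: Suc_le_eq)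
  show "card C \<le> m" using perms_orbit(2)[OF g x(1)] x(2) card_mono[of "letters m" C] by simp
qed

lemma prod_cycle_count:
  fixes h :: "nat \<Rightarrow> 'a::comm_semiring_1"
  assumes g: "g \<in> perms m" and D: "m \<le> D"
  shows "(\<Prod>d=1..D. h d ^ cycle_count m d g) = (\<Prod>C\<in>orbit g ` letters m. h (card C))"
proof -
  have "(\<Prod>C\<in>orbit g ` letters m. h (card C)) = (\<Prod>d\<in>{1..D}. \<Prod>C\<in>{C \<in> orbit g ` letters m. card C = d}. h (card C))"
    by (rule prod.group[symmetric]) (use card_cycle_bounds[OF g] D in force)+
  also have "\<dots> = (\<Prod>d=1..D. h d ^ cycle_count m d g)"
    by (intro prod.cong refl) (simp add: cycle_count_eq)
  finally show ?thesis ..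
qed

section \<open>Frobenius' formula\<close>

definition icontent :: "nat \<Rightarrow> (nat \<Rightarrow> nat) \<Rightarrow> nat \<Rightarrow> int" where
  "icontent m F j = int (colour_count m F j)"

text \<open>
  The coefficient of \<open>z\<^sup>\<gamma>\<close> in the Vandermonde product times the product of the power sums of the cycles of \<open>g\<close>,
  that is, the right-hand side of Frobenius' formula.
\<close>

definition alternating_fixed_count :: "nat \<Rightarrow> (nat \<Rightarrow> int) \<Rightarrow> nat \<Rightarrow> pfun" where
  "alternating_fixed_count l \<gamma> m g =
     (\<Sum>F | F \<in> colourings m {..<l} \<and> g \<in> stab m F. of_int (alternant_coeff l (\<gamma> - icontent m F)))"

definition part :: "nat list \<Rightarrow> nat \<Rightarrow> int" where
  "part \<mu> j = (if j < length \<mu> then int (\<mu> ! j) else 0)"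

definition frob_exponent :: "nat list \<Rightarrow> nat \<Rightarrow> int" where
  "frob_exponent \<mu> = part \<mu> + staircase (length \<mu>)"

lemma stab_inv_iff: "g \<in> perms m \<Longrightarrow> inv g \<in> stab m F \<longleftrightarrow> g \<in> stab m F"
  using stab_inv[of g m F] stab_inv[of "inv g" m F] by auto

lemma alternating_fixed_count_inv:
  "g \<in> perms m \<Longrightarrow> alternating_fixed_count l \<gamma> m (inv g) = alternating_fixed_count l \<gamma> m g"
  by (simp add: alternating_fixed_count_def stab_inv_iff)

lemma content_translate:
  assumes h: "h \<in> perms m"
  shows "colour_count m (restrict (F \<circ> h) (letters m)) = colour_count m F"
proof
  fix k
  have "bij_betw h {x \<in> letters m. restrict (F \<circ> h) (letters m) x = k} {x \<in> letters m. F x = k}"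
    by (rule bij_betwI[where g = "inv h"]) (auto simp: sym_inv_apply[OF h] sym_mem[OF h] sym_mem[OF sym_inv[OF h]])
  then show "colour_count m (restrict (F \<circ> h) (letters m)) k = colour_count m F k"
    unfolding colour_count_def by (rule bij_betw_same_card)
qed

lemma class_fun_alternating_fixed_count: "class_fun m (alternating_fixed_count l \<gamma> m)"
  unfolding class_fun_def alternating_fixed_count_def
proof (intro ballI)
  fix g h assume g: "g \<in> perms m" and h: "h \<in> perms m"
  let ?t = "\<lambda>h F. restrict (F \<circ> h) (letters m)"
  let ?X = "\<lambda>g. {F \<in> colourings m {..<l}. g \<in> stab m F}"
  have mem: "?t h F \<in> ?X g" if g: "g \<in> perms m" and h: "h \<in> perms m" and F: "F \<in> ?X (h \<circ> (g \<circ> inv h))" for F g h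
  proof -
    have "g \<in> stab m (?t h F)"
    proof (rule stabI[OF g])
      fix x assume x: "x \<in> letters m"
      then have hx: "h x \<in> letters m" "g x \<in> letters m" using sym_mem[OF h] sym_mem[OF g] by auto
      have "F ((h \<circ> (g \<circ> inv h)) (h x)) = F (h x)" using F hx stabD[of _ m F "h x"] by blast
      then show "?t h F (g x) = ?t h F x" using x hx by (simp add: sym_inv_apply[OF h])
    qed
    moreover have "?t h F \<in> colourings m {..<l}" using F sym_mem[OF h] by (auto simp: colourings_def)
    ultimately show ?thesis by simp
  qed
  have undo: "?t h (?t h' F) = F" if "h \<in> perms m" "h' \<circ> h = id" "F \<in> colourings m {..<l}" for F h h'
  proof
    fix x
    have "h' (h x) = x" using that(2) by (metis comp_apply id_apply)
    then show "?t h (?t h' F) x = F x"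
      using that(3) sym_mem[OF that(1), of x] by (auto simp: colourings_def PiE_def extensional_def)
  qed
  show "(\<Sum>F\<in>?X (h \<circ> (g \<circ> inv h)). of_int (alternant_coeff l (\<gamma> - icontent m F))) = (\<Sum>F\<in>?X g. rat_of_int (alternant_coeff l (\<gamma> - icontent m F)))"
  proof (rule sum.reindex_bij_witness[where i = "?t (inv h)" and j = "?t h"])
    fix F assume F: "F \<in> ?X (h \<circ> (g \<circ> inv h))"
    show "?t (inv h) (?t h F) = F" using F h by (intro undo) auto
    show "?t h F \<in> ?X g" using mem[OF g h F] .
    have "icontent m (?t h F) = icontent m F" using content_translate[OF h, of F] by (simp add: icontent_def fun_eq_iff)
    then show "rat_of_int (alternant_coeff l (\<gamma> - icontent m (?t h F))) = rat_of_int (alternant_coeff l (\<gamma> - icontent m F))" by simp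
  next
    fix F assume F: "F \<in> ?X g"
    show "?t h (?t (inv h) F) = F" using F h by (intro undo) auto
    have "inv h \<circ> ((h \<circ> (g \<circ> inv h)) \<circ> inv (inv h)) = g" using h by (simp add: comp_assoc)
    then show "?t (inv h) F \<in> ?X (h \<circ> (g \<circ> inv h))" using mem[of "h \<circ> (g \<circ> inv h)" "inv h" F] F g h by simp
  qed
qed


lemma staircase_partial_sum_le:
  assumes w: "w permutes {..<l}" and i: "i \<le> l"
  shows "(\<Sum>j<i. staircase l (w j)) \<le> (\<Sum>j<i. staircase l j)"
proof -
  let ?S = "w ` {..<i}"
  have inj: "inj_on w {..<i}" using permutes_inj_on[OF w] .
  have S: "finite ?S" "card ?S = i" using inj by (simp_all add: card_image)
  have "(\<Sum>j<i. staircase l (w j)) = (\<Sum>s\<in>?S. staircase l s)"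
    using inj by (simp add: sum.reindex)
  also have "\<dots> = (\<Sum>s\<in>?S \<inter> {..<i}. staircase l s) + (\<Sum>s\<in>?S - {..<i}. staircase l s)"
    using S by (simp add: sum.Int_Diff)
  also have "(\<Sum>s\<in>?S - {..<i}. staircase l s) \<le> of_nat (card (?S - {..<i})) * staircase l i"
    by (rule sum_bounded_above) (auto simp: staircase_def)
  also have "card (?S - {..<i}) = card ({..<i} - ?S)"
    using S card_Diff_subset_Int[of ?S "{..<i}"] card_Diff_subset_Int[of "{..<i}" ?S] by (simp add: Int_commute)
  also have "of_nat (card ({..<i} - ?S)) * staircase l i \<le> (\<Sum>s\<in>{..<i} - ?S. staircase l s)"
    by (rule sum_bounded_below) (auto simp: staircase_def)
  also have "(\<Sum>s\<in>?S \<inter> {..<i}. staircase l s) + (\<Sum>s\<in>{..<i} - ?S. staircase l s) = (\<Sum>j<i. staircase l j)"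
    by (subst sum.Int_Diff[of "{..<i}" _ ?S]) (auto simp: Int_commute)
  finally show ?thesis by simp
qed

lemma alternant_coeff_nonzeroE:
  assumes "alternant_coeff l \<beta> \<noteq> 0"
  obtains w where "w permutes {..<l}" "\<beta> = staircase l \<circ> w"
proof -
  obtain w where "w \<in> {w. w permutes {..<l}}" "(if \<beta> = staircase l \<circ> w then sign w else 0) \<noteq> 0"
    using sum.not_neutral_contains_not_neutral[OF assms[unfolded alternant_coeff_def]] .
  then show thesis using that by (metis mem_Collect_eq)
qed

lemma part_props:
  assumes "\<mu> \<in> partitions m"
  shows "\<And>i j. i \<le> j \<Longrightarrow> part \<mu> j \<le> part \<mu> i" "\<And>j. 0 \<le> part \<mu> j" "\<And>j. length \<mu> \<le> j \<Longrightarrow> part \<mu> j = 0"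
    "(\<Sum>j<i. part \<mu> j) = int (sum_list (take i \<mu>))"
proof -
  have dec: "sorted_wrt (\<ge>) \<mu>" using assms unfolding partitions_def by blast
  show "part \<mu> j \<le> part \<mu> i" if "i \<le> j" for i j
    using sorted_wrt_nth_less[OF dec, of i j] that by (cases "i = j") (auto simp: part_def)
  show "0 \<le> part \<mu> j" for j by (simp add: part_def)
  show "part \<mu> j = 0" if "length \<mu> \<le> j" for j using that by (simp add: part_def)
  show "(\<Sum>j<i. part \<mu> j) = int (sum_list (take i \<mu>))"
  proof (induction i)
    case (Suc i)
    then show ?case using sum_list_take_Suc[of i \<mu>] by (cases "i < length \<mu>") (auto simp: part_def)
  qed simp
qed

lemma sum_icontent: "(\<Sum>j<i. icontent m F j) = int (card {x \<in> letters m. F x < i})"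
proof (induction i)
  case (Suc i)
  have "{x \<in> letters m. F x < Suc i} = {x \<in> letters m. F x < i} \<union> {x \<in> letters m. F x = i}" by auto
  then have "card {x \<in> letters m. F x < Suc i} = card {x \<in> letters m. F x < i} + colour_count m F i"
    by (simp add: colour_count_def) (subst card_Un_disjoint; auto)
  then show ?case using Suc by (simp add: icontent_def)
qed simp

lemma sum_icontent_colouring:
  "F \<in> colourings m {..<l} \<Longrightarrow> (\<Sum>j<l. icontent m F j) = int m"
proof -
  assume "F \<in> colourings m {..<l}"
  then have "{x \<in> letters m. F x < l} = letters m" using colourings_mem by fastforce
  then show ?thesis by (simp add: sum_icontent)
qed

text \<open>
  A transposition of two equally coloured letters of one column stabilizes \<open>F\<close> and changes the sign of the symmetrizer.
\<close>

lemma (in tableau) sum_stab_not_column_inj: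
  assumes "\<not> column_inj F"
  shows "(\<Sum>g\<in>stab m F. symmetrizer g) = 0"
proof -
  obtain u v where uv: "u \<in> letters m" "v \<in> letters m" "k u = k v" "F u = F v" "u \<noteq> v"
    using assms by (auto simp: column_inj_def)
  have q: "transpose u v \<in> stab m k" "transpose u v \<in> stab m F" using uv by (auto intro: transpose_stab)
  have "(\<Sum>g\<in>stab m F. symmetrizer g) = (\<Sum>g\<in>stab m F. symmetrizer (g \<circ> transpose u v))"
    by (rule sum.reindex_bij_witness[where i = "\<lambda>g. g \<circ> transpose u v" and j = "\<lambda>g. g \<circ> transpose u v"])
       (use q in \<open>auto simp: comp_assoc\<close>)
  also have "\<dots> = - (\<Sum>g\<in>stab m F. symmetrizer g)"
    using symmetrizer_right[OF q(1)] uv by (simp add: sign_swap_id sum_negf)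
  finally show ?thesis by simp
qed

lemma (in tableau) sum_stab_permuted_rows:
  assumes q: "q \<in> stab m k"
  shows "(\<Sum>g\<in>stab m (restrict (r \<circ> q) (letters m)). symmetrizer g) = (\<Sum>p\<in>stab m r. of_int (sign q) * symmetrizer (inv q \<circ> p))"
proof -
  have qs: "q \<in> perms m" using q by simp
  let ?F = "restrict (r \<circ> q) (letters m)"
  show ?thesis
  proof (rule sum.reindex_bij_witness[where i = "\<lambda>p. inv q \<circ> (p \<circ> q)" and j = "\<lambda>g. q \<circ> (g \<circ> inv q)"])
    fix g assume g: "g \<in> stab m ?F"
    have gs: "g \<in> perms m" using g by simp
    show "inv q \<circ> ((q \<circ> (g \<circ> inv q)) \<circ> q) = g" using qs by (simp add: comp_assoc)
    show "q \<circ> (g \<circ> inv q) \<in> stab m r"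
    proof (rule stabI)
      fix x assume x: "x \<in> letters m"
      have y: "inv q x \<in> letters m" using x sym_mem[OF sym_inv[OF qs]] by blast
      have gy: "g (inv q x) \<in> letters m" using y sym_mem[OF gs] by blast
      show "r ((q \<circ> (g \<circ> inv q)) x) = r x"
        using stabD[OF g y] y gy by (simp add: sym_inv_apply[OF qs])
    qed (use qs gs in simp)
    have "symmetrizer (inv q \<circ> (q \<circ> (g \<circ> inv q))) = of_int (sign (inv q)) * symmetrizer g"
      using symmetrizer_right[OF stab_inv[OF q], of g] qs by simp
    then show "of_int (sign q) * symmetrizer (inv q \<circ> (q \<circ> (g \<circ> inv q))) = symmetrizer g"
      using sign_inv_sym[OF qs] by (simp flip: of_int_mult mult.assoc)
  next
    fix p assume p: "p \<in> stab m r"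
    have ps: "p \<in> perms m" using p by simp
    show "q \<circ> ((inv q \<circ> (p \<circ> q)) \<circ> inv q) = p" using qs by (simp add: comp_assoc)
    show "inv q \<circ> (p \<circ> q) \<in> stab m ?F"
    proof (rule stabI)
      fix x assume x: "x \<in> letters m"
      have qx: "q x \<in> letters m" "inv q (p (q x)) \<in> letters m"
        using x sym_mem[OF qs] sym_mem[OF ps] sym_mem[OF sym_inv[OF qs]] by blast+
      show "?F ((inv q \<circ> (p \<circ> q)) x) = ?F x"
        using stabD[OF p qx(1)] qx(2) x by (simp add: sym_inv_apply[OF qs])
    qed (use qs ps in simp)
  qed
qed

lemma (in tableau) norm_const_expansion:
  "norm_const = (\<Sum>q\<in>stab m k. \<Sum>p\<in>stab m r. of_int (sign q) * symmetrizer (inv q \<circ> p))"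
proof -
  have "norm_const = conv m (row_elt m r) (conv m (col_elt m k) symmetrizer) id"
    unfolding norm_const_def by (subst (1) symmetrizer_def) (simp add: conv_assoc)
  also have "\<dots> = (\<Sum>p\<in>stab m r. conv m (col_elt m k) symmetrizer (inv p))"
    unfolding conv_at_id by (rule sum.mono_neutral_cong_right) (auto simp: row_elt_def)
  also have "\<dots> = (\<Sum>p\<in>stab m r. conv m (col_elt m k) symmetrizer p)"
    by (rule sum.reindex_bij_witness[where i = inv and j = inv]) (auto simp: sym_inv_comp(3)[OF stab_sym])
  also have "\<dots> = (\<Sum>p\<in>stab m r. \<Sum>q\<in>stab m k. of_int (sign q) * symmetrizer (inv q \<circ> p))"
    unfolding conv_eq by (intro sum.cong refl sum.mono_neutral_cong_right) (auto simp: col_elt_def)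
  finally show ?thesis by (subst sum.swap)
qed

lemma scalar_prod_simple_char_alternating:
  assumes \<nu>: "\<nu> \<in> partitions m"
  shows "scalar_prod m (simple_char \<nu>) (alternating_fixed_count l \<gamma> m)
    = (\<Sum>F\<in>colourings m {..<l}. of_int (alternant_coeff l (\<gamma> - icontent m F)) * (\<Sum>g\<in>stab m F. young_symmetrizer \<nu> g)) / hook_const \<nu>"
  unfolding scalar_prod_simple_char[OF \<nu> class_fun_alternating_fixed_count]
  by (simp add: alternating_fixed_count_def sum_perms_colourings)

text \<open>
  A colouring contributes only if it is injective on columns, hence dominated by \<open>\<mu>\<close>, and if its multiplicities arise from
  \<open>\<mu>\<close> by adding a staircase and subtracting a permuted one, hence dominate \<open>\<mu>\<close>. What remains are the
  colourings by rows permuted by the column group, and their contributions add up to the coefficient of the identity in \<open>c\<^sup>2\<close>.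
\<close>

lemma scalar_prod_simple_char_own_alternating:
  assumes \<mu>: "\<mu> \<in> partitions m"
  shows "scalar_prod m (simple_char \<mu>) (alternating_fixed_count (length \<mu>) (frob_exponent \<mu>) m) = 1"
proof -
  interpret tableau m "row_of \<mu>" "col_of \<mu>" by (rule tableau_partition[OF \<mu>])
  have m: "sum_list \<mu> = m" by (rule sum_list_partition[OF \<mu>])
  let ?l = "length \<mu>" and ?\<gamma> = "frob_exponent \<mu>" and ?r = "row_of \<mu>"
  let ?R = "\<lambda>q. restrict (?r \<circ> q) (letters m)"
  let ?c = "\<lambda>F. of_int (alternant_coeff ?l (?\<gamma> - icontent m F)) * (\<Sum>g\<in>stab m F. symmetrizer g)"
  have row_col: "?r \<in> letters m \<rightarrow> {..<?l}" using tab_entry_row_col(1)[of _ \<mu>] m by auto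
  have R_mem: "?R q \<in> colourings m {..<?l}" if "q \<in> stab m (col_of \<mu>)" for q
    using row_col sym_mem[OF stab_sym[OF that]] by (auto simp: colourings_def)
  have cont: "icontent m (?R q) = part \<mu>" if q: "q \<in> stab m (col_of \<mu>)" for q
  proof
    fix j
    have "int (card {x \<in> letters m. ?r x < i}) = (\<Sum>j<i. part \<mu> j)" for i
      using card_row_of_less[OF m] part_props(4)[OF \<mu>] by simp
    then have "(\<Sum>j<i. icontent m ?r j) = (\<Sum>j<i. part \<mu> j)" for i by (simp add: sum_icontent)
    from this[of "Suc j"] this[of j] have "icontent m ?r j = part \<mu> j" by simp
    then show "icontent m (?R q) j = part \<mu> j"
      using content_translate[OF stab_sym[OF q], of ?r] by (simp add: icontent_def)
  qed
  have zero: "?c F = 0" if F: "F \<in> colourings m {..<?l} - ?R ` stab m (col_of \<mu>)" for F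
  proof (rule ccontr)
    assume nz: "?c F \<noteq> 0"
    then have ci: "column_inj F" using sum_stab_not_column_inj by auto
    obtain w where w: "w permutes {..<?l}" and eq: "?\<gamma> - icontent m F = staircase ?l \<circ> w"
      using nz alternant_coeff_nonzeroE by (metis mult_eq_0_iff of_int_0)
    have eqj: "icontent m F j = part \<mu> j + staircase ?l j - staircase ?l (w j)" for j
      using fun_cong[OF eq, of j] by (simp add: frob_exponent_def)
    have "card {x \<in> letters m. F x < i} = card {x \<in> letters m. ?r x < i}" for i
    proof (rule antisym)
      show "card {x \<in> letters m. F x < i} \<le> card {x \<in> letters m. ?r x < i}"
        using column_inj_dominance[OF ci, of "{..<i}"] by simp
      show "card {x \<in> letters m. ?r x < i} \<le> card {x \<in> letters m. F x < i}"
      proof (cases "i \<le> ?l")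
        case True
        have "(\<Sum>j<i. icontent m F j) = (\<Sum>j<i. part \<mu> j) + ((\<Sum>j<i. staircase ?l j) - (\<Sum>j<i. staircase ?l (w j)))"
          by (simp add: eqj sum.distrib sum_subtractf)
        then have "(\<Sum>j<i. part \<mu> j) \<le> (\<Sum>j<i. icontent m F j)"
          using staircase_partial_sum_le[OF w True] by simp
        then show ?thesis using card_row_of_less[OF m] part_props(4)[OF \<mu>] by (simp add: sum_icontent)
      next
        case False
        then have "{x \<in> letters m. F x < i} = letters m" using F colourings_mem by fastforce
        then show ?thesis by (metis (no_types, lifting) card_mono finite_letters mem_Collect_eq subsetI)
      qed
    qed
    then obtain q where q: "q \<in> stab m (col_of \<mu>)" "\<And>x. x \<in> letters m \<Longrightarrow> F x = ?r (q x)"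
      using column_inj_same_content[OF ci] by blast
    then have "F = ?R q" using F by (auto simp: fun_eq_iff colourings_def PiE_def extensional_def)
    then show False using F q(1) by blast
  qed
  have injR: "inj_on ?R (stab m (col_of \<mu>))"
  proof (rule inj_onI)
    fix q q' assume q: "q \<in> stab m (col_of \<mu>)" and q': "q' \<in> stab m (col_of \<mu>)" and eq: "?R q = ?R q'"
    show "q = q'"
    proof
      fix x show "q x = q' x"
      proof (cases "x \<in> letters m")
        case True
        have "?r (q x) = ?r (q' x)" using fun_cong[OF eq, of x] True by simp
        moreover have "q x \<in> letters m" "q' x \<in> letters m"
          using sym_mem[OF stab_sym[OF q]] sym_mem[OF stab_sym[OF q']] True by blast+
        ultimately show ?thesis using cell_inj stabD[OF q True] stabD[OF q' True] by simp
      next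
        case False
        then show ?thesis using stab_sym[OF q] stab_sym[OF q'] permutes_not_in by (metis perms_permutes)
      qed
    qed
  qed
  have "(\<Sum>F\<in>colourings m {..<?l}. ?c F) = (\<Sum>F\<in>?R ` stab m (col_of \<mu>). ?c F)"
    using zero R_mem by (intro sum.mono_neutral_right) auto
  also have "\<dots> = (\<Sum>q\<in>stab m (col_of \<mu>). ?c (?R q))"
    using injR by (simp add: sum.reindex)
  also have "\<dots> = (\<Sum>q\<in>stab m (col_of \<mu>). \<Sum>p\<in>stab m ?r. of_int (sign q) * symmetrizer (inv q \<circ> p))"
  proof (rule sum.cong[OF refl])
    fix q assume q: "q \<in> stab m (col_of \<mu>)"
    have "?\<gamma> - icontent m (?R q) = staircase ?l" unfolding cont[OF q] by (simp add: frob_exponent_def)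
    then have "alternant_coeff ?l (?\<gamma> - icontent m (?R q)) = 1" by (simp only: alternant_coeff_staircase)
    then show "?c (?R q) = (\<Sum>p\<in>stab m ?r. of_int (sign q) * symmetrizer (inv q \<circ> p))"
      using sum_stab_permuted_rows[OF q] by simp
  qed
  also have "\<dots> = hook_const \<mu>" using norm_const_expansion hook_const_eq[OF \<mu>] by simp
  finally show ?thesis
    unfolding scalar_prod_simple_char_alternating[OF \<mu>] young_symmetrizer_eq[OF \<mu>]
    using hook_const_nonzero[OF \<mu>] by simp
qed


text \<open>
  The inverse turns \<open>c = a b\<close> into \<open>b a\<close>, and averages over conjugates do not see the order of the factors.
\<close>

lemma simple_char_inv:
  assumes \<mu>: "\<mu> \<in> partitions m" and g: "g \<in> perms m"
  shows "simple_char \<mu> (inv g) = simple_char \<mu> g"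
proof -
  have trace_comm: "(\<Sum>h\<in>perms m. conv m x y (inv h \<circ> (g \<circ> h))) = (\<Sum>h\<in>perms m. conv m y x (inv h \<circ> (g \<circ> h)))"
    if g: "g \<in> perms m" for x y g
  proof -
    have "(\<Sum>h\<in>perms m. conv m x y (inv h \<circ> (g \<circ> h))) = (\<Sum>h\<in>perms m. \<Sum>u\<in>perms m. x u * y (inv u \<circ> (inv h \<circ> (g \<circ> h))))"
      by (simp add: conv_eq)
    also have "\<dots> = (\<Sum>u\<in>perms m. \<Sum>h\<in>perms m. x u * y (inv u \<circ> (inv h \<circ> (g \<circ> h))))"
      by (rule sum.swap)
    also have "\<dots> = (\<Sum>u\<in>perms m. \<Sum>h\<in>perms m. x u * y (inv h \<circ> (g \<circ> (h \<circ> inv u))))"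
    proof (rule sum.cong[OF refl])
      fix u assume u: "u \<in> perms m"
      have "(\<Sum>h\<in>perms m. x u * y (inv u \<circ> (inv h \<circ> (g \<circ> h)))) = (\<Sum>h\<in>perms m. x u * y (inv u \<circ> (inv (h \<circ> inv u) \<circ> (g \<circ> (h \<circ> inv u)))))"
        by (rule sum_sym_right[OF sym_inv[OF u], symmetric])
      also have "\<dots> = (\<Sum>h\<in>perms m. x u * y (inv h \<circ> (g \<circ> (h \<circ> inv u))))"
      proof (rule sum.cong[OF refl])
        fix h assume h: "h \<in> perms m"
        have "inv (h \<circ> inv u) = u \<circ> inv h" using sym_inv_distrib[OF h sym_inv[OF u]] u by simp
        then show "x u * y (inv u \<circ> (inv (h \<circ> inv u) \<circ> (g \<circ> (h \<circ> inv u)))) = x u * y (inv h \<circ> (g \<circ> (h \<circ> inv u)))"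
          using u by (simp add: comp_assoc)
      qed
      finally show "(\<Sum>h\<in>perms m. x u * y (inv u \<circ> (inv h \<circ> (g \<circ> h)))) = (\<Sum>h\<in>perms m. x u * y (inv h \<circ> (g \<circ> (h \<circ> inv u))))" .
    qed
    also have "\<dots> = (\<Sum>h\<in>perms m. \<Sum>u\<in>perms m. x u * y (inv h \<circ> (g \<circ> (h \<circ> inv u))))"
      by (rule sum.swap)
    also have "\<dots> = (\<Sum>h\<in>perms m. conv m y x (inv h \<circ> (g \<circ> h)))"
    proof (rule sum.cong[OF refl])
      fix h assume h: "h \<in> perms m"
      let ?k = "inv h \<circ> (g \<circ> h)"
      have k: "?k \<in> perms m" using g h by simp
      have "conv m y x ?k = (\<Sum>v\<in>perms m. y (?k \<circ> inv v) * x (inv (?k \<circ> inv v) \<circ> ?k))"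
      proof -
        have "(\<Sum>v\<in>perms m. y (?k \<circ> inv v) * x (inv (?k \<circ> inv v) \<circ> ?k)) = (\<Sum>v\<in>perms m. y (?k \<circ> v) * x (inv (?k \<circ> v) \<circ> ?k))"
          by (rule sum_sym_inv[of "\<lambda>v. y (?k \<circ> v) * x (inv (?k \<circ> v) \<circ> ?k)"])
        also have "\<dots> = conv m y x ?k"
          unfolding conv_eq by (rule sum_sym_left[OF k, of "\<lambda>v. y v * x (inv v \<circ> ?k)"])
        finally show ?thesis ..
      qed
      also have "\<dots> = (\<Sum>u\<in>perms m. x u * y (inv h \<circ> (g \<circ> (h \<circ> inv u))))"
      proof (rule sum.cong[OF refl])
        fix v assume v: "v \<in> perms m"
        have "inv (?k \<circ> inv v) \<circ> ?k = v" using sym_inv_distrib[OF k sym_inv[OF v]] k v by (simp add: comp_assoc)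
        then show "y (?k \<circ> inv v) * x (inv (?k \<circ> inv v) \<circ> ?k) = x v * y (inv h \<circ> (g \<circ> (h \<circ> inv v)))"
          by (simp add: comp_assoc)
      qed
      finally show "(\<Sum>u\<in>perms m. x u * y (inv h \<circ> (g \<circ> (h \<circ> inv u)))) = conv m y x ?k" ..
    qed
    finally show ?thesis .
  qed
  interpret tableau m "row_of \<mu>" "col_of \<mu>" by (rule tableau_partition[OF \<mu>])
  let ?a = "row_elt m (row_of \<mu>)" and ?b = "col_elt m (col_of \<mu>)"
  have "(\<Sum>h\<in>perms m. symmetrizer (inv h \<circ> (inv g \<circ> h))) = (\<Sum>h\<in>perms m. conv m ?b ?a (inv h \<circ> (g \<circ> h)))"
  proof (rule sum.cong[OF refl])
    fix h assume h: "h \<in> perms m"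
    have k: "inv h \<circ> (g \<circ> h) \<in> perms m" using g h by simp
    have "inv (inv h \<circ> (g \<circ> h)) = inv h \<circ> (inv g \<circ> h)"
      using sym_inv_distrib[OF sym_inv[OF h], of "g \<circ> h"] sym_inv_distrib[OF g h] g h by (simp add: comp_assoc)
    then have "symmetrizer (inv h \<circ> (inv g \<circ> h)) = star symmetrizer (inv h \<circ> (g \<circ> h))" by (simp add: star_def)
    also have "\<dots> = conv m (star ?b) (star ?a) (inv h \<circ> (g \<circ> h))"
      unfolding symmetrizer_def by (rule star_conv[OF k])
    also have "\<dots> = conv m ?b ?a (inv h \<circ> (g \<circ> h))" by (intro conv_cong star_col_elt star_row_elt k)
    finally show "symmetrizer (inv h \<circ> (inv g \<circ> h)) = conv m ?b ?a (inv h \<circ> (g \<circ> h))" .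
  qed
  also have "\<dots> = (\<Sum>h\<in>perms m. symmetrizer (inv h \<circ> (g \<circ> h)))"
    unfolding symmetrizer_def by (rule trace_comm[OF g, symmetric])
  finally show ?thesis
    using g by (simp add: simple_char_formula[OF \<mu>] young_symmetrizer_eq[OF \<mu>])
qed

lemma stab_pair:
  "stab m (restrict (\<lambda>x. (F x, G x)) (letters m)) = stab m F \<inter> stab m G"
proof (intro set_eqI iffI)
  fix p assume p: "p \<in> stab m (restrict (\<lambda>x. (F x, G x)) (letters m))"
  have "F (p x) = F x \<and> G (p x) = G x" if "x \<in> letters m" for x
    using stabD[OF p that] that sym_mem[OF stab_sym[OF p], of x] by simp
  then show "p \<in> stab m F \<inter> stab m G" using stab_sym[OF p] by (auto intro: stabI)
next
  fix p assume p: "p \<in> stab m F \<inter> stab m G"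
  then have "p \<in> perms m" by auto
  then show "p \<in> stab m (restrict (\<lambda>x. (F x, G x)) (letters m))"
    using p stabD[of p m F] stabD[of p m G] sym_mem[of p m] by (intro stabI) auto
qed

text \<open>
  A pair of colourings is a colouring by pairs of colours, and the orbit-stabilizer relation for the latter leaves one summand
  for each contingency table \<open>M\<close>, whose row and column sums are the multiplicities of the two colourings.
\<close>

lemma sum_fixed_pairs:
  fixes \<phi> :: "(nat \<Rightarrow> int) \<Rightarrow> rat"
  shows "(\<Sum>g\<in>perms m. (\<Sum>F | F \<in> colourings m {..<l} \<and> g \<in> stab m F. \<phi> (icontent m F)) * (\<Sum>F | F \<in> colourings m {..<l} \<and> g \<in> stab m F. \<phi> (icontent m F)))
    = fact m * (\<Sum>M\<in>colour_counts m ({..<l} \<times> {..<l}). \<phi> (\<lambda>j. \<Sum>k<l. int (M (j, k))) * \<phi> (\<lambda>k. \<Sum>j<l. int (M (j, k))))"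
proof -
  let ?C = "colourings m {..<l}" and ?K = "{..<l} \<times> {..<l}"
  let ?pair = "\<lambda>(F, G). restrict (\<lambda>x. (F x, G x)) (letters m)"
  let ?un = "\<lambda>H. (restrict (fst \<circ> H) (letters m), restrict (snd \<circ> H) (letters m))"
  have row: "icontent m (restrict (fst \<circ> H) (letters m)) = (\<lambda>j. \<Sum>k<l. int (colour_count m H (j, k)))" if H: "H \<in> colourings m ?K" for H
  proof
    fix j
    have "card {x \<in> letters m. fst (H x) = j} = (\<Sum>k<l. card {x \<in> {x \<in> letters m. fst (H x) = j}. snd (H x) = k})"
      using colourings_mem[OF H] by (intro sum_card_fibres[symmetric]) (auto simp: mem_Times_iff)
    also have "\<dots> = (\<Sum>k<l. colour_count m H (j, k))"
      unfolding colour_count_def by (intro sum.cong refl arg_cong[where f = card]) auto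
    finally show "icontent m (restrict (fst \<circ> H) (letters m)) j = (\<Sum>k<l. int (colour_count m H (j, k)))"
      unfolding icontent_def colour_count_def[of m "restrict _ _"] by (simp cong: conj_cong)
  qed
  have col: "icontent m (restrict (snd \<circ> H) (letters m)) = (\<lambda>k. \<Sum>j<l. int (colour_count m H (j, k)))" if H: "H \<in> colourings m ?K" for H
  proof
    fix k
    have "card {x \<in> letters m. snd (H x) = k} = (\<Sum>j<l. card {x \<in> {x \<in> letters m. snd (H x) = k}. fst (H x) = j})"
      using colourings_mem[OF H] by (intro sum_card_fibres[symmetric]) (auto simp: mem_Times_iff)
    also have "\<dots> = (\<Sum>j<l. colour_count m H (j, k))"
      unfolding colour_count_def by (intro sum.cong refl arg_cong[where f = card]) auto
    finally show "icontent m (restrict (snd \<circ> H) (letters m)) k = (\<Sum>j<l. int (colour_count m H (j, k)))"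
      unfolding icontent_def colour_count_def[of m "restrict _ _"] by (simp cong: conj_cong)
  qed
  have "(\<Sum>g\<in>perms m. (\<Sum>F | F \<in> ?C \<and> g \<in> stab m F. \<phi> (icontent m F)) * (\<Sum>F | F \<in> ?C \<and> g \<in> stab m F. \<phi> (icontent m F)))
     = (\<Sum>g\<in>perms m. \<Sum>(F, G)\<in>?C \<times> ?C. if g \<in> stab m F \<inter> stab m G then \<phi> (icontent m F) * \<phi> (icontent m G) else 0)"
  proof (rule sum.cong[OF refl])
    fix g
    have "(\<Sum>(F, G)\<in>?C \<times> ?C. if g \<in> stab m F \<inter> stab m G then \<phi> (icontent m F) * \<phi> (icontent m G) else 0)
      = (\<Sum>F\<in>?C. \<Sum>G\<in>?C. (if g \<in> stab m F then \<phi> (icontent m F) else 0) * (if g \<in> stab m G then \<phi> (icontent m G) else 0))"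
      by (subst sum.cartesian_product[symmetric]) (auto intro!: sum.cong)
    also have "\<dots> = (\<Sum>F\<in>?C. if g \<in> stab m F then \<phi> (icontent m F) else 0) * (\<Sum>G\<in>?C. if g \<in> stab m G then \<phi> (icontent m G) else 0)"
      by (simp add: sum_product)
    finally show "(\<Sum>F | F \<in> ?C \<and> g \<in> stab m F. \<phi> (icontent m F)) * (\<Sum>F | F \<in> ?C \<and> g \<in> stab m F. \<phi> (icontent m F))
      = (\<Sum>(F, G)\<in>?C \<times> ?C. if g \<in> stab m F \<inter> stab m G then \<phi> (icontent m F) * \<phi> (icontent m G) else 0)"
      by (simp add: sum.inter_filter)
  qed
  also have "\<dots> = (\<Sum>P\<in>?C \<times> ?C. \<Sum>g\<in>perms m. case P of (F, G) \<Rightarrow> if g \<in> stab m F \<inter> stab m G then \<phi> (icontent m F) * \<phi> (icontent m G) else 0)"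
    by (rule sum.swap)
  also have "\<dots> = (\<Sum>H\<in>colourings m ?K. of_nat (card (stab m H)) * (\<phi> (\<lambda>j. \<Sum>k<l. int (colour_count m H (j, k))) * \<phi> (\<lambda>k. \<Sum>j<l. int (colour_count m H (j, k)))))"
  proof (rule sum.reindex_bij_witness[where i = ?un and j = ?pair])
    fix P assume P: "P \<in> ?C \<times> ?C"
    obtain F G where FG: "P = (F, G)" "F \<in> ?C" "G \<in> ?C" using P by auto
    show un: "?un (?pair P) = P"
      using FG by (auto simp: fun_eq_iff colourings_def PiE_def extensional_def)
    show H: "?pair P \<in> colourings m ?K" using FG by (auto simp: colourings_def)
    have "(\<Sum>g\<in>perms m. if g \<in> stab m F \<inter> stab m G then \<phi> (icontent m F) * \<phi> (icontent m G) else 0)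
      = (\<Sum>g\<in>stab m F \<inter> stab m G. \<phi> (icontent m F) * \<phi> (icontent m G))"
      by (intro sum.mono_neutral_cong_right) auto
    also have "\<dots> = of_nat (card (stab m (?pair P))) * (\<phi> (icontent m F) * \<phi> (icontent m G))"
      by (simp add: FG(1) stab_pair)
    finally have "(\<Sum>g\<in>perms m. case P of (F, G) \<Rightarrow> if g \<in> stab m F \<inter> stab m G then \<phi> (icontent m F) * \<phi> (icontent m G) else 0)
      = of_nat (card (stab m (?pair P))) * (\<phi> (icontent m F) * \<phi> (icontent m G))"
      by (simp only: FG prod.case)
    moreover have "icontent m F = (\<lambda>j. \<Sum>k<l. int (colour_count m (?pair P) (j, k)))"
      using row[OF H] un FG by simp
    moreover have "icontent m G = (\<lambda>k. \<Sum>j<l. int (colour_count m (?pair P) (j, k)))"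
      using col[OF H] un FG by simp
    ultimately show "of_nat (card (stab m (?pair P))) * (\<phi> (\<lambda>j. \<Sum>k<l. int (colour_count m (?pair P) (j, k))) * \<phi> (\<lambda>k. \<Sum>j<l. int (colour_count m (?pair P) (j, k))))
      = (\<Sum>g\<in>perms m. case P of (F, G) \<Rightarrow> if g \<in> stab m F \<inter> stab m G then \<phi> (icontent m F) * \<phi> (icontent m G) else 0)"
      by (simp only:)
  next
    fix H assume H: "H \<in> colourings m ?K"
    show "?pair (?un H) = H"
      using H by (auto simp: fun_eq_iff colourings_def PiE_def extensional_def)
    show "?un H \<in> ?C \<times> ?C" using H colourings_mem[OF H] by (auto simp: colourings_def mem_Times_iff)
  qed
  also have "\<dots> = fact m * (\<Sum>M\<in>colour_counts m ?K. \<phi> (\<lambda>j. \<Sum>k<l. int (M (j, k))) * \<phi> (\<lambda>k. \<Sum>j<l. int (M (j, k))))"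
    by (rule sum_colourings_stab) simp
  finally show ?thesis .
qed

lemma sum_tables_columns:
  assumes \<alpha>: "(\<Sum>k<l. \<alpha> k) = int m" "\<And>k. l \<le> k \<Longrightarrow> \<alpha> k = 0"
  shows "(\<Sum>M | M \<in> colour_counts m ({..<l} \<times> {..<l}) \<and> (\<lambda>k. \<Sum>j<l. int (M (j, k))) = \<alpha>. alternant_coeff l (\<gamma> - (\<lambda>j. \<Sum>k<l. int (M (j, k)))))
    = alternant_h_coeff l \<alpha> l \<gamma>"
  unfolding alternant_h_coeff_unroll
proof (rule sum.reindex_bij_witness[where
      i = "\<lambda>N (j, k). if j < l \<and> k < l then nat (N k j) else 0" and
      j = "\<lambda>M. restrict (\<lambda>k j. int (M (j, k))) {..<l}"])
  fix M assume MM: "M \<in> {M \<in> colour_counts m ({..<l} \<times> {..<l}). (\<lambda>k. \<Sum>j<l. int (M (j, k))) = \<alpha>}"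
  then have M: "\<And>p. p \<notin> {..<l} \<times> {..<l} \<Longrightarrow> M p = 0" unfolding colour_counts_def by blast
  from MM have "(\<lambda>k. \<Sum>j<l. int (M (j, k))) = \<alpha>" by blast
  then have col: "\<And>k. (\<Sum>j<l. int (M (j, k))) = \<alpha> k" by (rule fun_cong)
  show "(\<lambda>(j, k). if j < l \<and> k < l then nat (restrict (\<lambda>k j. int (M (j, k))) {..<l} k j) else 0) = M"
  proof (rule ext, clarify)
    fix a b show "(if a < l \<and> b < l then nat (restrict (\<lambda>k j. int (M (j, k))) {..<l} b a) else 0) = M (a, b)"
      using M[of "(a, b)"] by auto
  qed
  show "restrict (\<lambda>k j. int (M (j, k))) {..<l} \<in> PiE {..<l} (\<lambda>i. compositions l (\<alpha> i))"
    using M col by (auto simp: compositions_def)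
  have "(\<Sum>i<l. restrict (\<lambda>k j. int (M (j, k))) {..<l} i) = (\<lambda>j. \<Sum>k<l. int (M (j, k)))"
    by (auto simp: fun_eq_iff sum_apply_fun)
  then show "alternant_coeff l (\<gamma> - (\<Sum>i<l. restrict (\<lambda>k j. int (M (j, k))) {..<l} i)) = alternant_coeff l (\<gamma> - (\<lambda>j. \<Sum>k<l. int (M (j, k))))"
    by (simp only:)
next
  fix N assume N: "N \<in> PiE {..<l} (\<lambda>i. compositions l (\<alpha> i))"
  let ?M = "\<lambda>(j, k). if j < l \<and> k < l then nat (N k j) else 0"
  have N0: "0 \<le> N k j" "l \<le> j \<Longrightarrow> N k j = 0" "(\<Sum>j<l. N k j) = \<alpha> k" if "k < l" for k j
    using N that by (auto simp: compositions_def PiE_def Pi_def)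
  show "restrict (\<lambda>k j. int (?M (j, k))) {..<l} = N"
  proof (intro ext)
    fix k j
    show "restrict (\<lambda>k j. int (?M (j, k))) {..<l} k j = N k j"
      using N N0(1,2)[of k j] by (cases "k < l"; cases "j < l") (auto simp: PiE_def extensional_def)
  qed
  have col: "(\<Sum>j<l. int (?M (j, k))) = \<alpha> k" for k
    using N0(1)[of k] N0(3)[of k] \<alpha>(2)[of k] by (cases "k < l") auto
  have "int (\<Sum>p\<in>{..<l} \<times> {..<l}. ?M p) = (\<Sum>j<l. \<Sum>k<l. int (?M (j, k)))"
    unfolding of_nat_sum sum.cartesian_product by (rule sum.cong[OF refl]) auto
  also have "\<dots> = (\<Sum>k<l. \<Sum>j<l. int (?M (j, k)))" by (rule sum.swap)
  also have "\<dots> = int m" by (simp only: col \<alpha>)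
  finally have "(\<Sum>p\<in>{..<l} \<times> {..<l}. ?M p) = m" by linarith
  then show "?M \<in> {M \<in> colour_counts m ({..<l} \<times> {..<l}). (\<lambda>k. \<Sum>j<l. int (M (j, k))) = \<alpha>}"
    using col by (auto simp: colour_counts_def fun_eq_iff)
qed

text \<open>
  Expanding one of the two Vandermonde factors prescribes the column sums of the tables and leaves the alternating sum
  evaluated by Pieri's rule.
\<close>

lemma alternating_fixed_count_norm:
  assumes \<mu>: "\<mu> \<in> partitions m"
  shows "(\<Sum>g\<in>perms m. (alternating_fixed_count (length \<mu>) (frob_exponent \<mu>) m g)\<^sup>2) = fact m"
proof -
  let ?l = "length \<mu>" and ?\<gamma> = "frob_exponent \<mu>"
  let ?CC = "colour_counts m ({..<?l} \<times> {..<?l})"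
  let ?row = "\<lambda>M j. \<Sum>k<?l. int (M (j, k))" and ?col = "\<lambda>M k. \<Sum>j<?l. int (M (j, k))"
  let ?A = "alternant_coeff ?l"
  have "(\<Sum>g\<in>perms m. (alternating_fixed_count ?l ?\<gamma> m g)\<^sup>2)
     = fact m * (\<Sum>M\<in>?CC. of_int (?A (?\<gamma> - ?row M)) * of_int (?A (?\<gamma> - ?col M)))"
    unfolding alternating_fixed_count_def power2_eq_square
    by (rule sum_fixed_pairs[of "\<lambda>c. of_int (?A (?\<gamma> - c))" m ?l])
  also have "(\<Sum>M\<in>?CC. of_int (?A (?\<gamma> - ?row M)) * of_int (?A (?\<gamma> - ?col M))) = (of_int (\<Sum>M\<in>?CC. ?A (?\<gamma> - ?row M) * ?A (?\<gamma> - ?col M)) :: rat)"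
    by simp
  also have "(\<Sum>M\<in>?CC. ?A (?\<gamma> - ?row M) * ?A (?\<gamma> - ?col M))
     = (\<Sum>M\<in>?CC. \<Sum>w | w permutes {..<?l}. sign w * (if ?col M = ?\<gamma> - (staircase ?l \<circ> w) then ?A (?\<gamma> - ?row M) else 0))"
  proof (rule sum.cong[OF refl])
    fix M
    have iff: "?\<gamma> - ?col M = staircase ?l \<circ> w \<longleftrightarrow> ?col M = ?\<gamma> - (staircase ?l \<circ> w)" for w
      by (metis (no_types, lifting) add_diff_cancel diff_add_cancel diff_diff_eq2 add.commute)
    show "?A (?\<gamma> - ?row M) * ?A (?\<gamma> - ?col M) = (\<Sum>w | w permutes {..<?l}. sign w * (if ?col M = ?\<gamma> - (staircase ?l \<circ> w) then ?A (?\<gamma> - ?row M) else 0))"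
      unfolding alternant_coeff_def[of ?l "?\<gamma> - ?col M"] iff sum_distrib_left by (intro sum.cong) auto
  qed
  also have "\<dots> = (\<Sum>w | w permutes {..<?l}. \<Sum>M\<in>?CC. sign w * (if ?col M = ?\<gamma> - (staircase ?l \<circ> w) then ?A (?\<gamma> - ?row M) else 0))"
    by (rule sum.swap)
  also have "\<dots> = (\<Sum>w | w permutes {..<?l}. sign w * alternant_h_coeff ?l (?\<gamma> - (staircase ?l \<circ> w)) ?l ?\<gamma>)"
  proof (rule sum.cong[OF refl])
    fix w assume "w \<in> {w. w permutes {..<?l}}"
    then have w: "w permutes {..<?l}" by simp
    let ?\<alpha> = "?\<gamma> - (staircase ?l \<circ> w)"
    have "(\<Sum>k<?l. staircase ?l (w k)) = (\<Sum>k<?l. staircase ?l k)"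
      using sum.permute[OF w, of "staircase ?l"] by (simp add: o_def)
    then have "(\<Sum>k<?l. ?\<alpha> k) = (\<Sum>k<?l. part \<mu> k)"
      by (simp add: frob_exponent_def sum.distrib sum_subtractf)
    then have 1: "(\<Sum>k<?l. ?\<alpha> k) = int m"
      using part_props(4)[OF \<mu>, of ?l] sum_list_partition[OF \<mu>] by simp
    have 2: "?\<alpha> k = 0" if "?l \<le> k" for k
      using that w part_props(3)[OF \<mu> that] by (simp add: frob_exponent_def permutes_def)
    have "(\<Sum>M\<in>?CC. sign w * (if ?col M = ?\<alpha> then ?A (?\<gamma> - ?row M) else 0)) = sign w * (\<Sum>M | M \<in> ?CC \<and> ?col M = ?\<alpha>. ?A (?\<gamma> - ?row M))"
      by (simp add: sum_distrib_left sum.inter_filter if_distrib cong: if_cong)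
    also have "\<dots> = sign w * alternant_h_coeff ?l ?\<alpha> ?l ?\<gamma>"
      by (subst sum_tables_columns[OF 1 2]) auto
    finally show "(\<Sum>M\<in>?CC. sign w * (if ?col M = ?\<alpha> then ?A (?\<gamma> - ?row M) else 0)) = sign w * alternant_h_coeff ?l ?\<alpha> ?l ?\<gamma>" .
  qed
  also have "\<dots> = 1"
    unfolding frob_exponent_def by (rule alternating_table_sum) (use part_props[OF \<mu>] in auto)
  finally show ?thesis by simp
qed

text \<open>
  Both class functions have norm 1 and their product is 1, so the square of their difference sums to 0.
\<close>

theorem frobenius_formula:
  assumes \<mu>: "\<mu> \<in> partitions m" and g: "g \<in> perms m"
  shows "simple_char \<mu> g = alternating_fixed_count (length \<mu>) (frob_exponent \<mu>) m g"
proof -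
  let ?\<omega> = "alternating_fixed_count (length \<mu>) (frob_exponent \<mu>) m" and ?\<chi> = "simple_char \<mu>"
  have "(\<Sum>g\<in>perms m. ?\<chi> g * ?\<chi> (inv g)) = fact m" "(\<Sum>g\<in>perms m. ?\<chi> g * ?\<omega> (inv g)) = fact m"
    using simple_char_orthonormal[OF \<mu> \<mu>] scalar_prod_simple_char_own_alternating[OF \<mu>]
    by (simp_all add: scalar_prod_perms field_simps)
  then have "(\<Sum>g\<in>perms m. (?\<chi> g)\<^sup>2) = fact m" "(\<Sum>g\<in>perms m. ?\<chi> g * ?\<omega> g) = fact m"
    by (simp_all add: simple_char_inv[OF \<mu>] alternating_fixed_count_inv power2_eq_square)
  then have "(\<Sum>g\<in>perms m. (?\<chi> g - ?\<omega> g)\<^sup>2) = 0"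
    using alternating_fixed_count_norm[OF \<mu>]
    by (simp add: power2_diff sum.distrib sum_subtractf mult.assoc flip: sum_distrib_left)
  then have "(?\<chi> g - ?\<omega> g)\<^sup>2 = 0" using g by (subst (asm) sum_nonneg_eq_0_iff) auto
  then show ?thesis by simp
qed

section \<open>Polynomials as finitely supported functions\<close>

lemma poly_mapping_expansion:
  fixes p :: "'a \<Rightarrow>\<^sub>0 'b::comm_monoid_add"
  shows "p = (\<Sum>t\<in>Poly_Mapping.keys p. Poly_Mapping.single t (Poly_Mapping.lookup p t))"
  by (rule poly_mapping_eqI)
     (auto simp: lookup_sum lookup_single when_def sum.delta' in_keys_iff)

lemma poly_mapping_hom_mult:
  fixes \<Phi> :: "('a::comm_monoid_add \<Rightarrow>\<^sub>0 'b::comm_ring_1) \<Rightarrow> 'c::comm_ring_1"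
  assumes add: "\<And>p q. \<Phi> (p + q) = \<Phi> p + \<Phi> q"
    and mon: "\<And>s a t b. \<Phi> (Poly_Mapping.single (s + t) (a * b)) = \<Phi> (Poly_Mapping.single s a) * \<Phi> (Poly_Mapping.single t b)"
  shows "\<Phi> (p * q) = \<Phi> p * \<Phi> q"
proof -
  have "\<Phi> 0 = 0" using add[of 0 0] by simp
  then have sum: "\<Phi> (\<Sum>i\<in>I. f i) = (\<Sum>i\<in>I. \<Phi> (f i))" for f :: "'x \<Rightarrow> _" and I
    by (induction I rule: infinite_finite_induct) (auto simp: add)
  let ?s = "\<lambda>p t. Poly_Mapping.single t (Poly_Mapping.lookup p t)"
  have "p * q = (\<Sum>t\<in>Poly_Mapping.keys p. ?s p t) * (\<Sum>t\<in>Poly_Mapping.keys q. ?s q t)"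
    using poly_mapping_expansion[of p] poly_mapping_expansion[of q] by simp
  also have "\<Phi> \<dots> = \<Phi> (\<Sum>t\<in>Poly_Mapping.keys p. ?s p t) * \<Phi> (\<Sum>t\<in>Poly_Mapping.keys q. ?s q t)"
    by (simp add: sum_product sum mult_single mon)
  finally show ?thesis using poly_mapping_expansion[of p] poly_mapping_expansion[of q] by simp
qed

definition mono_eval :: "(nat \<Rightarrow> rat) \<Rightarrow> (nat \<Rightarrow>\<^sub>0 nat) \<Rightarrow> rat" where
  "mono_eval a t = (\<Prod>k\<in>Poly_Mapping.keys t. a (Suc k) ^ Poly_Mapping.lookup t k)"

lemma mono_eval_superset:
  "finite S \<Longrightarrow> Poly_Mapping.keys t \<subseteq> S \<Longrightarrow> mono_eval a t = (\<Prod>k\<in>S. a (Suc k) ^ Poly_Mapping.lookup t k)"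
  unfolding mono_eval_def by (rule prod.mono_neutral_left) (auto simp: in_keys_iff)

lemma mono_eval_add: "mono_eval a (s + t) = mono_eval a s * mono_eval a t"
proof -
  let ?S = "Poly_Mapping.keys s \<union> Poly_Mapping.keys t"
  show ?thesis
    using keys_add[of s t] by (simp add: mono_eval_superset[of ?S] lookup_add power_add prod.distrib)
qed

lemma qeval_superset:
  "finite S \<Longrightarrow> Poly_Mapping.keys P \<subseteq> S \<Longrightarrow> qeval a P = (\<Sum>t\<in>S. Poly_Mapping.lookup P t * mono_eval a t)"
  unfolding qeval_def mono_eval_def by (rule sum.mono_neutral_left) (auto simp: in_keys_iff)

lemma qeval_add: "qeval a (P + Q) = qeval a P + qeval a Q"
proof -
  let ?S = "Poly_Mapping.keys P \<union> Poly_Mapping.keys Q"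
  show ?thesis
    using keys_add[of P Q] by (simp add: qeval_superset[of ?S] lookup_add algebra_simps sum.distrib)
qed

lemma qeval_single: "qeval a (Poly_Mapping.single t c) = c * mono_eval a t"
  by (simp add: qeval_superset[of "{t}"])

lemma qeval_mult: "qeval a (P * Q) = qeval a P * qeval a Q"
  by (rule poly_mapping_hom_mult) (auto simp: qeval_add qeval_single mono_eval_add)

lemma qeval_0 [simp]: "qeval a 0 = 0"
  by (simp add: qeval_def)

lemma qeval_1 [simp]: "qeval a 1 = 1"
  using qeval_single[of a 0 1] by (simp add: mono_eval_def)

lemma qeval_diff: "qeval a (P - Q) = qeval a P - qeval a Q"
  using qeval_add[of a "P - Q" Q] by simp

lemma qeval_prod: "qeval a (\<Prod>i\<in>I. f i) = (\<Prod>i\<in>I. qeval a (f i))"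
  by (induction I rule: infinite_finite_induct) (auto simp: qeval_mult)

lemma qeval_of_nat [simp]: "qeval a (of_nat n) = of_nat n"
  by (induction n) (auto simp: qeval_add)

lemma qeval_qconst [simp]: "qeval a (qconst c) = c"
  by (simp add: qconst_def qeval_single mono_eval_def)

lemma qeval_qvar: "1 \<le> i \<Longrightarrow> qeval a (qvar i) = a i"
  by (simp add: qvar_def qeval_single mono_eval_def)

lemma qeval_qbinom:
  assumes "1 \<le> d" "a d = of_nat n"
  shows "qeval a (qbinom (qvar d) k) = of_nat (n choose k)"
  using assms
  by (simp add: qbinom_def qeval_mult qeval_prod qeval_diff qeval_qvar binomial_gbinomial gbinomial_prod_rev atLeast0LessThan)

section \<open>Evaluation of the Frobenius polynomial\<close>

type_synonym yrat = "(nat \<Rightarrow>\<^sub>0 nat) \<Rightarrow>\<^sub>0 rat"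

definition coeff_eval :: "(nat \<Rightarrow> rat) \<Rightarrow> ypoly \<Rightarrow> yrat" where
  "coeff_eval a F = Poly_Mapping.map (qeval a) F"

lemma lookup_coeff_eval: "Poly_Mapping.lookup (coeff_eval a F) t = qeval a (Poly_Mapping.lookup F t)"
  by (simp add: coeff_eval_def map.rep_eq when_def)

lemma coeff_eval_add: "coeff_eval a (F + G) = coeff_eval a F + coeff_eval a G"
  by (rule poly_mapping_eqI) (simp add: lookup_coeff_eval lookup_add qeval_add)

lemma coeff_eval_single: "coeff_eval a (Poly_Mapping.single t P) = Poly_Mapping.single t (qeval a P)"
  by (rule poly_mapping_eqI) (simp add: lookup_coeff_eval lookup_single when_def)

lemma coeff_eval_mult: "coeff_eval a (F * G) = coeff_eval a F * coeff_eval a G"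
  by (rule poly_mapping_hom_mult) (auto simp: coeff_eval_add coeff_eval_single qeval_mult mult_single)

lemma coeff_eval_1 [simp]: "coeff_eval a 1 = 1"
  using coeff_eval_single[of a 0 1] by simp

lemma coeff_eval_0 [simp]: "coeff_eval a 0 = 0"
  by (rule poly_mapping_eqI) (simp add: lookup_coeff_eval)

lemma coeff_eval_diff: "coeff_eval a (P - Q) = coeff_eval a P - coeff_eval a Q"
  using coeff_eval_add[of a "P - Q" Q] by simp

lemma coeff_eval_sum: "coeff_eval a (\<Sum>i\<in>I. f i) = (\<Sum>i\<in>I. coeff_eval a (f i))"
  by (induction I rule: infinite_finite_induct) (auto simp: coeff_eval_add)

lemma coeff_eval_prod: "coeff_eval a (\<Prod>i\<in>I. f i) = (\<Prod>i\<in>I. coeff_eval a (f i))"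
  by (induction I rule: infinite_finite_induct) (auto simp: coeff_eval_mult)

lemma coeff_eval_power: "coeff_eval a (F ^ n) = coeff_eval a F ^ n"
  by (induction n) (auto simp: coeff_eval_mult)

definition yv :: "nat \<Rightarrow> yrat" where
  "yv j = (if j = 0 then 1 else Poly_Mapping.single (Poly_Mapping.single (Suc j) 1) 1)"

lemma coeff_eval_yvar: "2 \<le> j \<Longrightarrow> coeff_eval a (yvar j) = yv (j - 1)"
  by (simp add: yvar_def coeff_eval_single yv_def)

lemma coeff_eval_yconst: "coeff_eval a (yconst P) = Poly_Mapping.single 0 (qeval a P)"
  by (simp add: yconst_def coeff_eval_single)

text \<open>
  At nonnegative integers the binomial series are finite, and \<open>yv 0 = 1\<close> is the dehomogenized first variable: it turns the factors
  \<open>1 - y\<^sub>j\<close> into the missing part of the Vandermonde product and \<open>1 + p\<^sub>d\<close> into a power sum.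
\<close>

lemma coeff_eval_frob_truncated:
  fixes n :: "nat \<Rightarrow> nat"
  assumes a: "\<And>d. 1 \<le> d \<Longrightarrow> a d = of_nat (n d)" and N: "\<And>d. n d \<le> N" and l: "1 \<le> l \<or> n = (\<lambda>_. 0)"
  shows "coeff_eval a (frob_truncated l N)
    = (\<Prod>(i, j)\<in>{(i, j). i < j \<and> j < l}. yv i - yv j) * (\<Prod>d=1..N. (\<Sum>j<l. yv j ^ d) ^ n d)"
proof -
  let ?V = "{(i, j). 2 \<le> i \<and> i < j \<and> j \<le> l}" and ?W = "{(i, j). i < j \<and> j < l}"
  have "coeff_eval a (\<Prod>(i, j)\<in>?V. yvar i - yvar j) = (\<Prod>(i, j)\<in>?V. yv (i - 1) - yv (j - 1))"
    unfolding coeff_eval_prod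
    by (intro prod.cong refl) (auto simp: coeff_eval_diff coeff_eval_yvar)
  also have "\<dots> = (\<Prod>(i, j)\<in>{(i, j). 1 \<le> i \<and> i < j \<and> j < l}. yv i - yv j)"
    by (rule prod.reindex_bij_witness[where i = "\<lambda>(i, j). (Suc i, Suc j)" and j = "\<lambda>(i, j). (i - 1, j - 1)"]) auto
  finally have V: "coeff_eval a (\<Prod>(i, j)\<in>?V. yvar i - yvar j) = (\<Prod>(i, j)\<in>{(i, j). 1 \<le> i \<and> i < j \<and> j < l}. yv i - yv j)" .
  have "coeff_eval a (\<Prod>j=2..l. 1 - yvar j) = (\<Prod>j=2..l. 1 - yv (j - 1))"
    unfolding coeff_eval_prod
    by (intro prod.cong refl) (auto simp: coeff_eval_diff coeff_eval_yvar)
  also have "\<dots> = (\<Prod>(i, j)\<in>{0} \<times> {1..<l}. yv i - yv j)"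
    by (rule prod.reindex_bij_witness[where i = "\<lambda>(i, j). Suc j" and j = "\<lambda>j. (0, j - 1)"]) (auto simp: yv_def)
  finally have L: "coeff_eval a (\<Prod>j=2..l. 1 - yvar j) = (\<Prod>(i, j)\<in>{0} \<times> {1..<l}. yv i - yv j)" .
  have fin: "finite {(i, j). 1 \<le> i \<and> i < j \<and> j < l}"
    by (rule finite_subset[of _ "{..<l} \<times> {..<l}"]) auto
  have "?W = {(i, j). 1 \<le> i \<and> i < j \<and> j < l} \<union> {0} \<times> {1..<l}" by (auto simp: Suc_le_eq)
  then have W: "(\<Prod>(i, j)\<in>?W. yv i - yv j) = coeff_eval a (\<Prod>(i, j)\<in>?V. yvar i - yvar j) * coeff_eval a (\<Prod>j=2..l. 1 - yvar j)"
    unfolding V L using fin by (simp only:) (subst prod.union_disjoint; auto)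
  have D: "coeff_eval a (\<Sum>k\<le>N. yconst (qbinom (qvar d) k) * (\<Sum>j=2..l. yvar j ^ d) ^ k) = (\<Sum>j<l. yv j ^ d) ^ n d" if d: "1 \<le> d" for d
  proof -
    let ?s = "\<Sum>j=2..l. yv (j - 1) ^ d"
    have "coeff_eval a (\<Sum>j=2..l. yvar j ^ d) = ?s"
      unfolding coeff_eval_sum coeff_eval_power by (intro sum.cong refl) (auto simp: coeff_eval_yvar)
    then have "coeff_eval a (\<Sum>k\<le>N. yconst (qbinom (qvar d) k) * (\<Sum>j=2..l. yvar j ^ d) ^ k)
      = (\<Sum>k\<le>N. of_nat (n d choose k) * ?s ^ k)"
      by (simp add: coeff_eval_sum coeff_eval_mult coeff_eval_power coeff_eval_yconst qeval_qbinom[of d a "n d", OF d a[OF d]])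
    also have "\<dots> = (\<Sum>k\<le>n d. of_nat (n d choose k) * ?s ^ k)"
      using N by (intro sum.mono_neutral_right) auto
    also have "\<dots> = (?s + 1) ^ n d" by (simp add: binomial_ring)
    also have "\<dots> = (\<Sum>j<l. yv j ^ d) ^ n d"
    proof (cases "1 \<le> l")
      case True
      have "(\<Sum>j<l. yv j ^ d) = yv 0 ^ d + (\<Sum>j=1..<l. yv j ^ d)"
        using True by (simp add: lessThan_atLeast0 sum.atLeast_Suc_lessThan)
      also have "(\<Sum>j=1..<l. yv j ^ d) = ?s"
        by (rule sum.reindex_bij_witness[where i = "\<lambda>j. j - 1" and j = Suc]) auto
      finally show ?thesis by (simp add: yv_def add.commute)
    qed (use l in auto)
    finally show ?thesis .
  qed
  show ?thesis
    unfolding frob_truncated_def coeff_eval_mult W coeff_eval_prod[of a _ "{1..N}"]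
    by (simp add: D)
qed

lemma prod_yv_power:
  "(\<Prod>j<l. yv j ^ e j) = Poly_Mapping.single (\<Sum>j=1..<l. Poly_Mapping.single (Suc j) (e j)) 1"
proof (induction l)
  case (Suc l)
  have pow: "Poly_Mapping.single (Poly_Mapping.single k 1) (1::rat) ^ n = Poly_Mapping.single (Poly_Mapping.single k n) 1" for k n :: nat
    by (induction n) (auto simp: mult_single simp flip: single_add)
  show ?case
  proof (cases "l = 0")
    case False
    then show ?thesis using Suc pow[of "Suc l" "e l"] by (simp add: yv_def mult_single)
  qed (simp add: yv_def)
qed simp

lemma lookup_exponent_sum:
  "Poly_Mapping.lookup (\<Sum>j=1..<l. Poly_Mapping.single (Suc j) (e j)) i = (if 2 \<le> i \<and> i \<le> l then e (i - 1) else 0)"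
proof -
  have "Poly_Mapping.lookup (\<Sum>j=1..<l. Poly_Mapping.single (Suc j) (e j)) i = (\<Sum>j=1..<l. if Suc j = i then e j else 0)"
    by (simp add: lookup_sum lookup_single when_def)
  also have "\<dots> = (\<Sum>j\<in>{1..<l}. if j = i - 1 then (if 2 \<le> i then e j else 0) else 0)"
    by (intro sum.cong refl) auto
  also have "\<dots> = (if 2 \<le> i \<and> i \<le> l then e (i - 1) else 0)" by auto
  finally show ?thesis .
qed

definition cycle_type :: "nat \<Rightarrow> (nat \<Rightarrow> nat) \<Rightarrow> nat \<Rightarrow> rat" where
  "cycle_type m g i = of_nat (cycle_count m i g)"

lemma rho_perms: "rho m P g = (if g \<in> perms m then qeval (cycle_type m g) P else 0)"
  unfolding rho_def sym_perms by (simp add: cycle_type_def[abs_def])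

lemma coeff_eval_frob_truncated_colourings:
  assumes g: "g \<in> perms m" and l: "1 \<le> l \<or> m = 0" and N: "m \<le> N"
  shows "coeff_eval (cycle_type m g) (frob_truncated l N)
    = (\<Sum>w | w permutes {..<l}. \<Sum>F | F \<in> colourings m {..<l} \<and> g \<in> stab m F.
        of_int (sign w) * Poly_Mapping.single (\<Sum>j=1..<l. Poly_Mapping.single (Suc j) (l - 1 - w j + colour_count m F j)) 1)"
proof -
  let ?O = "orbit g ` letters m"
  have card_O: "card ?O \<le> m" using card_image_le[of "letters m" "orbit g"] by simp
  have cc: "cycle_count m d g \<le> N" for d
    unfolding cycle_count_eq using card_mono[of ?O "{C \<in> ?O. card C = d}"] card_O N by simp
  have z: "m = 0 \<Longrightarrow> cycle_count m d g = 0" for d unfolding cycle_count_eq by (simp add: letters_def)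
  have "coeff_eval (cycle_type m g) (frob_truncated l N)
     = (\<Prod>(i, j)\<in>{(i, j). i < j \<and> j < l}. yv i - yv j) * (\<Prod>d=1..N. (\<Sum>j<l. yv j ^ d) ^ cycle_count m d g)"
    by (rule coeff_eval_frob_truncated) (use cc l z in \<open>auto simp: cycle_type_def\<close>)
  also have "(\<Prod>d=1..N. (\<Sum>j<l. yv j ^ d) ^ cycle_count m d g) = (\<Prod>C\<in>?O. \<Sum>j<l. yv j ^ card C)"
    by (rule prod_cycle_count[OF g N])
  also have "\<dots> = (\<Sum>F | F \<in> colourings m {..<l} \<and> g \<in> stab m F. \<Prod>x\<in>letters m. yv (F x))"
    by (rule prod_cycles_power_sums[OF g]) simp
  also have "\<dots> = (\<Sum>F | F \<in> colourings m {..<l} \<and> g \<in> stab m F. \<Prod>j<l. yv j ^ colour_count m F j)"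
  proof (rule sum.cong[OF refl])
    fix F assume "F \<in> {F \<in> colourings m {..<l}. g \<in> stab m F}"
    then have "(\<Prod>x\<in>letters m. yv (F x)) = (\<Prod>j<l. \<Prod>x\<in>{x \<in> letters m. F x = j}. yv (F x))"
      by (intro prod.group[symmetric]) (auto dest: colourings_mem)
    then show "(\<Prod>x\<in>letters m. yv (F x)) = (\<Prod>j<l. yv j ^ colour_count m F j)"
      by (simp add: colour_count_def)
  qed
  also have "(\<Prod>(i, j)\<in>{(i, j). i < j \<and> j < l}. yv i - yv j) = (\<Sum>w | w permutes {..<l}. of_int (sign w) * (\<Prod>j<l. yv j ^ (l - 1 - w j)))"
    by (rule vandermonde_expansion)
  also have "\<dots> * (\<Sum>F | F \<in> colourings m {..<l} \<and> g \<in> stab m F. \<Prod>j<l. yv j ^ colour_count m F j)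
    = (\<Sum>w | w permutes {..<l}. \<Sum>F | F \<in> colourings m {..<l} \<and> g \<in> stab m F. of_int (sign w) * (\<Prod>j<l. yv j ^ (l - 1 - w j + colour_count m F j)))"
    by (simp add: sum_product power_add prod.distrib mult.assoc)
  finally show ?thesis by (simp only: prod_yv_power)
qed

lemma qeval_lookup_frob_truncated:
  assumes g: "g \<in> perms m" and l: "1 \<le> l \<or> m = 0" and N: "m \<le> N"
  shows "qeval (cycle_type m g) (Poly_Mapping.lookup (frob_truncated l N) (\<Sum>j=1..<l. Poly_Mapping.single (Suc j) (e j)))
    = (\<Sum>w | w permutes {..<l}. \<Sum>F | F \<in> colourings m {..<l} \<and> g \<in> stab m F.
        if \<forall>j\<in>{1..<l}. l - 1 - w j + colour_count m F j = e j then of_int (sign w) else 0)"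
proof -
  let ?s = "\<lambda>e. \<Sum>j=1..<l. Poly_Mapping.single (Suc j) (e j :: nat)"
  have eq: "?s e' = ?s e \<longleftrightarrow> (\<forall>j\<in>{1..<l}. e' j = e j)" for e' e
  proof
    assume h: "?s e' = ?s e"
    show "\<forall>j\<in>{1..<l}. e' j = e j"
    proof
      fix j assume j: "j \<in> {1..<l}"
      then show "e' j = e j"
        using arg_cong[OF h, of "\<lambda>t. Poly_Mapping.lookup t (Suc j)"] unfolding lookup_exponent_sum by auto
    qed
  qed auto
  have "of_int c * Poly_Mapping.single t (1::rat) = Poly_Mapping.single t (of_int c)" for c and t :: "nat \<Rightarrow>\<^sub>0 nat"
    using mult_single[of 0 "of_int c :: rat" t 1] by simp
  then have lk: "Poly_Mapping.lookup (of_int c * Poly_Mapping.single t (1::rat)) t' = (if t = t' then of_int c else 0)" for c and t t' :: "nat \<Rightarrow>\<^sub>0 nat"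
    by (simp add: lookup_single when_def)
  show ?thesis
    unfolding lookup_coeff_eval[symmetric] coeff_eval_frob_truncated_colourings[OF g l N] lookup_sum lk eq ..
qed

section \<open>Weights\<close>

definition ydeg :: "(nat \<Rightarrow>\<^sub>0 nat) \<Rightarrow> nat" where
  "ydeg t = (\<Sum>k\<in>Poly_Mapping.keys t. Poly_Mapping.lookup t k)"

lemma ydeg_add: "ydeg (s + t) = ydeg s + ydeg t"
proof -
  have sup: "ydeg t = (\<Sum>k\<in>S. Poly_Mapping.lookup t k)" if "finite S" "Poly_Mapping.keys t \<subseteq> S" for t S
    unfolding ydeg_def using that by (intro sum.mono_neutral_left) (auto simp: in_keys_iff)
  show ?thesis
    using keys_add[of s t] by (simp add: sup[of "Poly_Mapping.keys s \<union> Poly_Mapping.keys t"] lookup_add sum.distrib)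
qed

lemma monom_weight_add: "monom_weight (s + t) = monom_weight s + monom_weight t"
proof -
  have sup: "monom_weight t = (\<Sum>k\<in>S. Suc k * Poly_Mapping.lookup t k)" if "finite S" "Poly_Mapping.keys t \<subseteq> S" for t S
    unfolding monom_weight_def using that by (intro sum.mono_neutral_left) (auto simp: in_keys_iff)
  show ?thesis
    using keys_add[of s t]
    by (simp add: sup[of "Poly_Mapping.keys s \<union> Poly_Mapping.keys t"] lookup_add sum.distrib distrib_left del: mult_Suc)
qed

lemma ydeg_single [simp]: "ydeg (Poly_Mapping.single j n) = n"
  by (simp add: ydeg_def)

lemma monom_weight_single [simp]: "monom_weight (Poly_Mapping.single j n) = Suc j * n"
  by (simp add: monom_weight_def)

lemma ydeg_0 [simp]: "ydeg 0 = 0" and monom_weight_0 [simp]: "monom_weight 0 = 0"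
  by (simp_all add: ydeg_def monom_weight_def)

lemma ydeg_sum: "ydeg (\<Sum>i\<in>I. f i) = (\<Sum>i\<in>I. ydeg (f i))"
  by (induction I rule: infinite_finite_induct) (auto simp: ydeg_add)

definition ysupp :: "ypoly \<Rightarrow> ((nat \<Rightarrow>\<^sub>0 nat) \<times> (nat \<Rightarrow>\<^sub>0 nat)) set" where
  "ysupp F = {(t, s). Poly_Mapping.lookup (Poly_Mapping.lookup F t) s \<noteq> 0}"

lemma ysupp_mult:
  assumes "(t, s) \<in> ysupp (F * G)"
  obtains t1 s1 t2 s2 where "(t1, s1) \<in> ysupp F" "(t2, s2) \<in> ysupp G" "t = t1 + t2" "s = s1 + s2"
proof -
  let ?f = "\<lambda>t1 t2. Poly_Mapping.single (t1 + t2) (Poly_Mapping.lookup F t1 * Poly_Mapping.lookup G t2)"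
  have "F * G = (\<Sum>t1\<in>Poly_Mapping.keys F. \<Sum>t2\<in>Poly_Mapping.keys G. ?f t1 t2)"
    by (subst (1) poly_mapping_expansion[of F], subst (1) poly_mapping_expansion[of G])
       (simp only: sum_product mult_single)
  then have "(\<Sum>t1\<in>Poly_Mapping.keys F. \<Sum>t2\<in>Poly_Mapping.keys G. Poly_Mapping.lookup (Poly_Mapping.lookup (?f t1 t2) t) s) \<noteq> 0"
    using assms by (simp add: ysupp_def lookup_sum)
  then obtain t1 where "(\<Sum>t2\<in>Poly_Mapping.keys G. Poly_Mapping.lookup (Poly_Mapping.lookup (?f t1 t2) t) s) \<noteq> 0"
    using sum.not_neutral_contains_not_neutral by blast
  then obtain t2 where t2: "Poly_Mapping.lookup (Poly_Mapping.lookup (?f t1 t2) t) s \<noteq> 0"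
    using sum.not_neutral_contains_not_neutral by blast
  then have t: "t = t1 + t2" and s: "s \<in> Poly_Mapping.keys (Poly_Mapping.lookup F t1 * Poly_Mapping.lookup G t2)"
    by (auto simp: lookup_single when_def in_keys_iff split: if_splits)
  obtain s1 s2 where "s1 \<in> Poly_Mapping.keys (Poly_Mapping.lookup F t1)" "s2 \<in> Poly_Mapping.keys (Poly_Mapping.lookup G t2)" "s = s1 + s2"
    using s keys_mult[of "Poly_Mapping.lookup F t1" "Poly_Mapping.lookup G t2"] by blast
  then show thesis using that t by (simp add: ysupp_def in_keys_iff)
qed

lemma ysupp_add: "ysupp (F + G) \<subseteq> ysupp F \<union> ysupp G" and ysupp_diff: "ysupp (F - G) \<subseteq> ysupp F \<union> ysupp G"
  by (auto simp: ysupp_def lookup_add lookup_minus)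

lemma ysupp_single: "ysupp (Poly_Mapping.single t P) = {t} \<times> Poly_Mapping.keys P"
  by (auto simp: ysupp_def lookup_single when_def in_keys_iff split: if_splits)

lemma ysupp_0 [simp]: "ysupp 0 = {}" and ysupp_1: "ysupp 1 = {(0, 0)}"
  using ysupp_single[of 0 0] ysupp_single[of 0 1] by auto

text \<open>
  In a product of members of \<open>graded u\<close> and \<open>graded v\<close> the weight of a coefficient stays at least \<open>u + v\<close> below the degree
  of its monomial; \<open>deep n\<close> is the ideal of series starting in degree \<open>n\<close>.
\<close>

definition graded :: "nat \<Rightarrow> ypoly set" where
  "graded v = {F. \<forall>(t, s)\<in>ysupp F. monom_weight s + v \<le> ydeg t}"

definition deep :: "nat \<Rightarrow> ypoly set" where
  "deep n = {F. \<forall>(t, s)\<in>ysupp F. n \<le> ydeg t}"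

lemma graded_mult: "F \<in> graded u \<Longrightarrow> G \<in> graded v \<Longrightarrow> F * G \<in> graded (u + v)"
  unfolding graded_def by (fastforce elim!: ysupp_mult simp: monom_weight_add ydeg_add)

lemma deep_mult: "F \<in> deep u \<Longrightarrow> G \<in> deep v \<Longrightarrow> F * G \<in> deep (u + v)"
  unfolding deep_def by (fastforce elim!: ysupp_mult simp: ydeg_add)

lemma graded_add: "F \<in> graded v \<Longrightarrow> G \<in> graded v \<Longrightarrow> F + G \<in> graded v"
  and graded_diff: "F \<in> graded v \<Longrightarrow> G \<in> graded v \<Longrightarrow> F - G \<in> graded v"
  and deep_add: "F \<in> deep n \<Longrightarrow> G \<in> deep n \<Longrightarrow> F + G \<in> deep n"
  using ysupp_add[of F G] ysupp_diff[of F G] by (auto simp: graded_def deep_def)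

lemma graded_0 [simp]: "0 \<in> graded v" and deep_0 [simp]: "0 \<in> deep n" and graded_1 [simp]: "1 \<in> graded 0" and deep_zero [simp]: "F \<in> deep 0"
  by (auto simp: graded_def deep_def ysupp_1)

lemma graded_sum: "(\<And>i. i \<in> I \<Longrightarrow> f i \<in> graded v) \<Longrightarrow> (\<Sum>i\<in>I. f i) \<in> graded v"
  by (induction I rule: infinite_finite_induct) (auto intro: graded_add)

lemma deep_sum: "(\<And>i. i \<in> I \<Longrightarrow> f i \<in> deep v) \<Longrightarrow> (\<Sum>i\<in>I. f i) \<in> deep v"
  by (induction I rule: infinite_finite_induct) (auto intro: deep_add)

lemma graded_prod: "(\<And>i. i \<in> I \<Longrightarrow> f i \<in> graded v) \<Longrightarrow> finite I \<Longrightarrow> (\<Prod>i\<in>I. f i) \<in> graded (card I * v)"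
  by (induction I rule: infinite_finite_induct) (auto intro: graded_mult)

lemma deep_power: "F \<in> deep n \<Longrightarrow> F ^ k \<in> deep (k * n)"
  by (induction k) (auto intro: deep_mult)

lemma deep_mono: "F \<in> deep n \<Longrightarrow> k \<le> n \<Longrightarrow> F \<in> deep k"
  by (auto simp: deep_def)

lemma deep_prod_diff:
  assumes "\<And>i. i \<in> I \<Longrightarrow> f i - g i \<in> deep n"
  shows "(\<Prod>i\<in>I. f i) - (\<Prod>i\<in>I. g i) \<in> deep n"
  using assms
proof (induction I rule: infinite_finite_induct)
  case (insert i I)
  have "f i * (\<Prod>i\<in>I. f i) - g i * (\<Prod>i\<in>I. g i) = (f i - g i) * (\<Prod>i\<in>I. f i) + ((\<Prod>i\<in>I. f i) - (\<Prod>i\<in>I. g i)) * g i"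
    by (simp add: algebra_simps)
  moreover have "\<dots> \<in> deep n"
    using insert deep_mult[of _ n _ 0] by (intro deep_add) auto
  ultimately show ?case using insert by simp
qed auto

lemma yvar_power: "yvar j ^ n = Poly_Mapping.single (Poly_Mapping.single j n) 1"
proof (induction n)
  case (Suc n)
  then show ?case by (simp add: yvar_def mult_single flip: single_add)
qed (simp add: yvar_def)

lemma yvar_graded: "yvar j \<in> graded 1"
  by (simp add: yvar_def graded_def ysupp_single)

lemma power_sum_deep: "(\<Sum>j=2..l. yvar j ^ d) ^ k \<in> deep (k * d)"
  by (intro deep_power deep_sum) (simp add: yvar_power deep_def ysupp_single)

definition binom_series :: "nat \<Rightarrow> nat \<Rightarrow> nat \<Rightarrow> ypoly" where
  "binom_series l N d = (\<Sum>k\<le>N. yconst (qbinom (qvar d) k) * (\<Sum>j=2..l. yvar j ^ d) ^ k)"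

lemma yconst_mult: "yconst (P * Q) = yconst P * yconst Q"
  by (simp add: yconst_def mult_single)

lemma yconst_prod: "yconst (\<Prod>i\<in>I. f i) = (\<Prod>i\<in>I. yconst (f i))"
  by (induction I rule: infinite_finite_induct) (auto simp: yconst_mult, auto simp: yconst_def)

text \<open>
  Each factor \<open>X\<^sub>d - i\<close> of the binomial coefficient, of weight \<open>d\<close>, is paired with a factor \<open>p\<^sub>d\<close>, of degree \<open>d\<close>.
\<close>

lemma binom_term_graded:
  assumes d: "1 \<le> d"
  shows "yconst (qbinom (qvar d) k) * (\<Sum>j=2..l. yvar j ^ d) ^ k \<in> graded 0"
proof -
  let ?S = "\<Sum>j=2..l. yvar j ^ d"
  have mon: "yconst (qvar d - of_nat i) * yvar j ^ d \<in> graded 0" for i j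
  proof -
    have "monom_weight s \<le> d" if "s \<in> Poly_Mapping.keys (qvar d - of_nat i)" for s
      using that d by (auto simp: in_keys_iff lookup_minus qvar_def lookup_single lookup_of_nat when_def split: if_splits)
    then show ?thesis
      by (auto simp: yconst_def yvar_power mult_single graded_def ysupp_single)
  qed
  have "(\<Prod>i<k. yconst (qvar d - of_nat i) * ?S) \<in> graded (card {..<k} * 0)"
    unfolding sum_distrib_left by (intro graded_prod graded_sum mon) auto
  moreover have "yconst (qconst c) \<in> graded 0" for c
    by (cases "c = 0") (auto simp: yconst_def qconst_def graded_def ysupp_single)
  ultimately have "yconst (qconst (1 / fact k)) * (\<Prod>i<k. yconst (qvar d - of_nat i) * ?S) \<in> graded (0 + 0)"
    by (intro graded_mult) auto
  then show ?thesis
    by (simp add: qbinom_def yconst_mult yconst_prod prod.distrib mult.assoc)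
qed

lemma binom_series_graded: "1 \<le> d \<Longrightarrow> binom_series l N d \<in> graded 0"
  unfolding binom_series_def by (intro graded_sum binom_term_graded)

lemma binom_series_truncation:
  assumes "D \<le> N" "1 \<le> d"
  shows "binom_series l N d - (if d \<le> D then binom_series l D d else 1) \<in> deep (Suc D)"
proof -
  let ?f = "\<lambda>k. yconst (qbinom (qvar d) k) * (\<Sum>j=2..l. yvar j ^ d) ^ k"
  have f: "?f k \<in> deep (Suc D)" if "D < k * d" for k
  proof -
    have "?f k \<in> deep (0 + k * d)" by (intro deep_mult deep_zero power_sum_deep)
    then show ?thesis using that by (elim deep_mono) simp
  qed
  show ?thesis
  proof (cases "d \<le> D")
    case True
    have "binom_series l N d = binom_series l D d + (\<Sum>k\<in>{..N} - {..D}. ?f k)"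
      unfolding binom_series_def using assms by (subst sum.subset_diff[of "{..D}"]) (auto simp: add.commute)
    moreover have "(\<Sum>k\<in>{..N} - {..D}. ?f k) \<in> deep (Suc D)"
    proof (intro deep_sum f)
      fix k assume "k \<in> {..N} - {..D}"
      then have "D < k" by auto
      also have "k \<le> k * d" using assms by simp
      finally show "D < k * d" .
    qed
    ultimately show ?thesis using True by simp
  next
    case False
    have "binom_series l N d = ?f 0 + (\<Sum>k\<in>{..N} - {0}. ?f k)"
      unfolding binom_series_def by (intro sum.remove) auto
    moreover have "?f 0 = 1" by (simp add: qbinom_def qconst_def yconst_def)
    moreover have "(\<Sum>k\<in>{..N} - {0}. ?f k) \<in> deep (Suc D)"
    proof (intro deep_sum f)
      fix k assume "k \<in> {..N} - {0}"
      then have "1 * d \<le> k * d" by (intro mult_le_mono1) auto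
      then show "D < k * d" using False by linarith
    qed
    ultimately show ?thesis using False by simp
  qed
qed

lemma frob_truncated_eq:
  "frob_truncated l N = (\<Prod>(i, j)\<in>{(i, j). 2 \<le> i \<and> i < j \<and> j \<le> l}. yvar i - yvar j) * (\<Prod>j=2..l. 1 - yvar j) * (\<Prod>d=1..N. binom_series l N d)"
  by (simp add: frob_truncated_def binom_series_def)

lemma lookup_frob_truncated_stable:
  assumes "ydeg \<alpha> \<le> D" "D \<le> N"
  shows "Poly_Mapping.lookup (frob_truncated l N) \<alpha> = Poly_Mapping.lookup (frob_truncated l D) \<alpha>"
proof -
  let ?V = "(\<Prod>(i, j)\<in>{(i, j). 2 \<le> i \<and> i < j \<and> j \<le> l}. yvar i - yvar j) * (\<Prod>j=2..l. 1 - yvar j)"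
  have "(\<Prod>d=1..N. if d \<le> D then binom_series l D d else 1) = (\<Prod>d\<in>{1..D}. if d \<le> D then binom_series l D d else 1)"
    by (rule prod.mono_neutral_right) (use assms in auto)
  also have "\<dots> = (\<Prod>d=1..D. binom_series l D d)" by (intro prod.cong) auto
  finally have e: "(\<Prod>d=1..N. if d \<le> D then binom_series l D d else 1) = (\<Prod>d=1..D. binom_series l D d)" .
  have "(\<Prod>d=1..N. binom_series l N d) - (\<Prod>d=1..D. binom_series l D d) \<in> deep (Suc D)"
    unfolding e[symmetric] by (intro deep_prod_diff binom_series_truncation) (use assms in auto)
  then have "?V * ((\<Prod>d=1..N. binom_series l N d) - (\<Prod>d=1..D. binom_series l D d)) \<in> deep (0 + Suc D)"
    by (intro deep_mult deep_zero)
  then have "frob_truncated l N - frob_truncated l D \<in> deep (Suc D)"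
    by (simp add: frob_truncated_eq algebra_simps)
  then have "Poly_Mapping.lookup (Poly_Mapping.lookup (frob_truncated l N - frob_truncated l D) \<alpha>) s = 0" for s
    using assms by (force simp: deep_def ysupp_def)
  then have "Poly_Mapping.lookup (frob_truncated l N - frob_truncated l D) \<alpha> = 0"
    by (intro poly_mapping_eqI) simp
  then show ?thesis by (simp add: lookup_minus)
qed

lemma frob_coeff_eq:
  assumes "ydeg \<alpha> \<le> N"
  shows "frob_coeff l \<alpha> = Poly_Mapping.lookup (frob_truncated l N) \<alpha>"
proof -
  let ?L = "\<lambda>N. Poly_Mapping.lookup (frob_truncated l N) \<alpha>"
  have ev: "\<forall>\<^sub>F n in sequentially. ?L n = ?L N"
    by (rule eventually_sequentiallyI[of N]) (rule lookup_frob_truncated_stable[OF assms])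
  show ?thesis unfolding frob_coeff_def
  proof (rule the_equality)
    show "\<forall>\<^sub>F n in sequentially. ?L n = ?L N" by (rule ev)
    fix c assume "\<forall>\<^sub>F n in sequentially. ?L n = c"
    then have "\<forall>\<^sub>F n in sequentially. c = ?L N" using ev by eventually_elim simp
    then show "c = ?L N" by simp
  qed
qed

definition frob_monomial :: "nat list \<Rightarrow> nat \<Rightarrow>\<^sub>0 nat" where
  "frob_monomial \<mu> = (\<Sum>j=1..<length \<mu>. Poly_Mapping.single (Suc j) (\<mu> ! j + (length \<mu> - 1 - j)))"

lemma frob_poly_eq:
  assumes "ydeg (frob_monomial \<mu>) \<le> N"
  shows "frob_poly \<mu> = Poly_Mapping.lookup (frob_truncated (length \<mu>) N) (frob_monomial \<mu>)"
proof -
  have "(\<Sum>j=2..length \<mu>. Poly_Mapping.single j (\<mu> ! (j - 1) + length \<mu> - j)) = frob_monomial \<mu>"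
    unfolding frob_monomial_def
    by (rule sum.reindex_bij_witness[where i = Suc and j = "\<lambda>j. j - 1"]) auto
  then show ?thesis unfolding frob_poly_def Let_def using frob_coeff_eq[OF assms] by simp
qed

lemma sum_nth_tl: "(\<Sum>j=1..<length \<mu>. \<mu> ! j) = weight \<mu>"
proof (cases \<mu>)
  case (Cons a \<nu>)
  have "(\<Sum>j=1..<length \<mu>. \<mu> ! j) = (\<Sum>j<length \<nu>. \<nu> ! j)"
    by (rule sum.reindex_bij_witness[where i = Suc and j = "\<lambda>j. j - 1"]) (auto simp: Cons)
  then show ?thesis by (simp add: Cons weight_def sum_list_sum_nth atLeast0LessThan)
qed (simp add: weight_def)

text \<open>
  The Vandermonde factor has weight 0, and its degree is the part of the exponent that does not come from the socle of \<open>\<mu>\<close>,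
  so the remaining factors are read off in degree \<open>weight \<mu>\<close>.
\<close>

lemma frob_poly_weight:
  assumes s: "s \<in> Poly_Mapping.keys (frob_poly \<mu>)"
  shows "monom_weight s \<le> weight \<mu>"
proof -
  let ?l = "length \<mu>" and ?\<alpha> = "frob_monomial \<mu>"
  let ?N = "ydeg ?\<alpha>"
  let ?V = "{(i, j). 2 \<le> i \<and> i < j \<and> j \<le> ?l}"
  have V: "?V = (SIGMA i:{2..?l}. {i<..?l})" by auto
  have cardV: "card ?V = (\<Sum>j=2..?l. ?l - j)" unfolding V by simp
  also have "\<dots> = (\<Sum>j=1..<?l. ?l - 1 - j)"
    by (rule sum.reindex_bij_witness[where i = Suc and j = "\<lambda>j. j - 1"]) auto
  finally have deg: "ydeg ?\<alpha> = weight \<mu> + card ?V"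
    unfolding frob_monomial_def ydeg_sum ydeg_single sum.distrib sum_nth_tl by simp
  have "(\<Prod>(i, j)\<in>?V. yvar i - yvar j) \<in> graded (card ?V * 1)"
    by (intro graded_prod) (use V yvar_graded in \<open>auto intro: graded_diff\<close>)
  moreover have "(\<Prod>j=2..?l. 1 - yvar j) \<in> graded (card {2..?l} * 0)"
  proof (intro graded_prod graded_diff graded_1)
    show "yvar j \<in> graded 0" for j using yvar_graded[of j] by (auto simp: graded_def)
  qed simp
  moreover have "(\<Prod>d=1..?N. binom_series ?l ?N d) \<in> graded (card {1..?N} * 0)"
    by (intro graded_prod binom_series_graded) auto
  ultimately have "frob_truncated ?l ?N \<in> graded ((card ?V * 1 + card {2..?l} * 0) + card {1..?N} * 0)"
    unfolding frob_truncated_eq by (intro graded_mult)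
  moreover have "(?\<alpha>, s) \<in> ysupp (frob_truncated ?l ?N)"
    using s frob_poly_eq[of \<mu> ?N] by (simp add: ysupp_def in_keys_iff)
  ultimately show ?thesis using deg by (auto simp: graded_def)
qed

lemma rho_frob_poly:
  assumes g: "g \<in> perms m" and \<mu>: "\<mu> \<noteq> [] \<or> m = 0"
  shows "rho m (frob_poly \<mu>) g
    = (\<Sum>w | w permutes {..<length \<mu>}. \<Sum>F | F \<in> colourings m {..<length \<mu>} \<and> g \<in> stab m F.
        if \<forall>j\<in>{1..<length \<mu>}. staircase (length \<mu>) (w j) + icontent m F j = frob_exponent \<mu> j then of_int (sign w) else 0)"
proof -
  let ?l = "length \<mu>"
  let ?N = "ydeg (frob_monomial \<mu>) + m"
  have l: "1 \<le> ?l \<or> m = 0" using \<mu> by (cases \<mu>) auto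
  have cond: "?l - 1 - w j + colour_count m F j = \<mu> ! j + (?l - 1 - j) \<longleftrightarrow> staircase ?l (w j) + icontent m F j = frob_exponent \<mu> j"
    if "j \<in> {1..<?l}" for j w F
    using that by (auto simp: staircase_def icontent_def frob_exponent_def part_def)
  have "rho m (frob_poly \<mu>) g = qeval (cycle_type m g) (Poly_Mapping.lookup (frob_truncated ?l ?N) (frob_monomial \<mu>))"
    using g frob_poly_eq[of \<mu> ?N] by (simp add: rho_perms)
  also have "\<dots> = (\<Sum>w | w permutes {..<?l}. \<Sum>F | F \<in> colourings m {..<?l} \<and> g \<in> stab m F.
        if \<forall>j\<in>{1..<?l}. ?l - 1 - w j + colour_count m F j = \<mu> ! j + (?l - 1 - j) then of_int (sign w) else 0)"
    unfolding frob_monomial_def by (rule qeval_lookup_frob_truncated[OF g l]) simp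
  finally show ?thesis using cond by simp
qed

text \<open>When \<open>\<mu>\<close> is a partition of \<open>m\<close>, the exponent of the variable set to 1 is determined by the total degree.\<close>

lemma rho_frob_poly_own:
  assumes \<mu>: "\<mu> \<in> partitions m"
  shows "rho m (frob_poly \<mu>) = simple_char \<mu>"
proof
  fix g
  let ?l = "length \<mu>" and ?\<gamma> = "frob_exponent \<mu>"
  have m: "sum_list \<mu> = m" by (rule sum_list_partition[OF \<mu>])
  show "rho m (frob_poly \<mu>) g = simple_char \<mu> g"
  proof (cases "g \<in> perms m")
    case g: True
    let ?X = "{F \<in> colourings m {..<?l}. g \<in> stab m F}"
    have iff: "(\<forall>j\<in>{1..<?l}. staircase ?l (w j) + icontent m F j = ?\<gamma> j) \<longleftrightarrow> ?\<gamma> - icontent m F = staircase ?l \<circ> w"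
      if w: "w permutes {..<?l}" and F: "F \<in> colourings m {..<?l}" for w F
    proof
      assume h: "\<forall>j\<in>{1..<?l}. staircase ?l (w j) + icontent m F j = ?\<gamma> j"
      have "(\<Sum>j<?l. staircase ?l (w j)) = (\<Sum>j<?l. staircase ?l j)"
        using sum.permute[OF w, of "staircase ?l"] by (simp add: o_def)
      then have tot: "(\<Sum>j<?l. staircase ?l (w j) + icontent m F j) = (\<Sum>j<?l. ?\<gamma> j)"
        using sum_icontent_colouring[OF F] part_props(4)[OF \<mu>, of ?l] m by (simp add: sum.distrib frob_exponent_def)
      have all: "staircase ?l (w j) + icontent m F j = ?\<gamma> j" if "j < ?l" for j
      proof (cases "j = 0")
        case True
        have split: "(\<Sum>j<?l. f j) = f 0 + (\<Sum>j=1..<?l. f j)" for f :: "nat \<Rightarrow> int"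
          unfolding lessThan_atLeast0 using sum.atLeast_Suc_lessThan[of 0 ?l f] \<open>j < ?l\<close>
          by (metis One_nat_def gr_zeroI less_zeroE)
        have "(\<Sum>j=1..<?l. staircase ?l (w j) + icontent m F j) = (\<Sum>j=1..<?l. ?\<gamma> j)"
          using h by (intro sum.cong) auto
        then show ?thesis using tot True unfolding split by simp
      qed (use h that in auto)
      show "?\<gamma> - icontent m F = staircase ?l \<circ> w"
      proof
        fix j show "(?\<gamma> - icontent m F) j = (staircase ?l \<circ> w) j"
        proof (cases "j < ?l")
          case False
          then have "icontent m F j = 0" "w j = j"
            using F colourings_mem w by (fastforce simp: icontent_def colour_count_def, simp add: permutes_def)
          then show ?thesis using False by (simp add: frob_exponent_def part_def)
        qed (use all[of j] in simp)
      qed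
    next
      assume "?\<gamma> - icontent m F = staircase ?l \<circ> w"
      then have "staircase ?l (w j) = ?\<gamma> j - icontent m F j" for j by (metis comp_apply minus_apply)
      then show "\<forall>j\<in>{1..<?l}. staircase ?l (w j) + icontent m F j = ?\<gamma> j" by simp
    qed
    have ne: "\<mu> \<noteq> [] \<or> m = 0" using m by auto
    have "rho m (frob_poly \<mu>) g = (\<Sum>w | w permutes {..<?l}. \<Sum>F\<in>?X. if ?\<gamma> - icontent m F = staircase ?l \<circ> w then of_int (sign w) else 0)"
      unfolding rho_frob_poly[OF g ne] by (intro sum.cong refl if_cong iff) auto
    also have "\<dots> = (\<Sum>F\<in>?X. \<Sum>w | w permutes {..<?l}. if ?\<gamma> - icontent m F = staircase ?l \<circ> w then of_int (sign w) else 0)"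
      by (rule sum.swap)
    also have "\<dots> = alternating_fixed_count ?l ?\<gamma> m g"
      unfolding alternating_fixed_count_def alternant_coeff_def by (intro sum.cong refl) (simp add: of_int_sum if_distrib cong: if_cong)
    finally show ?thesis using frobenius_formula[OF \<mu> g] by simp
  next
    case False
    then show ?thesis using simple_char_outside[OF False m] by (simp add: rho_perms)
  qed
qed

section \<open>Independent families\<close>

text \<open>
  A family version of linear independence, which includes injectivity of the family and so allows counting its index set.
\<close>

definition independent_family :: "('s::zero \<Rightarrow> 'v \<Rightarrow> 'v::comm_monoid_add) \<Rightarrow> 'i set \<Rightarrow> ('i \<Rightarrow> 'v) \<Rightarrow> bool" where
  "independent_family scale I e \<longleftrightarrow> (\<forall>u. (\<Sum>i\<in>I. scale (u i) (e i)) = 0 \<longrightarrow> (\<forall>i\<in>I. u i = 0))"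

lemma independent_familyD:
  "\<lbrakk>independent_family scale I e; (\<Sum>i\<in>I. scale (u i) (e i)) = 0; i \<in> I\<rbrakk> \<Longrightarrow> u i = 0"
  by (simp add: independent_family_def)

context vector_space
begin

lemma independent_family_image:
  assumes fin: "finite I" and indep: "independent_family scale I e"
  shows "inj_on e I" "\<not> dependent (e ` I)"
proof -
  show inj: "inj_on e I"
  proof (rule inj_onI, rule ccontr)
    fix i j assume ij: "i \<in> I" "j \<in> I" "e i = e j" "i \<noteq> j"
    let ?u = "\<lambda>k. if k = i then (1 :: 'a) else if k = j then -1 else 0"
    have "(\<Sum>k\<in>I. scale (?u k) (e k)) = (\<Sum>k\<in>{i, j}. scale (?u k) (e k))"
      using ij fin by (intro sum.mono_neutral_right) auto
    also have "\<dots> = 0" using ij by simp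
    finally have "?u i = 0" using independent_familyD[OF indep, of ?u i] ij(1) by blast
    then show False by simp
  qed
  show "\<not> dependent (e ` I)"
  proof
    assume "dependent (e ` I)"
    then obtain u v where u: "v \<in> e ` I" "u v \<noteq> 0" "(\<Sum>v\<in>e ` I. scale (u v) v) = 0"
      using fin by (auto simp: dependent_finite)
    then have "(\<Sum>i\<in>I. scale (u (e i)) (e i)) = 0" using inj by (simp add: sum.reindex)
    then have "\<forall>i\<in>I. u (e i) = 0" using independent_familyD[OF indep, of "\<lambda>i. u (e i)"] by blast
    then show False using u by auto
  qed
qed

lemma independent_family_card:
  assumes fin: "finite I" and indep: "independent_family scale I e"
    and T: "finite T" "\<And>i. i \<in> I \<Longrightarrow> e i \<in> span T"
  shows "card I \<le> card T"
proof -
  have "card (e ` I) \<le> card T"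
    using independent_span_bound[OF T(1) independent_family_image(2)[OF fin indep]] T(2) by auto
  then show ?thesis using independent_family_image(1)[OF fin indep] by (simp add: card_image)
qed

lemma independent_family_spans:
  assumes fin: "finite I" and indep: "independent_family scale I e"
    and T: "finite T" "\<And>i. i \<in> I \<Longrightarrow> e i \<in> span T" and card: "card T \<le> card I" and x: "x \<in> span T"
  obtains u where "x = (\<Sum>i\<in>I. scale (u i) (e i))"
proof -
  note fam = independent_family_image[OF fin indep]
  have "x \<in> span (e ` I)"
  proof (rule ccontr)
    assume nx: "x \<notin> span (e ` I)"
    then have "x \<notin> e ` I" using span_base by blast
    then have "\<not> dependent (insert x (e ` I))" using fam(2) nx by (simp add: independent_insert)
    then have "card (insert x (e ` I)) \<le> card T"
      using independent_span_bound[OF T(1)] T(2) x by auto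
    then show False using \<open>x \<notin> e ` I\<close> fam(1) fin card by (simp add: card_image)
  qed
  then obtain u where "x = (\<Sum>v\<in>e ` I. scale (u v) v)" using fin by (auto simp: span_finite)
  then have "x = (\<Sum>i\<in>I. scale (u (e i)) (e i))" using fam(1) by (simp add: sum.reindex)
  then show thesis by (rule that)
qed

end

section \<open>Partitions and exponents\<close>

lemma finite_partitions: "finite (partitions m)"
proof (rule finite_subset)
  show "partitions m \<subseteq> {xs. set xs \<subseteq> {..m} \<and> length xs \<le> m}"
  proof
    fix \<mu> assume \<mu>: "\<mu> \<in> partitions m"
    have "length \<mu> \<le> sum_list \<mu>" if "0 \<notin> set \<mu>" for \<mu> :: "nat list"
      using that by (induction \<mu>) auto
    then show "\<mu> \<in> {xs. set xs \<subseteq> {..m} \<and> length xs \<le> m}"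
      using \<mu> member_le_sum_list by (fastforce simp: partitions_def)
  qed
qed (simp add: finite_lists_length_le)

text \<open>
  The exponent of the product of the variables \<open>X\<^sub>i\<close> over the parts \<open>i\<close>; the variable \<open>X\<^sub>i\<close> has index \<open>i - 1\<close>.
\<close>

definition exponent :: "nat list \<Rightarrow> nat \<Rightarrow>\<^sub>0 nat" where
  "exponent \<nu> = (\<Sum>i\<leftarrow>\<nu>. Poly_Mapping.single (i - 1) 1)"

lemma exponent_simps [simp]: "exponent [] = 0" "exponent (i # \<nu>) = Poly_Mapping.single (i - 1) 1 + exponent \<nu>"
  by (simp_all add: exponent_def)

lemma lookup_exponent: "0 \<notin> set \<nu> \<Longrightarrow> Poly_Mapping.lookup (exponent \<nu>) k = count (mset \<nu>) (Suc k)"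
  by (induction \<nu>) (auto simp: lookup_add lookup_single when_def)

lemma monom_weight_exponent: "0 \<notin> set \<nu> \<Longrightarrow> monom_weight (exponent \<nu>) = sum_list \<nu>"
  by (induction \<nu>) (auto simp: monom_weight_add simp del: mult_Suc)

lemma decreasing_mset_eq:
  assumes "sorted_wrt (\<ge>) \<mu>" "sorted_wrt (\<ge>) \<nu>" "mset \<mu> = mset (\<nu> :: nat list)"
  shows "\<mu> = \<nu>"
proof -
  have "sorted (rev \<mu>)" "sorted (rev \<nu>)" using assms by (simp_all add: sorted_wrt_rev)
  then have "rev \<mu> = rev \<nu>" using assms(3) by (metis mset_rev properties_for_sort)
  then show ?thesis by simp
qed

lemma exponent_inj:
  assumes \<mu>: "\<mu> \<in> partitions m" and \<nu>: "\<nu> \<in> partitions n" and eq: "exponent \<mu> = exponent \<nu>"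
  shows "\<mu> = \<nu>"
proof (rule decreasing_mset_eq)
  have z: "0 \<notin> set \<mu>" "0 \<notin> set \<nu>" using \<mu> \<nu> unfolding partitions_def by blast+
  show "sorted_wrt (\<ge>) \<mu>" "sorted_wrt (\<ge>) \<nu>" using \<mu> \<nu> unfolding partitions_def by blast+
  show "mset \<mu> = mset \<nu>"
  proof (rule multiset_eqI)
    fix i show "count (mset \<mu>) i = count (mset \<nu>) i"
    proof (cases i)
      case 0
      then show ?thesis using z by (simp add: count_eq_zero_iff[THEN iffD2])
    next
      case (Suc k)
      then show ?thesis using lookup_exponent[OF z(1), of k] lookup_exponent[OF z(2), of k] eq by simp
    qed
  qed
qed

lemma partition_of_multiset:
  assumes "0 \<notin># M" "sum_mset M = (m :: nat)"
  obtains \<nu> where "\<nu> \<in> partitions m" "mset \<nu> = M"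
proof -
  let ?\<nu> = "rev (sorted_list_of_multiset M)"
  have ms: "mset ?\<nu> = M" by simp
  have "sorted_wrt (\<ge>) ?\<nu>" by (simp add: sorted_wrt_rev)
  moreover have "0 \<notin> set ?\<nu>" using assms(1) by simp
  moreover have "sum_list ?\<nu> = m" using assms(2) ms by (metis sum_mset_sum_list)
  ultimately have "?\<nu> \<in> partitions m" unfolding partitions_def by blast
  then show thesis using that ms by blast
qed

lemma exponent_surj:
  obtains \<nu> where "\<nu> \<in> partitions (monom_weight t)" "exponent \<nu> = t"
proof -
  let ?M = "\<Sum>k\<in>Poly_Mapping.keys t. replicate_mset (Poly_Mapping.lookup t k) (Suc k)"
  have count: "count ?M (Suc k) = Poly_Mapping.lookup t k" for k
  proof -
    have "count ?M (Suc k) = (\<Sum>j\<in>Poly_Mapping.keys t. if j = k then Poly_Mapping.lookup t j else 0)"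
      by (simp add: count_sum)
    then show ?thesis by (auto simp: in_keys_iff)
  qed
  have z: "0 \<notin># ?M" by (auto simp: count_sum not_in_iff)
  obtain \<nu> where \<nu>: "\<nu> \<in> partitions (sum_mset ?M)" "mset \<nu> = ?M" using partition_of_multiset[OF z refl] .
  have z\<nu>: "0 \<notin> set \<nu>" using \<nu>(1) unfolding partitions_def by blast
  have e: "exponent \<nu> = t"
    by (rule poly_mapping_eqI) (simp only: lookup_exponent[OF z\<nu>] \<nu>(2) count)
  then have "sum_mset ?M = monom_weight t"
    using monom_weight_exponent[OF z\<nu>] sum_list_partition[OF \<nu>(1)] by simp
  then show thesis using that \<nu> e by simp
qed

lemma partition_tl:
  assumes "\<mu> \<in> partitions m" shows "tl \<mu> \<in> partitions (weight \<mu>)"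
proof -
  have "sorted_wrt (\<ge>) \<mu>" "0 \<notin> set \<mu>" using assms unfolding partitions_def by blast+
  then have "sorted_wrt (\<ge>) (tl \<mu>)" "0 \<notin> set (tl \<mu>)" by (cases \<mu>; simp)+
  then show ?thesis unfolding partitions_def weight_def by blast
qed

lemma partition_tl_inj:
  assumes "\<mu> \<in> partitions m" "\<nu> \<in> partitions m" "tl \<mu> = tl \<nu>" shows "\<mu> = \<nu>"
proof -
  have 1: "sum_list \<mu> = m" "sum_list \<nu> = m" "0 \<notin> set \<mu>" "0 \<notin> set \<nu>" using assms unfolding partitions_def by blast+
  then show ?thesis using assms(3) by (cases \<mu>; cases \<nu>) auto
qed

definition light_partitions :: "nat \<Rightarrow> nat \<Rightarrow> nat list set" where
  "light_partitions m d = {\<mu> \<in> partitions m. weight \<mu> \<le> d}"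

definition light_exponents :: "nat \<Rightarrow> (nat \<Rightarrow>\<^sub>0 nat) set" where
  "light_exponents d = {t. monom_weight t \<le> d}"

lemma finite_light_partitions [simp]: "finite (light_partitions m d)"
  using finite_partitions by (simp add: light_partitions_def)

lemma light_exponents_eq: "light_exponents d = exponent ` (\<Union>k\<le>d. partitions k)"
proof (intro set_eqI iffI)
  fix t assume t: "t \<in> light_exponents d"
  obtain \<nu> where "\<nu> \<in> partitions (monom_weight t)" "exponent \<nu> = t" using exponent_surj .
  then show "t \<in> exponent ` (\<Union>k\<le>d. partitions k)" using t by (auto simp: light_exponents_def)
next
  fix t assume "t \<in> exponent ` (\<Union>k\<le>d. partitions k)"
  then obtain \<nu> k where \<nu>: "\<nu> \<in> partitions k" "k \<le> d" "t = exponent \<nu>" by auto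
  then have "0 \<notin> set \<nu>" "sum_list \<nu> = k" unfolding partitions_def by blast+
  then show "t \<in> light_exponents d" using monom_weight_exponent \<nu> by (simp add: light_exponents_def)
qed

lemma finite_light_exponents [simp]: "finite (light_exponents d)"
  unfolding light_exponents_eq using finite_partitions by auto

lemma exponent_tl_light:
  assumes "\<mu> \<in> light_partitions m d" shows "exponent (tl \<mu>) \<in> light_exponents d"
  using assms partition_tl[of \<mu> m] unfolding light_exponents_eq light_partitions_def by blast

lemma exponent_tl_inj: "inj_on (\<lambda>\<mu>. exponent (tl \<mu>)) (light_partitions m d)"
proof (rule inj_onI)
  fix \<mu> \<nu> assume \<mu>: "\<mu> \<in> light_partitions m d" and \<nu>: "\<nu> \<in> light_partitions m d" and e: "exponent (tl \<mu>) = exponent (tl \<nu>)"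
  then have P: "\<mu> \<in> partitions m" "\<nu> \<in> partitions m" by (auto simp: light_partitions_def)
  have "tl \<mu> = tl \<nu>" using exponent_inj[OF partition_tl[OF P(1)] partition_tl[OF P(2)] e] .
  then show "\<mu> = \<nu>" using partition_tl_inj P by blast
qed

text \<open>
  Every partition of some \<open>k \<le> d\<close> is the socle of a partition of \<open>m\<close> as soon as \<open>2 d \<le> m\<close>;
  beyond that, the socle \<open>(d)\<close> is missing.
\<close>

lemma card_light_exponents_le:
  assumes "2 * d \<le> m" shows "card (light_exponents d) \<le> card (light_partitions m d)"
proof -
  have "light_exponents d \<subseteq> (\<lambda>\<mu>. exponent (tl \<mu>)) ` light_partitions m d"
  proof
    fix t assume "t \<in> light_exponents d"
    then obtain \<nu> k where \<nu>: "\<nu> \<in> partitions k" "k \<le> d" "t = exponent \<nu>" by (auto simp: light_exponents_eq)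
    have n: "sorted_wrt (\<ge>) \<nu>" "0 \<notin> set \<nu>" "sum_list \<nu> = k" using \<nu>(1) unfolding partitions_def by blast+
    show "t \<in> (\<lambda>\<mu>. exponent (tl \<mu>)) ` light_partitions m d"
    proof (cases "m = 0")
      case True
      then have "\<nu> = []" using n \<nu>(2) assms by (cases \<nu>) auto
      moreover have "[] \<in> light_partitions m d" using True by (simp add: light_partitions_def partitions_def weight_def)
      ultimately show ?thesis using \<nu>(3) by force
    next
      case False
      let ?\<mu> = "(m - k) # \<nu>"
      have "x \<le> m - k" if "x \<in> set \<nu>" for x
        using member_le_sum_list[OF that] n \<nu>(2) assms by simp
      moreover have "m - k \<noteq> 0" using False \<nu>(2) assms by simp
      ultimately have "?\<mu> \<in> light_partitions m d"
        using n \<nu>(2) assms by (auto simp: light_partitions_def partitions_def weight_def)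
      then show ?thesis using \<nu>(3) by force
    qed
  qed
  then have "card (light_exponents d) \<le> card ((\<lambda>\<mu>. exponent (tl \<mu>)) ` light_partitions m d)"
    by (intro card_mono) auto
  also have "\<dots> \<le> card (light_partitions m d)" by (rule card_image_le) simp
  finally show ?thesis .
qed

lemma card_light_partitions_less:
  assumes "m < 2 * d" shows "card (light_partitions m d) < card (light_exponents d)"
proof -
  have d: "[d] \<in> partitions d" using assms by (simp add: partitions_def)
  have "exponent [d] \<notin> (\<lambda>\<mu>. exponent (tl \<mu>)) ` light_partitions m d"
  proof
    assume "exponent [d] \<in> (\<lambda>\<mu>. exponent (tl \<mu>)) ` light_partitions m d"
    then obtain \<mu> where \<mu>: "\<mu> \<in> partitions m" "exponent (tl \<mu>) = exponent [d]" by (auto simp: light_partitions_def)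
    have "tl \<mu> = [d]" using exponent_inj[OF partition_tl[OF \<mu>(1)] d \<mu>(2)] .
    then obtain a where a: "\<mu> = [a, d]" by (cases \<mu>) auto
    have "sorted_wrt (\<ge>) \<mu>" "sum_list \<mu> = m" using \<mu>(1) unfolding partitions_def by blast+
    then show False using a assms by simp
  qed
  moreover have "exponent [d] \<in> light_exponents d" using d unfolding light_exponents_eq by blast
  moreover have "(\<lambda>\<mu>. exponent (tl \<mu>)) ` light_partitions m d \<subseteq> light_exponents d" using exponent_tl_light by auto
  ultimately have "(\<lambda>\<mu>. exponent (tl \<mu>)) ` light_partitions m d \<subset> light_exponents d" by blast
  then have "card ((\<lambda>\<mu>. exponent (tl \<mu>)) ` light_partitions m d) < card (light_exponents d)"
    by (intro psubset_card_mono) auto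
  then show ?thesis using exponent_tl_inj by (simp add: card_image)
qed

section \<open>Completeness of the characters\<close>

lemma scalar_prod_sum_right:
  "scalar_prod m f (\<Sum>i\<in>I. pfun_scale (u i) (h i)) = (\<Sum>i\<in>I. u i * scalar_prod m f (h i))"
proof -
  have "(\<Sum>g\<in>perms m. f g * (\<Sum>i\<in>I. pfun_scale (u i) (h i)) (inv g)) = (\<Sum>g\<in>perms m. \<Sum>i\<in>I. u i * (f g * h i (inv g)))"
    by (simp add: sum_apply_fun sum_distrib_left pfun_scale_def mult.left_commute)
  also have "\<dots> = (\<Sum>i\<in>I. \<Sum>g\<in>perms m. u i * (f g * h i (inv g)))" by (rule sum.swap)
  finally show ?thesis by (simp add: scalar_prod_perms sum_distrib_left mult.left_commute)
qed

lemma scalar_prod_simple_char_combination: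
  assumes "\<nu> \<in> partitions m"
  shows "scalar_prod m (simple_char \<nu>) (\<Sum>\<mu>\<in>partitions m. pfun_scale (u \<mu>) (simple_char \<mu>)) = u \<nu>"
proof -
  have "scalar_prod m (simple_char \<nu>) (\<Sum>\<mu>\<in>partitions m. pfun_scale (u \<mu>) (simple_char \<mu>))
    = (\<Sum>\<mu>\<in>partitions m. if \<mu> = \<nu> then u \<mu> else 0)"
    unfolding scalar_prod_sum_right by (intro sum.cong refl) (auto simp: simple_char_orthonormal[OF assms])
  then show ?thesis using assms finite_partitions by simp
qed

lemma simple_char_independent: "independent_family pfun_scale (partitions m) simple_char"
  unfolding independent_family_def
proof (intro allI impI ballI)
  fix u \<mu> assume "(\<Sum>\<mu>\<in>partitions m. pfun_scale (u \<mu>) (simple_char \<mu>)) = 0" "\<mu> \<in> partitions m"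
  then show "u \<mu> = 0"
    using scalar_prod_simple_char_combination[of \<mu> m u] by (simp add: scalar_prod_perms)
qed

definition cycle_fun :: "nat \<Rightarrow> pfun \<Rightarrow> bool" where
  "cycle_fun m f \<longleftrightarrow> f \<in> group_algebra m \<and> (\<forall>g\<in>perms m. \<forall>h\<in>perms m. cycle_type m g = cycle_type m h \<longrightarrow> f g = f h)"

lemma cycle_fun_rho: "cycle_fun m (rho m P)"
  by (auto simp: cycle_fun_def group_algebra_eq rho_perms)

lemma cycle_partition:
  assumes g: "g \<in> perms m"
  obtains \<nu> where "\<nu> \<in> partitions m" "\<And>i. cycle_count m i g = count (mset \<nu>) i"
proof -
  let ?O = "orbit g ` letters m"
  let ?M = "image_mset card (mset_set ?O)"
  have z: "0 \<notin># ?M" using card_cycle_bounds[OF g] by force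
  have "sum_mset ?M = (\<Sum>C\<in>?O. card C)" by (simp add: sum_unfold_sum_mset)
  also have "\<dots> = (\<Sum>C\<in>?O. card {x \<in> letters m. orbit g x = C})"
  proof (rule sum.cong[OF refl])
    fix C assume C: "C \<in> ?O"
    have "{x \<in> letters m. orbit g x = C} = C" using C perms_orbit[OF g] by blast
    then show "card C = card {x \<in> letters m. orbit g x = C}" by simp
  qed
  also have "\<dots> = m" using sum_card_fibres[of ?O "letters m" "orbit g"] by simp
  finally have sum: "sum_mset ?M = m" .
  obtain \<nu> where \<nu>: "\<nu> \<in> partitions m" "mset \<nu> = ?M" using partition_of_multiset[OF z sum] .
  have "cycle_count m i g = count ?M i" for i
    by (simp add: cycle_count_eq count_image_mset_eq_card_vimage)
  then show thesis using that[OF \<nu>(1)] by (simp add: \<nu>(2))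
qed

lemma cycle_fun_in_span:
  obtains T where "finite T" "card T \<le> card (partitions m)" "\<And>f. cycle_fun m f \<Longrightarrow> f \<in> module.span pfun_scale T"
proof -
  interpret vector_space pfun_scale by (rule vector_space_pfun)
  define ind where "ind \<nu> g = (if g \<in> perms m \<and> (\<forall>i. cycle_count m i g = count (mset \<nu>) i) then 1 else 0 :: rat)" for \<nu> g
  have "f \<in> span (ind ` partitions m)" if f: "cycle_fun m f" for f
  proof -
    define v where "v \<nu> = f (SOME g. g \<in> perms m \<and> (\<forall>i. cycle_count m i g = count (mset \<nu>) i))" for \<nu>
    have "f = (\<Sum>\<nu>\<in>partitions m. pfun_scale (v \<nu>) (ind \<nu>))"
    proof
      fix g show "f g = (\<Sum>\<nu>\<in>partitions m. pfun_scale (v \<nu>) (ind \<nu>)) g"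
      proof (cases "g \<in> perms m")
        case g: True
        obtain \<nu> where \<nu>: "\<nu> \<in> partitions m" "\<And>i. cycle_count m i g = count (mset \<nu>) i" using cycle_partition[OF g] by blast
        have uniq: "ind \<mu> g = (if \<mu> = \<nu> then 1 else 0)" if \<mu>: "\<mu> \<in> partitions m" for \<mu>
        proof -
          have "\<mu> = \<nu>" if "\<forall>i. cycle_count m i g = count (mset \<mu>) i"
          proof (rule decreasing_mset_eq)
            show "sorted_wrt (\<ge>) \<mu>" "sorted_wrt (\<ge>) \<nu>" using \<mu> \<nu>(1) unfolding partitions_def by blast+
            show "mset \<mu> = mset \<nu>" using that \<nu>(2) by (intro multiset_eqI) simp
          qed
          then show ?thesis using g \<nu> by (auto simp: ind_def)
        qed
        define h where "h = (SOME h. h \<in> perms m \<and> (\<forall>i. cycle_count m i h = count (mset \<nu>) i))"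
        have h: "h \<in> perms m \<and> (\<forall>i. cycle_count m i h = count (mset \<nu>) i)"
          unfolding h_def by (rule someI[of _ g]) (use g \<nu> in auto)
        then have "cycle_type m g = cycle_type m h" using \<nu>(2) by (auto simp: cycle_type_def fun_eq_iff)
        then have "v \<nu> = f g" using f g h unfolding v_def h_def[symmetric] cycle_fun_def by metis
        moreover have "(\<Sum>\<mu>\<in>partitions m. pfun_scale (v \<mu>) (ind \<mu>)) g = (\<Sum>\<mu>\<in>partitions m. if \<mu> = \<nu> then v \<mu> else 0)"
          by (auto simp: sum_apply_fun pfun_scale_def uniq intro!: sum.cong)
        ultimately show ?thesis using \<nu>(1) finite_partitions by simp
      next
        case False
        then show ?thesis using f by (simp add: sum_apply_fun pfun_scale_def ind_def cycle_fun_def group_algebra_eq)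
      qed
    qed
    moreover have "(\<Sum>\<nu>\<in>partitions m. pfun_scale (v \<nu>) (ind \<nu>)) \<in> span (ind ` partitions m)"
      by (intro span_sum span_scale span_base) auto
    ultimately show ?thesis by metis
  qed
  moreover have "card (ind ` partitions m) \<le> card (partitions m)" by (rule card_image_le[OF finite_partitions])
  ultimately show thesis using that[of "ind ` partitions m"] finite_partitions by blast
qed

text \<open>
  The characters are functions of the cycle type by Frobenius' formula. They are independent, and as many as there are partitions of \<open>m\<close>,
  while there are at most that many cycle types.
\<close>

theorem cycle_fun_expansion:
  assumes f: "cycle_fun m f"
  shows "f = (\<Sum>\<mu>\<in>partitions m. pfun_scale (scalar_prod m (simple_char \<mu>) f) (simple_char \<mu>))"
proof -
  interpret vector_space pfun_scale by (rule vector_space_pfun)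
  obtain T where T: "finite T" "card T \<le> card (partitions m)" "\<And>f. cycle_fun m f \<Longrightarrow> f \<in> span T"
    using cycle_fun_in_span by blast
  have "simple_char \<mu> \<in> span T" if "\<mu> \<in> partitions m" for \<mu>
    using T(3)[OF cycle_fun_rho] rho_frob_poly_own[OF that] by metis
  then obtain u where u: "f = (\<Sum>\<mu>\<in>partitions m. pfun_scale (u \<mu>) (simple_char \<mu>))"
    using independent_family_spans[OF finite_partitions simple_char_independent T(1) _ T(2) T(3)[OF f]] by blast
  have "scalar_prod m (simple_char \<mu>) f = u \<mu>" if "\<mu> \<in> partitions m" for \<mu>
    unfolding u by (rule scalar_prod_simple_char_combination[OF that])
  then show ?thesis using u by simp
qed

lemma class_fun_cycle_fun:
  assumes f: "cycle_fun m f" shows "class_fun m f"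
  unfolding class_fun_def
proof (intro ballI)
  fix g h assume g: "g \<in> perms m" and h: "h \<in> perms m"
  have e: "f k = (\<Sum>\<mu>\<in>partitions m. scalar_prod m (simple_char \<mu>) f * simple_char \<mu> k)" for k
    using fun_cong[OF cycle_fun_expansion[OF f], of k] by (simp only: sum_apply_fun pfun_scale_def)
  have "simple_char \<mu> (h \<circ> (g \<circ> inv h)) = simple_char \<mu> g" if "\<mu> \<in> partitions m" for \<mu>
    using class_fun_simple_char[OF that] g h unfolding class_fun_def by blast
  then show "f (h \<circ> (g \<circ> inv h)) = f g" unfolding e[of g] e[of "h \<circ> (g \<circ> inv h)"] by simp
qed

section \<open>Frobenius polynomials as a basis\<close>

definition qscale :: "rat \<Rightarrow> qpoly \<Rightarrow> qpoly" where
  "qscale c P = qconst c * P"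

lemma lookup_qscale: "Poly_Mapping.lookup (qscale c P) t = c * Poly_Mapping.lookup P t"
  unfolding qscale_def qconst_def mult_map_scale_conv_mult[symmetric]
  by (simp add: map.rep_eq when_def)

lemma vector_space_qpoly: "vector_space qscale"
  by unfold_locales (auto intro!: poly_mapping_eqI simp: lookup_qscale lookup_add algebra_simps)

lemma rho_add: "rho m (P + Q) = rho m P + rho m Q"
  by (auto simp: rho_perms qeval_add fun_eq_iff)

lemma rho_qscale: "rho m (qscale c P) = pfun_scale c (rho m P)"
  by (auto simp: rho_perms qscale_def qeval_mult pfun_scale_def fun_eq_iff)

lemma rho_0: "rho m 0 = 0"
  by (auto simp: rho_perms fun_eq_iff)

lemma rho_combination: "rho m (\<Sum>i\<in>I. qscale (u i) (P i)) = (\<Sum>i\<in>I. pfun_scale (u i) (rho m (P i)))"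
  by (induction I rule: infinite_finite_induct) (simp_all add: rho_0 rho_add rho_qscale)

lemma polys_weight_le_iff: "P \<in> polys_weight_le d \<longleftrightarrow> Poly_Mapping.keys P \<subseteq> light_exponents d"
  by (auto simp: polys_weight_le_def deg_w_def SUP_le_iff light_exponents_def)

lemma qscale_single: "qscale c (Poly_Mapping.single t 1) = Poly_Mapping.single t c"
  by (simp add: qscale_def qconst_def mult_single)

lemma polys_weight_le_span:
  assumes "P \<in> polys_weight_le d"
  shows "P \<in> module.span qscale ((\<lambda>t. Poly_Mapping.single t 1) ` light_exponents d)"
proof -
  interpret vector_space qscale by (rule vector_space_qpoly)
  have "(\<Sum>t\<in>Poly_Mapping.keys P. qscale (Poly_Mapping.lookup P t) (Poly_Mapping.single t 1)) \<in> span ((\<lambda>t. Poly_Mapping.single t 1) ` light_exponents d)"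
    using assms by (intro span_sum span_scale span_base) (auto simp: polys_weight_le_iff)
  then show ?thesis using poly_mapping_expansion[of P] by (simp add: qscale_single)
qed

lemma frob_poly_weight_le: "weight \<mu> \<le> d \<Longrightarrow> frob_poly \<mu> \<in> polys_weight_le d"
  using frob_poly_weight by (force simp: polys_weight_le_iff light_exponents_def)

lemma light_char_independent: "independent_family pfun_scale (light_partitions m d) simple_char"
  unfolding independent_family_def
proof (intro allI impI ballI)
  fix u \<mu> assume z: "(\<Sum>\<mu>\<in>light_partitions m d. pfun_scale (u \<mu>) (simple_char \<mu>)) = 0" and \<mu>: "\<mu> \<in> light_partitions m d"
  let ?u = "\<lambda>\<mu>. if weight \<mu> \<le> d then u \<mu> else 0"
  have "(\<Sum>\<mu>\<in>partitions m. pfun_scale (?u \<mu>) (simple_char \<mu>)) = (\<Sum>\<mu>\<in>light_partitions m d. pfun_scale (u \<mu>) (simple_char \<mu>))"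
    using finite_partitions
    by (intro sum.mono_neutral_cong_right) (auto simp: light_partitions_def pfun_scale_def fun_eq_iff)
  then have "?u \<mu> = 0"
    using z \<mu> independent_familyD[OF simple_char_independent[of m], of ?u \<mu>] by (simp add: light_partitions_def)
  then show "u \<mu> = 0" using \<mu> by (simp add: light_partitions_def)
qed

text \<open>
  The Frobenius polynomials of weight at most \<open>d\<close> are independent because their images are,
  and there are as many of them as monomials of weight at most \<open>d\<close>.
\<close>

theorem polys_weight_le_frob_basis:
  assumes P: "P \<in> polys_weight_le d" and m: "2 * d \<le> m"
  obtains u where "P = (\<Sum>\<mu>\<in>light_partitions m d. qscale (u \<mu>) (frob_poly \<mu>))"
proof -
  interpret vector_space qscale by (rule vector_space_qpoly)
  let ?T = "(\<lambda>t. Poly_Mapping.single t (1::rat)) ` light_exponents d"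
  have indep: "independent_family qscale (light_partitions m d) frob_poly"
    unfolding independent_family_def
  proof (intro allI impI)
    fix u assume z: "(\<Sum>\<mu>\<in>light_partitions m d. qscale (u \<mu>) (frob_poly \<mu>)) = 0"
    have "(\<Sum>\<mu>\<in>light_partitions m d. pfun_scale (u \<mu>) (simple_char \<mu>)) = rho m (\<Sum>\<mu>\<in>light_partitions m d. qscale (u \<mu>) (frob_poly \<mu>))"
      unfolding rho_combination by (intro sum.cong refl) (auto simp: light_partitions_def rho_frob_poly_own)
    then have "(\<Sum>\<mu>\<in>light_partitions m d. pfun_scale (u \<mu>) (simple_char \<mu>)) = 0" using z by (simp add: rho_0)
    then show "\<forall>\<mu>\<in>light_partitions m d. u \<mu> = 0"
      using light_char_independent[of m d] unfolding independent_family_def by blast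
  qed
  have "card ?T \<le> card (light_exponents d)" by (rule card_image_le) simp
  also have "\<dots> \<le> card (light_partitions m d)" using m by (rule card_light_exponents_le)
  finally have card: "card ?T \<le> card (light_partitions m d)" .
  have "frob_poly \<mu> \<in> span ?T" if "\<mu> \<in> light_partitions m d" for \<mu>
    using that by (intro polys_weight_le_span frob_poly_weight_le) (simp add: light_partitions_def)
  then show thesis
    using independent_family_spans[OF _ indep _ _ card polys_weight_le_span[OF P]] that by auto
qed

section \<open>Scalar products with polynomials\<close>

lemma permuted_staircase_tail:
  assumes w: "w permutes {..<l}" and l: "1 \<le> l"
  shows "(\<Sum>j=1..<l. staircase l j) \<le> (\<Sum>j=1..<l. staircase l (w j))"
proof -
  have split: "(\<Sum>j<l. f j) = f 0 + (\<Sum>j=1..<l. f j)" for f :: "nat \<Rightarrow> int"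
    using sum.atLeast_Suc_lessThan[of 0 l f] l by (simp add: lessThan_atLeast0)
  have "(\<Sum>j<l. staircase l (w j)) = (\<Sum>j<l. staircase l j)"
    using sum.permute[OF w, of "staircase l"] by (simp add: o_def)
  moreover have "staircase l (w 0) \<le> staircase l 0" by (simp add: staircase_def)
  ultimately show ?thesis unfolding split by simp
qed

lemma sum_part_tail: "(\<Sum>j=1..<length \<mu>. part \<mu> j) = int (weight \<mu>)"
  unfolding sum_nth_tl[symmetric] of_nat_sum by (intro sum.cong) (auto simp: part_def)

text \<open>The prescribed colours \<open>1, \<dots>, l - 1\<close> occupy at most \<open>weight \<mu>\<close> letters in total.\<close>

lemma prescribed_colours_sum:
  assumes w: "w permutes {..<length \<mu>}" and ne: "\<mu> \<noteq> []"
    and c: "\<And>j. j \<in> {1..<length \<mu>} \<Longrightarrow> staircase (length \<mu>) (w j) + c j = frob_exponent \<mu> j"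
  shows "(\<Sum>j=1..<length \<mu>. c j) \<le> int (weight \<mu>)"
proof -
  let ?l = "length \<mu>"
  have "c j = part \<mu> j + staircase ?l j - staircase ?l (w j)" if "j \<in> {1..<?l}" for j
    using c[OF that] by (simp add: frob_exponent_def)
  then have "(\<Sum>j=1..<?l. c j) = int (weight \<mu>) + ((\<Sum>j=1..<?l. staircase ?l j) - (\<Sum>j=1..<?l. staircase ?l (w j)))"
    by (simp add: sum.distrib sum_subtractf sum_part_tail[symmetric])
  moreover have "1 \<le> ?l" using ne by (cases \<mu>) auto
  ultimately show ?thesis using permuted_staircase_tail[OF w] by simp
qed

text \<open>
  The prescribed multiplicities determine the multiplicity of colour 0, which is nonnegative since the other ones take up at most
  \<open>weight \<mu> \<le> m\<close> letters. So there is one solution or none, independently of \<open>m\<close>.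
\<close>

lemma sum_colour_counts_prescribed:
  assumes w: "w permutes {..<length \<mu>}" and ne: "\<mu> \<noteq> []" and m: "weight \<mu> \<le> m"
  shows "(\<Sum>M\<in>colour_counts m {..<length \<mu>}.
      if \<forall>j\<in>{1..<length \<mu>}. staircase (length \<mu>) (w j) + int (M j) = frob_exponent \<mu> j then c else (0::rat))
    = (if \<forall>j\<in>{1..<length \<mu>}. staircase (length \<mu>) (w j) \<le> frob_exponent \<mu> j then c else 0)"
    (is "(\<Sum>M\<in>?CC. if ?P M then c else 0) = (if ?Q then c else 0)")
proof (cases ?Q)
  case False
  then have nP: "\<not> ?P M" for M by (metis le_add_same_cancel1 of_nat_0_le_iff)
  show ?thesis by (simp only: if_not_P[OF nP] if_not_P[OF False] sum.neutral_const)
next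
  case True
  let ?l = "length \<mu>"
  have l: "1 \<le> ?l" using ne by (cases \<mu>) auto
  have split: "(\<Sum>j<?l. f j) = f 0 + (\<Sum>j=1..<?l. f j)" for f :: "nat \<Rightarrow> nat"
    using sum.atLeast_Suc_lessThan[of 0 ?l f] ne by (simp add: lessThan_atLeast0)
  define K where "K j = nat (frob_exponent \<mu> j - staircase ?l (w j))" for j
  define M0 where "M0 j = (if j = 0 then m - (\<Sum>j=1..<?l. K j) else if j < ?l then K j else 0)" for j
  have K: "staircase ?l (w j) + int (K j) = frob_exponent \<mu> j" if "j \<in> {1..<?l}" for j
    using True that by (simp add: K_def)
  have "(\<Sum>j=1..<?l. int (K j)) \<le> int (weight \<mu>)" using prescribed_colours_sum[OF w ne, of "\<lambda>j. int (K j)"] K by simp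
  then have "(\<Sum>j=1..<?l. K j) \<le> weight \<mu>" by (simp flip: of_nat_sum)
  then have Km: "(\<Sum>j=1..<?l. K j) \<le> m" using m by simp
  have "(\<Sum>j=1..<?l. M0 j) = (\<Sum>j=1..<?l. K j)" by (intro sum.cong) (auto simp: M0_def)
  then have M0: "M0 \<in> ?CC" using Km l unfolding colour_counts_def split by (auto simp: M0_def)
  have "?P M \<longleftrightarrow> M = M0" if M: "M \<in> ?CC" for M
  proof
    assume P: "?P M"
    have MK: "M j = K j" if "j \<in> {1..<?l}" for j using P K[OF that] that by (metis add_left_cancel of_nat_eq_iff)
    then have "(\<Sum>j=1..<?l. M j) = (\<Sum>j=1..<?l. K j)" by (intro sum.cong) auto
    moreover have "M 0 + (\<Sum>j=1..<?l. M j) = m" using M unfolding colour_counts_def split by simp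
    ultimately have "M 0 = M0 0" by (simp add: M0_def)
    moreover have "M j = M0 j" if "j \<noteq> 0" for j
      using MK[of j] M that by (cases "j < ?l") (auto simp: M0_def colour_counts_def)
    ultimately show "M = M0" by (metis ext)
  next
    assume "M = M0"
    then show "?P M" using K by (simp add: M0_def)
  qed
  then have "(\<Sum>M\<in>?CC. if ?P M then c else 0) = (\<Sum>M\<in>?CC. if M = M0 then c else 0)" by (intro sum.cong) auto
  also have "\<dots> = c" using M0 by simp
  finally show ?thesis using True by simp
qed

lemma scalar_prod_one_frob_poly:
  assumes ne: "\<mu> \<noteq> []" and m: "weight \<mu> \<le> m"
  shows "scalar_prod m (rho m 1) (rho m (frob_poly \<mu>)) = (\<Sum>w | w permutes {..<length \<mu>}.
      if \<forall>j\<in>{1..<length \<mu>}. staircase (length \<mu>) (w j) \<le> frob_exponent \<mu> j then of_int (sign w) else 0)"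
proof -
  let ?l = "length \<mu>"
  let ?\<phi> = "\<lambda>w M. if \<forall>j\<in>{1..<?l}. staircase ?l (w j) + int (M j) = frob_exponent \<mu> j then of_int (sign w) else (0::rat)"
  have "(\<Sum>g\<in>perms m. rho m (frob_poly \<mu>) (inv g)) = (\<Sum>g\<in>perms m. rho m (frob_poly \<mu>) g)" by (rule sum_sym_inv)
  also have "\<dots> = (\<Sum>g\<in>perms m. \<Sum>w | w permutes {..<?l}. \<Sum>F | F \<in> colourings m {..<?l} \<and> g \<in> stab m F. ?\<phi> w (colour_count m F))"
    using ne by (intro sum.cong refl) (simp add: rho_frob_poly icontent_def)
  also have "\<dots> = (\<Sum>w | w permutes {..<?l}. \<Sum>g\<in>perms m. 1 * (\<Sum>F | F \<in> colourings m {..<?l} \<and> g \<in> stab m F. ?\<phi> w (colour_count m F)))"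
    by (subst sum.swap) simp
  also have "\<dots> = (\<Sum>w | w permutes {..<?l}. \<Sum>F\<in>colourings m {..<?l}. of_nat (card (stab m F)) * ?\<phi> w (colour_count m F))"
  proof (rule sum.cong[OF refl])
    fix w
    show "(\<Sum>g\<in>perms m. 1 * (\<Sum>F | F \<in> colourings m {..<?l} \<and> g \<in> stab m F. ?\<phi> w (colour_count m F)))
      = (\<Sum>F\<in>colourings m {..<?l}. of_nat (card (stab m F)) * ?\<phi> w (colour_count m F))"
      using sum_perms_colourings[of "{..<?l}" "\<lambda>_. 1" "\<lambda>F. ?\<phi> w (colour_count m F)" m] by (simp add: mult.commute)
  qed
  also have "\<dots> = (\<Sum>w | w permutes {..<?l}. fact m * (\<Sum>M\<in>colour_counts m {..<?l}. ?\<phi> w M))"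
    by (intro sum.cong refl sum_colourings_stab) simp
  also have "\<dots> = fact m * (\<Sum>w | w permutes {..<?l}. if \<forall>j\<in>{1..<?l}. staircase ?l (w j) \<le> frob_exponent \<mu> j then of_int (sign w) else 0)"
    unfolding sum_distrib_left[symmetric]
    by (intro arg_cong[where f = "\<lambda>x. fact m * x"] sum.cong refl sum_colour_counts_prescribed ne m) simp
  finally have "(\<Sum>g\<in>perms m. rho m (frob_poly \<mu>) (inv g))
    = fact m * (\<Sum>w | w permutes {..<?l}. if \<forall>j\<in>{1..<?l}. staircase ?l (w j) \<le> frob_exponent \<mu> j then of_int (sign w) else 0)" .
  moreover have "(\<Sum>g\<in>perms m. rho m 1 g * rho m (frob_poly \<mu>) (inv g)) = (\<Sum>g\<in>perms m. rho m (frob_poly \<mu>) (inv g))"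
    by (intro sum.cong) (auto simp: rho_perms[of m 1])
  ultimately show ?thesis by (simp add: scalar_prod_perms)
qed

theorem scalar_prod_one_constant:
  assumes P: "P \<in> polys_weight_le d" and m: "d \<le> m" "d \<le> m'"
  shows "scalar_prod m (rho m 1) (rho m P) = scalar_prod m' (rho m' 1) (rho m' P)"
proof -
  let ?L = "light_partitions (2 * d + 1) d"
  obtain u where u: "P = (\<Sum>\<mu>\<in>?L. qscale (u \<mu>) (frob_poly \<mu>))"
    using polys_weight_le_frob_basis[OF P, of "2 * d + 1"] by auto
  have "scalar_prod m (rho m 1) (rho m (frob_poly \<mu>)) = scalar_prod m' (rho m' 1) (rho m' (frob_poly \<mu>))" if "\<mu> \<in> ?L" for \<mu>
  proof -
    have "\<mu> \<noteq> []" "weight \<mu> \<le> d" using that by (auto simp: light_partitions_def partitions_def)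
    then show ?thesis using m by (simp add: scalar_prod_one_frob_poly)
  qed
  then show ?thesis unfolding u rho_combination scalar_prod_sum_right by simp
qed

text \<open>
  In the colourings counted by \<open>frob_poly \<mu>\<close> at least \<open>m - weight \<mu>\<close> letters have colour 0. This exceeds the first row of \<open>\<nu>\<close>, so two of
  them share a column and the stabilizer sum of the Young symmetrizer vanishes.
\<close>

lemma scalar_prod_heavy_frob_poly:
  assumes \<nu>: "\<nu> \<in> partitions m" and ne: "\<mu> \<noteq> []" and w: "weight \<mu> < weight \<nu>"
  shows "scalar_prod m (simple_char \<nu>) (rho m (frob_poly \<mu>)) = 0"
proof -
  interpret tableau m "row_of \<nu>" "col_of \<nu>" by (rule tableau_partition[OF \<nu>])
  let ?l = "length \<mu>"
  let ?\<phi> = "\<lambda>w F. if \<forall>j\<in>{1..<?l}. staircase ?l (w j) + icontent m F j = frob_exponent \<mu> j then of_int (sign w) else (0::rat)"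
  have zero: "?\<phi> w F * (\<Sum>g\<in>stab m F. symmetrizer g) = 0" if w': "w permutes {..<?l}" and F: "F \<in> colourings m {..<?l}" for w F
  proof (rule ccontr)
    assume nz: "?\<phi> w F * (\<Sum>g\<in>stab m F. symmetrizer g) \<noteq> 0"
    then have ci: "column_inj F" using sum_stab_not_column_inj by auto
    have l: "1 \<le> ?l" using ne by (cases \<mu>) auto
    have "(\<Sum>j=1..<?l. icontent m F j) \<le> int (weight \<mu>)"
      using nz by (intro prescribed_colours_sum[OF w' ne]) (auto split: if_splits)
    moreover have "(\<Sum>j<?l. icontent m F j) = icontent m F 0 + (\<Sum>j=1..<?l. icontent m F j)"
      using sum.atLeast_Suc_lessThan[of 0 ?l "icontent m F"] ne by (simp add: lessThan_atLeast0)
    ultimately have "int m \<le> int (colour_count m F 0) + int (weight \<mu>)"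
      using sum_icontent_colouring[OF F] by (simp add: icontent_def)
    moreover have "colour_count m F 0 \<le> card {x \<in> letters m. row_of \<nu> x < 1}"
      using column_inj_dominance[OF ci, of "{0}"] by (simp add: colour_count_def)
    moreover have "card {x \<in> letters m. row_of \<nu> x < 1} + weight \<nu> = m"
      using card_row_of_less[OF sum_list_partition[OF \<nu>], of 1] sum_list_partition[OF \<nu>] w
      by (cases \<nu>) (auto simp: weight_def)
    ultimately show False using w by linarith
  qed
  have "(\<Sum>g\<in>perms m. symmetrizer g * rho m (frob_poly \<mu>) g)
     = (\<Sum>g\<in>perms m. \<Sum>w | w permutes {..<?l}. symmetrizer g * (\<Sum>F | F \<in> colourings m {..<?l} \<and> g \<in> stab m F. ?\<phi> w F))"
    using ne by (intro sum.cong refl) (simp add: rho_frob_poly sum_distrib_left)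
  also have "\<dots> = (\<Sum>w | w permutes {..<?l}. \<Sum>g\<in>perms m. symmetrizer g * (\<Sum>F | F \<in> colourings m {..<?l} \<and> g \<in> stab m F. ?\<phi> w F))"
    by (rule sum.swap)
  also have "\<dots> = (\<Sum>w | w permutes {..<?l}. \<Sum>F\<in>colourings m {..<?l}. ?\<phi> w F * (\<Sum>g\<in>stab m F. symmetrizer g))"
    by (intro sum.cong refl sum_perms_colourings) simp
  also have "\<dots> = 0" using zero by (intro sum.neutral ballI) blast
  finally show ?thesis
    using scalar_prod_simple_char[OF \<nu> class_fun_cycle_fun[OF cycle_fun_rho]] young_symmetrizer_eq[OF \<nu>] by simp
qed

theorem scalar_prod_heavy:
  assumes P: "P \<in> polys_weight_le d" and \<nu>: "\<nu> \<in> partitions m" and w: "d < weight \<nu>"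
  shows "scalar_prod m (simple_char \<nu>) (rho m P) = 0"
proof -
  let ?L = "light_partitions (2 * d + 1) d"
  obtain u where u: "P = (\<Sum>\<mu>\<in>?L. qscale (u \<mu>) (frob_poly \<mu>))"
    using polys_weight_le_frob_basis[OF P, of "2 * d + 1"] by auto
  have "scalar_prod m (simple_char \<nu>) (rho m (frob_poly \<mu>)) = 0" if "\<mu> \<in> ?L" for \<mu>
  proof (rule scalar_prod_heavy_frob_poly[OF \<nu>])
    show "\<mu> \<noteq> []" "weight \<mu> < weight \<nu>" using that w by (auto simp: light_partitions_def partitions_def)
  qed
  then show ?thesis unfolding u rho_combination scalar_prod_sum_right by simp
qed

section \<open>Image and kernel\<close>

theorem rho_image:
  "rho m ` polys_weight_le d = module.span pfun_scale {simple_char \<mu> | \<mu>. \<mu> \<in> partitions m \<and> weight \<mu> \<le> d}"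
proof -
  interpret vector_space pfun_scale by (rule vector_space_pfun)
  let ?X = "{simple_char \<mu> | \<mu>. \<mu> \<in> partitions m \<and> weight \<mu> \<le> d}"
  show ?thesis
  proof (intro subset_antisym subsetI)
    fix f assume "f \<in> rho m ` polys_weight_le d"
    then obtain P where P: "P \<in> polys_weight_le d" "f = rho m P" by auto
    have "pfun_scale (scalar_prod m (simple_char \<mu>) f) (simple_char \<mu>) \<in> span ?X" if \<mu>: "\<mu> \<in> partitions m" for \<mu>
    proof (cases "weight \<mu> \<le> d")
      case True
      then show ?thesis using \<mu> by (intro span_scale span_base) auto
    next
      case False
      then have "scalar_prod m (simple_char \<mu>) f = 0" using scalar_prod_heavy[OF P(1) \<mu>] P(2) by simp
      then show ?thesis using span_zero by simp
    qed
    then have "(\<Sum>\<mu>\<in>partitions m. pfun_scale (scalar_prod m (simple_char \<mu>) f) (simple_char \<mu>)) \<in> span ?X"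
      by (rule span_sum)
    then show "f \<in> span ?X" using cycle_fun_expansion[OF cycle_fun_rho, of m P] P(2) by simp
  next
    fix f assume f: "f \<in> span ?X"
    have "subspace (rho m ` polys_weight_le d)"
    proof (rule subspaceI)
      show "0 \<in> rho m ` polys_weight_le d"
        by (rule image_eqI[of _ _ 0]) (auto simp: rho_0 polys_weight_le_iff)
      fix x y assume "x \<in> rho m ` polys_weight_le d" "y \<in> rho m ` polys_weight_le d"
      then obtain P Q where "x = rho m P" "y = rho m Q" "P \<in> polys_weight_le d" "Q \<in> polys_weight_le d" by auto
      then show "x + y \<in> rho m ` polys_weight_le d"
        using keys_add[of P Q] by (intro image_eqI[of _ _ "P + Q"]) (auto simp: rho_add polys_weight_le_iff)
    next
      fix c x assume "x \<in> rho m ` polys_weight_le d"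
      then obtain P where "x = rho m P" "P \<in> polys_weight_le d" by auto
      then show "pfun_scale c x \<in> rho m ` polys_weight_le d"
        by (intro image_eqI[of _ _ "qscale c P"]) (auto simp: rho_qscale polys_weight_le_iff in_keys_iff lookup_qscale subset_iff)
    qed
    moreover have "?X \<subseteq> rho m ` polys_weight_le d"
      using frob_poly_weight_le rho_frob_poly_own by (force simp: image_iff)
    ultimately show "f \<in> rho m ` polys_weight_le d" using span_minimal f by blast
  qed
qed

theorem rho_kernel_trivial:
  assumes P: "P \<in> polys_weight_le d" and z: "rho m P = 0" and m: "2 * d \<le> m"
  shows "P = 0"
proof -
  obtain u where u: "P = (\<Sum>\<mu>\<in>light_partitions m d. qscale (u \<mu>) (frob_poly \<mu>))"
    using polys_weight_le_frob_basis[OF P m] .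
  have "(\<Sum>\<mu>\<in>light_partitions m d. pfun_scale (u \<mu>) (simple_char \<mu>)) = rho m P"
    unfolding u rho_combination by (intro sum.cong refl) (auto simp: light_partitions_def rho_frob_poly_own)
  then have "u \<mu> = 0" if "\<mu> \<in> light_partitions m d" for \<mu>
    using light_char_independent[of m d] z that unfolding independent_family_def by auto
  then show ?thesis unfolding u by (intro sum.neutral) (simp add: qscale_def qconst_def)
qed

text \<open>
  The images of the monomials lie in the span of fewer characters than there are monomials.
\<close>

theorem rho_kernel_nontrivial:
  assumes m: "m < 2 * d"
  obtains P where "P \<in> polys_weight_le d" "rho m P = 0" "P \<noteq> 0"
proof -
  interpret vector_space pfun_scale by (rule vector_space_pfun)
  let ?mon = "\<lambda>t. Poly_Mapping.single t (1::rat)"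
  let ?T = "simple_char ` light_partitions m d"
  have span: "rho m (?mon t) \<in> span ?T" if "t \<in> light_exponents d" for t
  proof -
    have "rho m (?mon t) \<in> rho m ` polys_weight_le d" using that by (auto simp: polys_weight_le_iff)
    moreover have "{simple_char \<mu> | \<mu>. \<mu> \<in> partitions m \<and> weight \<mu> \<le> d} = ?T" by (auto simp: light_partitions_def)
    ultimately show ?thesis using rho_image[of m d] by simp
  qed
  have "card ?T \<le> card (light_partitions m d)" by (rule card_image_le) simp
  then have "\<not> card (light_exponents d) \<le> card ?T" using card_light_partitions_less[OF m] by simp
  then have "\<not> independent_family pfun_scale (light_exponents d) (\<lambda>t. rho m (?mon t))"
    using independent_family_card[of "light_exponents d" "\<lambda>t. rho m (?mon t)" ?T] span by auto
  then obtain u t where u: "(\<Sum>t\<in>light_exponents d. pfun_scale (u t) (rho m (?mon t))) = 0" "t \<in> light_exponents d" "u t \<noteq> 0"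
    unfolding independent_family_def by blast
  let ?P = "\<Sum>t\<in>light_exponents d. qscale (u t) (?mon t)"
  have lk: "Poly_Mapping.lookup ?P s = (if s \<in> light_exponents d then u s else 0)" for s
    by (simp add: lookup_sum qscale_single lookup_single when_def)
  have "?P \<noteq> 0" using lk[of t] u(2,3) by auto
  moreover have "rho m ?P = 0" unfolding rho_combination using u(1) .
  moreover have "?P \<in> polys_weight_le d" using lk by (auto simp: polys_weight_le_iff in_keys_iff split: if_splits)
  ultimately show thesis using that by blast
qed

section \<open>The unit of the group algebra\<close>

lemma delta_id_cycle_fun: "cycle_fun m (delta id)"
proof -
  have "g = id" if g: "g \<in> perms m" and eq: "cycle_type m g = cycle_type m id" for g
  proof -
    let ?S = "{x \<in> letters m. g x = x}"
    have sub: "{C \<in> orbit g ` letters m. card C = 1} \<subseteq> (\<lambda>x. {x}) ` ?S" 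
    proof
      fix C assume "C \<in> {C \<in> orbit g ` letters m. card C = 1}"
      then obtain x where x: "x \<in> letters m" "C = orbit g x" "card C = 1" by auto
      then have "C = {x}" using perms_orbit(1)[OF g x(1)] by (metis card_1_singletonE singletonD)
      moreover have "g x \<in> C" unfolding x(2) by (rule orbit.base)
      ultimately show "C \<in> (\<lambda>x. {x}) ` ?S" using x(1) by auto
    qed
    have "orbit id ` letters m = (\<lambda>x. {x}) ` letters m"
      by (intro image_cong refl) (simp add: orbit_eq_singleton_iff)
    then have "{C \<in> orbit id ` letters m. card C = 1} = (\<lambda>x. {x}) ` letters m" by auto
    then have "cycle_count m 1 id = m" unfolding cycle_count_eq by (simp add: card_image)
    then have "cycle_count m 1 g = m"
      using fun_cong[OF eq, of 1] by (simp add: cycle_type_def)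
    then have "m \<le> card ((\<lambda>x. {x}) ` ?S)"
      unfolding cycle_count_eq using card_mono[OF _ sub] by simp
    also have "\<dots> = card ?S" by (rule card_image) simp
    finally have "?S = letters m" by (intro card_seteq) auto
    then have "g x = x" for x
      using g permutes_not_in[of g "letters m" x] by (cases "x \<in> letters m") (auto simp: perms_def)
    then show "g = id" by auto
  qed
  then show ?thesis by (auto simp: cycle_fun_def group_algebra_eq delta_def)
qed

lemma conv_delta_right:
  assumes k: "k \<in> perms m" and x: "x \<in> group_algebra m"
  shows "conv m x (delta k) = (\<lambda>g. x (g \<circ> inv k))"
proof
  fix g
  show "conv m x (delta k) g = x (g \<circ> inv k)"
  proof (cases "g \<in> perms m")
    case g: True
    have iff: "inv h \<circ> g = k \<longleftrightarrow> h = g \<circ> inv k" if h: "h \<in> perms m" for h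
    proof
      assume "inv h \<circ> g = k"
      then have "h \<circ> (inv h \<circ> g) = h \<circ> k" by simp
      then have "g = h \<circ> k" using h by simp
      then show "h = g \<circ> inv k" using k by simp
    next
      assume e: "h = g \<circ> inv k"
      have "inv h = k \<circ> inv g" unfolding e using sym_inv_distrib[OF g sym_inv[OF k]] k by simp
      then show "inv h \<circ> g = k" using g by (simp add: comp_assoc)
    qed
    have "conv m x (delta k) g = (\<Sum>h\<in>perms m. if h = g \<circ> inv k then x h else 0)"
      unfolding conv_eq delta_def by (intro sum.cong refl) (auto simp: iff)
    also have "\<dots> = x (g \<circ> inv k)" using g k by simp
    finally show ?thesis .
  next
    case False
    then have "g \<circ> inv k \<notin> perms m" using sym_comp_cancel(2)[OF sym_inv[OF k], of g] by simp
    moreover have "inv h \<circ> g \<noteq> k" if h: "h \<in> perms m" for h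
    proof
      assume "inv h \<circ> g = k"
      then have "inv h \<circ> g \<in> perms m" using k by simp
      then show False using False sym_comp_cancel(1)[OF sym_inv[OF h], of g] by simp
    qed
    ultimately show ?thesis using x by (simp add: conv_eq delta_def group_algebra_eq)
  qed
qed

text \<open>
  Expanding the indicator of the identity in characters writes the unit as a combination of conjugates of Young symmetrizers.
\<close>

lemma unit_decomposition:
  obtains \<beta> where "delta id = (\<Sum>\<mu>\<in>partitions m. \<Sum>h\<in>perms m.
    pfun_scale (\<beta> \<mu>) (conv m (delta h) (conv m (young_symmetrizer \<mu>) (delta (inv h)))))"
proof -
  let ?a = "\<lambda>\<mu>. scalar_prod m (simple_char \<mu>) (delta id)"
  let ?x = "\<lambda>\<mu> h. conv m (delta h) (conv m (young_symmetrizer \<mu>) (delta (inv h)))"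
  have chi: "simple_char \<mu> = (\<Sum>h\<in>perms m. pfun_scale (1 / hook_const \<mu>) (?x \<mu> h))" if \<mu>: "\<mu> \<in> partitions m" for \<mu>
  proof
    fix g
    have c: "young_symmetrizer \<mu> \<in> group_algebra m" by (rule young_symmetrizer_group_algebra[OF \<mu>])
    have x: "?x \<mu> h k = young_symmetrizer \<mu> (inv h \<circ> (k \<circ> h))" if h: "h \<in> perms m" for h k
      using h by (simp add: conv_delta_left conv_delta_right[OF _ c] comp_assoc)
    show "simple_char \<mu> g = (\<Sum>h\<in>perms m. pfun_scale (1 / hook_const \<mu>) (?x \<mu> h)) g"
    proof (cases "g \<in> perms m")
      case g: True
      have "simple_char \<mu> g = simple_char \<mu> (inv g)" using simple_char_inv[OF \<mu> g] by simp
      also have "\<dots> = (\<Sum>h\<in>perms m. young_symmetrizer \<mu> (inv h \<circ> (g \<circ> h))) / hook_const \<mu>"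
        using simple_char_formula[OF \<mu> sym_inv[OF g]] g by simp
      finally show ?thesis by (simp add: sum_apply_fun pfun_scale_def x sum_divide_distrib)
    next
      case False
      have "inv h \<circ> (g \<circ> h) \<notin> perms m" if h: "h \<in> perms m" for h
        using False sym_comp_cancel(1)[OF sym_inv[OF h], of "g \<circ> h"] sym_comp_cancel(2)[OF h, of g] by simp
      then have "young_symmetrizer \<mu> (inv h \<circ> (g \<circ> h)) = 0" if h: "h \<in> perms m" for h
        using c h by (simp add: group_algebra_eq)
      then show ?thesis
        using simple_char_outside[OF False sum_list_partition[OF \<mu>]] by (simp add: sum_apply_fun pfun_scale_def x)
    qed
  qed
  have "delta id = (\<Sum>\<mu>\<in>partitions m. pfun_scale (?a \<mu>) (simple_char \<mu>))"
    by (rule cycle_fun_expansion[OF delta_id_cycle_fun])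
  also have "\<dots> = (\<Sum>\<mu>\<in>partitions m. \<Sum>h\<in>perms m. pfun_scale (?a \<mu> / hook_const \<mu>) (?x \<mu> h))"
  proof (rule sum.cong[OF refl])
    fix \<mu> assume \<mu>: "\<mu> \<in> partitions m"
    show "pfun_scale (?a \<mu>) (simple_char \<mu>) = (\<Sum>h\<in>perms m. pfun_scale (?a \<mu> / hook_const \<mu>) (?x \<mu> h))"
      by (subst chi[OF \<mu>]) (auto simp: fun_eq_iff pfun_scale_def sum_apply_fun sum_distrib_left)
  qed
  finally show thesis using that[of "\<lambda>\<mu>. ?a \<mu> / hook_const \<mu>"] by blast
qed

lemma conv_pfun_scale_right: "conv m x (pfun_scale c y) = pfun_scale c (conv m x y)"
  by (simp add: pfun_scale_def conv_scale_right)

lemma conv_sum_left: "conv m (\<Sum>i\<in>I. f i) y = (\<Sum>i\<in>I. conv m (f i) y)"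
proof (induction I rule: infinite_finite_induct)
  case (insert i I)
  then show ?case by (simp only: sum.insert[OF insert(1,2)] conv_add_left insert(3))
qed (auto simp: conv_eq fun_eq_iff)

section \<open>Decomposition of representations\<close>

locale representation =
  fixes m :: nat and W :: "'v::ab_group_add rep"
  assumes rep: "is_rep m W"
begin

abbreviation sc :: "rat \<Rightarrow> 'v \<Rightarrow> 'v" where "sc \<equiv> rep_scale W"

sublocale vector_space sc using rep by (simp add: is_rep_def)

abbreviation V :: "'v set" where "V \<equiv> rep_space W"

lemma finite_generators: obtains B where "finite B" "span B = V"
  using rep by (auto simp: is_rep_def)

lemma subspace_V: "subspace V"
  using finite_generators by (metis subspace_span)

lemma rho_in: "g \<in> perms m \<Longrightarrow> v \<in> V \<Longrightarrow> rep_act W g v \<in> V"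
  and rho_add: "g \<in> perms m \<Longrightarrow> v \<in> V \<Longrightarrow> w \<in> V \<Longrightarrow> rep_act W g (v + w) = rep_act W g v + rep_act W g w"
  and rho_scale: "g \<in> perms m \<Longrightarrow> v \<in> V \<Longrightarrow> rep_act W g (sc c v) = sc c (rep_act W g v)"
  and rho_id: "v \<in> V \<Longrightarrow> rep_act W id v = v"
  and rho_comp: "g \<in> perms m \<Longrightarrow> h \<in> perms m \<Longrightarrow> v \<in> V \<Longrightarrow> rep_act W (g \<circ> h) v = rep_act W g (rep_act W h v)"
  using rep unfolding is_rep_def sym_perms by blast+

definition act :: "pfun \<Rightarrow> 'v \<Rightarrow> 'v" where
  "act x v = (\<Sum>g\<in>perms m. sc (x g) (rep_act W g v))"

lemma act_in: "v \<in> V \<Longrightarrow> act x v \<in> V"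
  unfolding act_def by (intro subspace_sum[OF subspace_V] subspace_scale[OF subspace_V] rho_in)

lemma act_add_left: "act (x + y) v = act x v + act y v"
  by (simp add: act_def scale_left_distrib sum.distrib)

lemma act_scale_left: "act (pfun_scale c x) v = sc c (act x v)"
  by (simp add: act_def pfun_scale_def scale_sum_right)

lemma act_0_left: "act 0 v = 0"
  by (simp add: act_def)

lemma act_sum_left: "act (\<Sum>i\<in>I. f i) v = (\<Sum>i\<in>I. act (f i) v)"
proof (induction I rule: infinite_finite_induct)
  case (insert i I)
  then show ?case by (simp only: sum.insert[OF insert(1,2)] act_add_left insert(3))
qed (simp_all only: sum.infinite sum.empty act_0_left not_False_eq_True)

lemma act_add_right: "v \<in> V \<Longrightarrow> w \<in> V \<Longrightarrow> act x (v + w) = act x v + act x w"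
  by (simp add: act_def rho_add scale_right_distrib sum.distrib)

lemma act_scale_right: "v \<in> V \<Longrightarrow> act x (sc c v) = sc c (act x v)"
  by (simp add: act_def rho_scale scale_sum_right mult.commute)

lemma act_sum_right: "finite I \<Longrightarrow> (\<And>i. i \<in> I \<Longrightarrow> f i \<in> V) \<Longrightarrow> act x (\<Sum>i\<in>I. f i) = (\<Sum>i\<in>I. act x (f i))"
  by (rule linear_on_sum[OF subspace_V act_add_right])

lemma act_delta:
  assumes "g \<in> perms m" shows "act (delta g) v = rep_act W g v"
proof -
  have "act (delta g) v = (\<Sum>h\<in>perms m. if h = g then rep_act W h v else 0)"
    unfolding act_def delta_def by (intro sum.cong refl) simp
  then show ?thesis using assms by simp
qed

lemma act_conv:
  assumes v: "v \<in> V" shows "act (conv m x y) v = act x (act y v)"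
proof -
  have "act x (act y v) = (\<Sum>g\<in>perms m. sc (x g) (\<Sum>h\<in>perms m. sc (y h) (rep_act W (g \<circ> h) v)))"
    unfolding act_def[of x]
  proof (intro sum.cong refl arg_cong[where f = "sc _"])
    fix g assume g: "g \<in> perms m"
    have "rep_act W g (\<Sum>h\<in>perms m. sc (y h) (rep_act W h v)) = (\<Sum>h\<in>perms m. rep_act W g (sc (y h) (rep_act W h v)))"
      by (rule linear_on_sum[OF subspace_V rho_add[OF g]]) (auto intro: subspace_scale[OF subspace_V] rho_in v)
    also have "\<dots> = (\<Sum>h\<in>perms m. sc (y h) (rep_act W (g \<circ> h) v))"
      using g v by (intro sum.cong refl) (simp add: rho_scale rho_in rho_comp)
    finally show "rep_act W g (act y v) = (\<Sum>h\<in>perms m. sc (y h) (rep_act W (g \<circ> h) v))" by (simp only: act_def)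
  qed
  also have "\<dots> = (\<Sum>g\<in>perms m. \<Sum>k\<in>perms m. sc (x g * y (inv g \<circ> k)) (rep_act W k v))"
  proof (rule sum.cong[OF refl])
    fix g assume g: "g \<in> perms m"
    have "(\<Sum>k\<in>perms m. sc (x g * y (inv g \<circ> k)) (rep_act W k v)) = (\<Sum>h\<in>perms m. sc (x g * y (inv g \<circ> (g \<circ> h))) (rep_act W (g \<circ> h) v))"
      by (rule sum_sym_left[OF g, symmetric])
    then show "sc (x g) (\<Sum>h\<in>perms m. sc (y h) (rep_act W (g \<circ> h) v)) = (\<Sum>k\<in>perms m. sc (x g * y (inv g \<circ> k)) (rep_act W k v))"
      using g by (simp add: scale_sum_right)
  qed
  also have "\<dots> = (\<Sum>k\<in>perms m. \<Sum>g\<in>perms m. sc (x g * y (inv g \<circ> k)) (rep_act W k v))" by (rule sum.swap)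
  also have "\<dots> = act (conv m x y) v" by (simp add: act_def conv_eq scale_sum_left)
  finally show ?thesis ..
qed

definition isotypic :: "nat list \<Rightarrow> 'v set" where
  "isotypic \<mu> = act (young_symmetrizer \<mu>) ` V"

lemma isotypic_basis:
  obtains n w where "independent_family sc {..<n::nat} w" "\<And>i. i < n \<Longrightarrow> w i \<in> isotypic \<mu>"
    "\<And>u. u \<in> isotypic \<mu> \<Longrightarrow> \<exists>a. u = (\<Sum>i<n. sc (a i) (w i))"
proof -
  obtain B where B: "B \<subseteq> isotypic \<mu>" "\<not> dependent B" "isotypic \<mu> \<subseteq> span B" using basis_exists by metis
  obtain G where G: "finite G" "span G = V" using finite_generators .
  have "isotypic \<mu> \<subseteq> V" using act_in by (auto simp: isotypic_def)
  then have fin: "finite B" using independent_span_bound[OF G(1) B(2)] B(1) G(2) by auto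
  then obtain w where w: "bij_betw w {0..<card B} B" using ex_bij_betw_nat_finite by blast
  let ?n = "card B"
  have w': "bij_betw w {..<?n} B" using w by (simp add: lessThan_atLeast0)
  have "independent_family sc {..<?n} w"
    unfolding independent_family_def
  proof (intro allI impI ballI)
    fix u i assume z: "(\<Sum>i<?n. sc (u i) (w i)) = 0" and i: "i \<in> {..<?n}"
    let ?u = "\<lambda>b. u (inv_into {..<?n} w b)"
    have "(\<Sum>b\<in>B. sc (?u b) b) = (\<Sum>i<?n. sc (?u (w i)) (w i))"
      using sum.reindex_bij_betw[OF w', of "\<lambda>b. sc (?u b) b"] by simp
    also have "\<dots> = (\<Sum>i<?n. sc (u i) (w i))"
      using w' by (intro sum.cong refl) (simp add: bij_betw_def)
    finally have "(\<Sum>b\<in>B. sc (?u b) b) = 0" using z by simp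
    then have "\<forall>b\<in>B. ?u b = 0" using B(2) fin by (auto simp: dependent_finite)
    then have "?u (w i) = 0" using w' i bij_betwE by blast
    then show "u i = 0" using w' i by (simp add: bij_betw_def)
  qed
  moreover have "w i \<in> isotypic \<mu>" if "i < ?n" for i using w' that B(1) bij_betwE by blast
  moreover have "\<exists>a. u = (\<Sum>i<?n. sc (a i) (w i))" if u: "u \<in> isotypic \<mu>" for u
  proof -
    have "u \<in> span B" using u B(3) by auto
    then obtain a where "u = (\<Sum>b\<in>B. sc (a b) b)" using fin by (auto simp: span_finite)
    then have "u = (\<Sum>i<?n. sc (a (w i)) (w i))"
      using sum.reindex_bij_betw[OF w', of "\<lambda>b. sc (a b) b"] by simp
    then show ?thesis by (rule exI[of _ "\<lambda>i. a (w i)"])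
  qed
  ultimately show thesis using that by blast
qed

text \<open>
  For a basis \<open>w\<^sub>1, \<dots>, w\<^sub>n\<close> of \<open>c\<^sub>\<mu> V\<close> every map \<open>x \<mapsto> x w\<^sub>i\<close> embeds the left ideal of \<open>c\<^sub>\<mu>\<close> into \<open>V\<close>, and all these maps
  together form an isomorphism: applying \<open>c\<^sub>\<nu> x\<close> to a vanishing combination isolates the components of shape \<open>\<nu>\<close>, and the
  decomposition of the unit shows both that a component killed by all \<open>c\<^sub>\<mu> x\<close> is zero and that \<open>V\<close> is exhausted.
\<close>

theorem decomposition:
  obtains n where "\<And>\<mu>. \<mu> \<notin> partitions m \<Longrightarrow> n \<mu> = 0" "rep_iso m W (sum_of_simples m n)"
proof -
  let ?c = young_symmetrizer and ?P = "partitions m"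
  have "\<exists>n w. independent_family sc {..<n::nat} w \<and> (\<forall>i<n. w i \<in> isotypic \<mu>)
    \<and> (\<forall>u\<in>isotypic \<mu>. \<exists>a. u = (\<Sum>i<n. sc (a i) (w i)))" for \<mu>
    using isotypic_basis[of \<mu>] by metis
  then obtain n0 w where w0: "\<And>\<mu>. independent_family sc {..<n0 \<mu>::nat} (w \<mu>)" "\<And>\<mu> i. i < n0 \<mu> \<Longrightarrow> w \<mu> i \<in> isotypic \<mu>"
    "\<And>\<mu> u. u \<in> isotypic \<mu> \<Longrightarrow> \<exists>a. u = (\<Sum>i<n0 \<mu>. sc (a i) (w \<mu> i))"
    by metis
  define n where "n \<mu> = (if \<mu> \<in> ?P then n0 \<mu> else 0)" for \<mu>
  let ?S = "sum_of_simples m n"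
  have n: "n \<mu> = n0 \<mu>" if "\<mu> \<in> ?P" for \<mu> using that by (simp add: n_def)
  have wV: "w \<mu> i \<in> V" if "\<mu> \<in> ?P" "i < n \<mu>" for \<mu> i
    using w0(2)[of i \<mu>] that act_in by (auto simp: n isotypic_def)
  have cw: "act (?c \<mu>) (w \<mu> i) = sc (hook_const \<mu>) (w \<mu> i)" if \<mu>: "\<mu> \<in> ?P" "i < n \<mu>" for \<mu> i
  proof -
    obtain v where v: "v \<in> V" "w \<mu> i = act (?c \<mu>) v" using w0(2)[of i \<mu>] \<mu> by (auto simp: n isotypic_def)
    have "act (?c \<mu>) (w \<mu> i) = act (conv m (?c \<mu>) (?c \<mu>)) v" by (simp add: v act_conv)
    also have "\<dots> = sc (hook_const \<mu>) (act (?c \<mu>) v)"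
      unfolding young_symmetrizer_square[OF \<mu>(1)] using act_scale_left[of "hook_const \<mu>" "?c \<mu>" v] by (simp add: pfun_scale_def)
    finally show ?thesis by (simp add: v)
  qed
  have S_iff: "F \<in> rep_space ?S \<longleftrightarrow> (\<forall>\<mu> i. if \<mu> \<in> ?P \<and> i < n \<mu> then F (\<mu>, i) \<in> simple_space \<mu> else F (\<mu>, i) = 0)" for F
    by (simp add: sum_of_simples_def)
  define \<Phi> where "\<Phi> F = (\<Sum>\<mu>\<in>?P. \<Sum>i<n \<mu>. act (F (\<mu>, i)) (w \<mu> i))" for F :: "nat list \<times> nat \<Rightarrow> pfun"
  have \<Phi>_in: "\<Phi> F \<in> V" for F
    unfolding \<Phi>_def by (intro subspace_sum[OF subspace_V] act_in wV) auto
  have \<Phi>_add: "\<Phi> (F + G) = \<Phi> F + \<Phi> G" for F G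
    by (simp add: \<Phi>_def act_add_left sum.distrib)
  have \<Phi>_scale: "\<Phi> (\<lambda>k. pfun_scale c (F k)) = sc c (\<Phi> F)" for c F
    by (simp add: \<Phi>_def act_scale_left scale_sum_right)
  have \<Phi>_act: "\<Phi> (rep_act ?S g F) = rep_act W g (\<Phi> F)" if g: "g \<in> perms m" for g F
  proof -
    have e: "rep_act ?S g F k = conv m (delta g) (F k)" for k
      by (simp add: sum_of_simples_def simple_rep_def conv_delta_left[OF g])
    have "\<Phi> (rep_act ?S g F) = (\<Sum>\<mu>\<in>?P. \<Sum>i<n \<mu>. act (delta g) (act (F (\<mu>, i)) (w \<mu> i)))"
      unfolding \<Phi>_def e using wV by (intro sum.cong refl act_conv) auto
    also have "\<dots> = (\<Sum>\<mu>\<in>?P. act (delta g) (\<Sum>i<n \<mu>. act (F (\<mu>, i)) (w \<mu> i)))"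
      using wV by (intro sum.cong refl act_sum_right[symmetric] act_in) auto
    also have "\<dots> = act (delta g) (\<Phi> F)"
      unfolding \<Phi>_def using wV finite_partitions
      by (intro act_sum_right[symmetric] subspace_sum[OF subspace_V] act_in) auto
    finally show ?thesis by (simp add: act_delta[OF g])
  qed
  obtain \<beta> where unit: "delta id = (\<Sum>\<mu>\<in>?P. \<Sum>h\<in>perms m. pfun_scale (\<beta> \<mu>) (conv m (delta h) (conv m (?c \<mu>) (delta (inv h)))))"
    using unit_decomposition .
  have simple_c: "x = pfun_scale (1 / hook_const \<mu>) (conv m x (?c \<mu>))" if "\<mu> \<in> ?P" "x \<in> simple_space \<mu>" for \<mu> x
    using that simple_space_iff[OF that(1)] hook_const_nonzero[OF that(1)] by (auto simp: pfun_scale_def fun_eq_iff)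
  have pull: "act z (\<Sum>\<mu>\<in>?P. \<Sum>j<n \<mu>. f \<mu> j) = (\<Sum>\<mu>\<in>?P. \<Sum>j<n \<mu>. act z (f \<mu> j))"
    if f: "\<And>\<mu> j. \<mu> \<in> ?P \<Longrightarrow> j < n \<mu> \<Longrightarrow> f \<mu> j \<in> V" for z f
  proof -
    have "act z (\<Sum>\<mu>\<in>?P. \<Sum>j<n \<mu>. f \<mu> j) = (\<Sum>\<mu>\<in>?P. act z (\<Sum>j<n \<mu>. f \<mu> j))"
      using f finite_partitions by (intro act_sum_right subspace_sum[OF subspace_V]) auto
    also have "\<dots> = (\<Sum>\<mu>\<in>?P. \<Sum>j<n \<mu>. act z (f \<mu> j))"
      using f by (intro sum.cong refl act_sum_right) auto
    finally show ?thesis .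
  qed
  have kill: "F (\<nu>, i) = 0" if F: "F \<in> rep_space ?S" and z: "\<Phi> F = 0" and \<nu>: "\<nu> \<in> ?P" and i: "i < n \<nu>" for F \<nu> i
  proof -
    have Fs: "F (\<mu>, j) \<in> simple_space \<mu>" if "\<mu> \<in> ?P" "j < n \<mu>" for \<mu> j
      using F that unfolding S_iff by meson
    have orth: "conv m (?c \<kappa>) (conv m x (F (\<mu>, j))) = 0" if "\<kappa> \<in> ?P" "\<mu> \<in> ?P" "\<kappa> \<noteq> \<mu>" "j < n \<mu>" for \<kappa> \<mu> x j
    proof -
      let ?y = "F (\<mu>, j)"
      have "conv m (?c \<kappa>) (conv m x ?y) = conv m (?c \<kappa>) (conv m x (pfun_scale (1 / hook_const \<mu>) (conv m ?y (?c \<mu>))))"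
        using simple_c[OF that(2) Fs[OF that(2,4)]] by metis
      also have "\<dots> = pfun_scale (1 / hook_const \<mu>) (conv m (?c \<kappa>) (conv m (conv m x ?y) (?c \<mu>)))"
        by (simp only: conv_pfun_scale_right conv_assoc)
      also have "\<dots> = 0" unfolding young_symmetrizer_orthogonal[OF that(1,2,3)] by (auto simp: pfun_scale_def fun_eq_iff)
      finally show ?thesis .
    qed
    have diag: "conv m (?c \<nu>) (conv m x (F (\<nu>, j))) = pfun_scale (conv m (?c \<nu>) (conv m x (F (\<nu>, j))) id) (?c \<nu>)" if "j < n \<nu>" for x j
    proof -
      let ?y = "F (\<nu>, j)"
      let ?k = "conv m (?c \<nu>) (conv m (conv m x ?y) (?c \<nu>)) id"
      have "conv m (?c \<nu>) (conv m x ?y) = conv m (?c \<nu>) (conv m x (pfun_scale (1 / hook_const \<nu>) (conv m ?y (?c \<nu>))))"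
        using simple_c[OF \<nu> Fs[OF \<nu> that]] by metis
      also have "\<dots> = pfun_scale (1 / hook_const \<nu>) (conv m (?c \<nu>) (conv m (conv m x ?y) (?c \<nu>)))"
        by (simp only: conv_pfun_scale_right conv_assoc)
      also have "\<dots> = pfun_scale (?k / hook_const \<nu>) (?c \<nu>)"
        by (subst young_symmetrizer_sandwich[OF \<nu>]) (simp add: pfun_scale_def)
      finally have e: "conv m (?c \<nu>) (conv m x ?y) = pfun_scale (?k / hook_const \<nu>) (?c \<nu>)" .
      have "?c \<nu> id = 1"
        using tableau.symmetrizer_id[OF tableau_partition[OF \<nu>]] by (simp add: young_symmetrizer_eq[OF \<nu>])
      then have "conv m (?c \<nu>) (conv m x ?y) id = ?k / hook_const \<nu>" by (subst e) (simp add: pfun_scale_def)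
      then show ?thesis using e by simp
    qed
    have van: "conv m (?c \<nu>) (conv m x (F (\<nu>, i))) = 0" for x
    proof -
      let ?k = "\<lambda>j. conv m (?c \<nu>) (conv m x (F (\<nu>, j))) id"
      have "0 = act (?c \<nu>) (act x (\<Phi> F))"
        using z act_scale_right[OF subspace_0[OF subspace_V], of _ 0] by simp
      also have "\<dots> = (\<Sum>\<mu>\<in>?P. \<Sum>j<n \<mu>. act (?c \<nu>) (act x (act (F (\<mu>, j)) (w \<mu> j))))"
        unfolding \<Phi>_def by (simp only: pull act_in wV)
      also have "\<dots> = (\<Sum>\<mu>\<in>?P. \<Sum>j<n \<mu>. act (conv m (?c \<nu>) (conv m x (F (\<mu>, j)))) (w \<mu> j))"
        using wV by (intro sum.cong refl) (simp add: act_conv act_in)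
      also have "\<dots> = (\<Sum>\<mu>\<in>{\<nu>}. \<Sum>j<n \<mu>. act (conv m (?c \<nu>) (conv m x (F (\<mu>, j)))) (w \<mu> j))"
      proof (rule sum.mono_neutral_right)
        show "\<forall>\<mu>\<in>?P - {\<nu>}. (\<Sum>j<n \<mu>. act (conv m (?c \<nu>) (conv m x (F (\<mu>, j)))) (w \<mu> j)) = 0"
        proof (intro ballI sum.neutral)
          fix \<mu> j assume "\<mu> \<in> ?P - {\<nu>}" "j \<in> {..<n \<mu>}"
          then have "conv m (?c \<nu>) (conv m x (F (\<mu>, j))) = 0" by (intro orth \<nu>) auto
          then show "act (conv m (?c \<nu>) (conv m x (F (\<mu>, j)))) (w \<mu> j) = 0" by (simp only: act_0_left)
        qed
      qed (use \<nu> finite_partitions in auto)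
      also have "\<dots> = (\<Sum>j<n \<nu>. sc (?k j * hook_const \<nu>) (w \<nu> j))"
      proof -
        have "act (conv m (?c \<nu>) (conv m x (F (\<nu>, j)))) (w \<nu> j) = sc (?k j * hook_const \<nu>) (w \<nu> j)" if "j < n \<nu>" for j
          using diag[OF that, of x] cw[OF \<nu> that] act_scale_left[of "?k j" "?c \<nu>" "w \<nu> j"] by simp
        then show ?thesis by simp
      qed
      finally have "(\<Sum>j<n0 \<nu>. sc (?k j * hook_const \<nu>) (w \<nu> j)) = 0" by (simp add: n[OF \<nu>])
      then have "?k i * hook_const \<nu> = 0"
        using independent_familyD[OF w0(1)[of \<nu>], of "\<lambda>j. ?k j * hook_const \<nu>" i] i by (simp add: n[OF \<nu>])
      then have "?k i = 0" using hook_const_nonzero[OF \<nu>] by simp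
      then show ?thesis using diag[OF i, of x] by (auto simp: pfun_scale_def fun_eq_iff)
    qed
    have all: "conv m (?c \<mu>) (conv m x (F (\<nu>, i))) = 0" if "\<mu> \<in> ?P" for \<mu> x
      using orth[OF that \<nu> _ i] van by (cases "\<mu> = \<nu>") auto
    have "F (\<nu>, i) = conv m (delta id) (F (\<nu>, i))" by (simp add: conv_delta_left)
    also have "\<dots> = (\<Sum>\<mu>\<in>?P. \<Sum>h\<in>perms m. pfun_scale (\<beta> \<mu>) (conv m (delta h) (conv m (?c \<mu>) (conv m (delta (inv h)) (F (\<nu>, i))))))"
      by (subst unit) (simp add: conv_sum_left pfun_scale_def conv_scale_left conv_assoc)
    also have "\<dots> = 0"
      by (intro sum.neutral ballI, subst all) (auto simp: pfun_scale_def conv_eq fun_eq_iff)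
    finally show ?thesis .
  qed
  have subS: "F - G \<in> rep_space ?S" if "F \<in> rep_space ?S" "G \<in> rep_space ?S" for F G
    unfolding S_iff
  proof (intro allI)
    fix \<mu> i
    interpret p: vector_space pfun_scale by (rule vector_space_pfun)
    show "if \<mu> \<in> ?P \<and> i < n \<mu> then (F - G) (\<mu>, i) \<in> simple_space \<mu> else (F - G) (\<mu>, i) = 0"
      using that p.subspace_diff[OF subspace_simple_space, of \<mu> m "F (\<mu>, i)" "G (\<mu>, i)"] unfolding S_iff by (auto; metis)
  qed
  have addS: "F + G \<in> rep_space ?S" if "F \<in> rep_space ?S" "G \<in> rep_space ?S" for F G
    unfolding S_iff
  proof (intro allI)
    fix \<mu> i
    interpret p: vector_space pfun_scale by (rule vector_space_pfun)
    show "if \<mu> \<in> ?P \<and> i < n \<mu> then (F + G) (\<mu>, i) \<in> simple_space \<mu> else (F + G) (\<mu>, i) = 0"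
      using that p.subspace_add[OF subspace_simple_space, of \<mu> m "F (\<mu>, i)" "G (\<mu>, i)"] unfolding S_iff by (auto; metis)
  qed
  have scaleS: "(\<lambda>k. pfun_scale c (F k)) \<in> rep_space ?S" if "F \<in> rep_space ?S" for F c
    unfolding S_iff
  proof (intro allI)
    fix \<mu> i
    interpret p: vector_space pfun_scale by (rule vector_space_pfun)
    show "if \<mu> \<in> ?P \<and> i < n \<mu> then pfun_scale c (F (\<mu>, i)) \<in> simple_space \<mu> else pfun_scale c (F (\<mu>, i)) = 0"
      using that p.subspace_scale[OF subspace_simple_space, of \<mu> m "F (\<mu>, i)" c] unfolding S_iff by (auto simp: pfun_scale_def fun_eq_iff; metis)
  qed
  have actS: "rep_act ?S g F \<in> rep_space ?S" if F: "F \<in> rep_space ?S" and g: "g \<in> perms m" for F g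
    unfolding S_iff
  proof (intro allI)
    fix \<mu> i
    have e: "rep_act ?S g F k = (\<lambda>h. F k (inv g \<circ> h))" for k by (simp add: sum_of_simples_def simple_rep_def)
    show "if \<mu> \<in> ?P \<and> i < n \<mu> then rep_act ?S g F (\<mu>, i) \<in> simple_space \<mu> else rep_act ?S g F (\<mu>, i) = 0"
    proof (cases "\<mu> \<in> ?P \<and> i < n \<mu>")
      case True
      then have "F (\<mu>, i) \<in> simple_space \<mu>" using F unfolding S_iff by meson
      then show ?thesis using True simple_space_act[OF _ g, of \<mu> "F (\<mu>, i)"] by (simp add: e)
    next
      case False
      then have "F (\<mu>, i) = 0" using F unfolding S_iff by meson
      then show ?thesis using False by (auto simp: e fun_eq_iff)
    qed
  qed
  have inj: "inj_on \<Phi> (rep_space ?S)"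
  proof (rule inj_onI)
    fix F G assume F: "F \<in> rep_space ?S" and G: "G \<in> rep_space ?S" and e: "\<Phi> F = \<Phi> G"
    have "\<Phi> (F - G) + \<Phi> G = \<Phi> F" by (simp flip: \<Phi>_add)
    then have z: "\<Phi> (F - G) = 0" using e by simp
    have "(F - G) (\<mu>, i) = 0" for \<mu> i
    proof (cases "\<mu> \<in> ?P \<and> i < n \<mu>")
      case True
      then show ?thesis using kill[OF subS[OF F G] z] by blast
    next
      case False
      then show ?thesis using subS[OF F G] unfolding S_iff by meson
    qed
    then show "F = G" by (simp add: fun_eq_iff)
  qed
  have ideal_img: "act x (w \<mu> i) \<in> \<Phi> ` rep_space ?S" if \<mu>: "\<mu> \<in> ?P" and i: "i < n \<mu>" and x: "x \<in> simple_space \<mu>" for \<mu> i x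
  proof (rule image_eqI)
    let ?F = "\<lambda>k. if k = (\<mu>, i) then x else 0"
    show "?F \<in> rep_space ?S" unfolding S_iff
    proof (intro allI)
      fix \<nu> j
      interpret p: vector_space pfun_scale by (rule vector_space_pfun)
      show "if \<nu> \<in> ?P \<and> j < n \<nu> then ?F (\<nu>, j) \<in> simple_space \<nu> else ?F (\<nu>, j) = 0"
        using \<mu> i x p.subspace_0[OF subspace_simple_space, of \<nu> m] by auto
    qed
    have "\<Phi> ?F = (\<Sum>\<nu>\<in>?P. \<Sum>j<n \<nu>. if \<nu> = \<mu> \<and> j = i then act x (w \<mu> i) else 0)"
      unfolding \<Phi>_def by (intro sum.cong refl) (auto simp: act_0_left)
    also have "\<dots> = (\<Sum>\<nu>\<in>?P. if \<nu> = \<mu> then act x (w \<mu> i) else 0)"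
      using i by (intro sum.cong refl) auto
    also have "\<dots> = act x (w \<mu> i)" using \<mu> finite_partitions by simp
    finally show "act x (w \<mu> i) = \<Phi> ?F" ..
  qed
  have sub_img: "subspace (\<Phi> ` rep_space ?S)"
  proof (rule subspaceI)
    have "(\<lambda>k. 0) \<in> rep_space ?S"
      unfolding S_iff
    proof (intro allI)
      fix \<nu> j
      interpret p: vector_space pfun_scale by (rule vector_space_pfun)
      show "if \<nu> \<in> ?P \<and> j < n \<nu> then (0 :: pfun) \<in> simple_space \<nu> else (0 :: pfun) = 0"
        using p.subspace_0[OF subspace_simple_space, of \<nu> m] by auto
    qed
    moreover have "\<Phi> (\<lambda>k. 0) = 0" by (simp add: \<Phi>_def act_0_left)
    ultimately show "0 \<in> \<Phi> ` rep_space ?S" by (intro image_eqI[of _ _ "\<lambda>k. 0"]) (rule sym)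
    show "x + y \<in> \<Phi> ` rep_space ?S" if "x \<in> \<Phi> ` rep_space ?S" "y \<in> \<Phi> ` rep_space ?S" for x y
    proof -
      obtain F G where F: "F \<in> rep_space ?S" "x = \<Phi> F" and G: "G \<in> rep_space ?S" "y = \<Phi> G" using \<open>x \<in> _\<close> \<open>y \<in> _\<close> by blast
      have "x + y = \<Phi> (F + G)" unfolding F(2) G(2) by (rule \<Phi>_add[symmetric])
      then show ?thesis using addS[OF F(1) G(1)] by (rule image_eqI)
    qed
    show "sc c x \<in> \<Phi> ` rep_space ?S" if "x \<in> \<Phi> ` rep_space ?S" for c x
    proof -
      obtain F where F: "F \<in> rep_space ?S" "x = \<Phi> F" using \<open>x \<in> _\<close> by blast
      have "sc c x = \<Phi> (\<lambda>k. pfun_scale c (F k))" unfolding F(2) by (rule \<Phi>_scale[symmetric])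
      then show ?thesis using scaleS[OF F(1)] by (rule image_eqI)
    qed
  qed
  have surj: "\<Phi> ` rep_space ?S = V"
  proof (intro subset_antisym subsetI)
    fix v assume v: "v \<in> V"
    have term_in: "act (conv m (delta h) (conv m (?c \<mu>) (delta (inv h)))) v \<in> \<Phi> ` rep_space ?S" if \<mu>: "\<mu> \<in> ?P" and h: "h \<in> perms m" for \<mu> h
    proof -
      let ?v = "act (delta (inv h)) v"
      have v': "?v \<in> V" using v by (rule act_in)
      then have "act (?c \<mu>) ?v \<in> isotypic \<mu>" by (auto simp: isotypic_def)
      then obtain a where a: "act (?c \<mu>) ?v = (\<Sum>i<n \<mu>. sc (a i) (w \<mu> i))" using w0(3) n[OF \<mu>] by metis
      have "act (conv m (delta h) (conv m (?c \<mu>) (delta (inv h)))) v = act (delta h) (act (?c \<mu>) ?v)"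
        using v by (simp add: act_conv act_in)
      also have "\<dots> = (\<Sum>i<n \<mu>. act (delta h) (sc (a i) (w \<mu> i)))"
        unfolding a using wV[OF \<mu>] by (intro act_sum_right subspace_scale[OF subspace_V]) auto
      also have "\<dots> = (\<Sum>i<n \<mu>. sc (a i) (act (pfun_scale (1 / hook_const \<mu>) (conv m (delta h) (?c \<mu>))) (w \<mu> i)))"
      proof (rule sum.cong[OF refl])
        fix i assume "i \<in> {..<n \<mu>}"
        then have i: "i < n \<mu>" by simp
        have "act (delta h) (sc (a i) (w \<mu> i)) = sc (a i) (act (delta h) (w \<mu> i))"
          using wV[OF \<mu> i] by (rule act_scale_right)
        moreover have "act (pfun_scale (1 / hook_const \<mu>) (conv m (delta h) (?c \<mu>))) (w \<mu> i) = act (delta h) (w \<mu> i)"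
          using wV[OF \<mu> i] hook_const_nonzero[OF \<mu>]
          by (simp add: act_scale_left act_conv cw[OF \<mu> i] act_scale_right)
        ultimately show "act (delta h) (sc (a i) (w \<mu> i)) = sc (a i) (act (pfun_scale (1 / hook_const \<mu>) (conv m (delta h) (?c \<mu>))) (w \<mu> i))" by simp
      qed
      also have "\<dots> \<in> \<Phi> ` rep_space ?S"
      proof (intro subspace_sum[OF sub_img] subspace_scale[OF sub_img] ideal_img[OF \<mu>])
        have "pfun_scale (1 / hook_const \<mu>) (conv m (delta h) (?c \<mu>)) = frame_vec \<mu> h"
          by (simp add: pfun_scale_def frame_vec_def conv_delta_left[OF h])
        then show "pfun_scale (1 / hook_const \<mu>) (conv m (delta h) (?c \<mu>)) \<in> simple_space \<mu>"
          using frame_vec_simple_space[OF \<mu> h] by simp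
      qed auto
      finally show ?thesis .
    qed
    have "v = act (delta id) v" using v by (simp add: act_delta rho_id)
    also have "\<dots> = (\<Sum>\<mu>\<in>?P. \<Sum>h\<in>perms m. sc (\<beta> \<mu>) (act (conv m (delta h) (conv m (?c \<mu>) (delta (inv h)))) v))"
      by (subst unit) (simp add: act_sum_left act_scale_left)
    also have "\<dots> \<in> \<Phi> ` rep_space ?S"
      by (intro subspace_sum[OF sub_img] subspace_scale[OF sub_img] term_in)
    finally show "v \<in> \<Phi> ` rep_space ?S" .
  qed (use \<Phi>_in in auto)
  let ?\<phi> = "inv_into (rep_space ?S) \<Phi>"
  have \<phi>_in: "?\<phi> v \<in> rep_space ?S" and \<Phi>\<phi>: "\<Phi> (?\<phi> v) = v" if "v \<in> V" for v
    using that surj inv_into_into[of v \<Phi> "rep_space ?S"] f_inv_into_f[of v \<Phi> "rep_space ?S"] by auto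
  have \<phi>\<Phi>: "?\<phi> v = F" if "F \<in> rep_space ?S" "\<Phi> F = v" for v F
    using inv_into_f_f[OF inj] that by metis
  have "rep_iso m W ?S"
    unfolding rep_iso_def sym_perms
  proof (intro exI[of _ ?\<phi>] conjI ballI allI)
    show "bij_betw ?\<phi> V (rep_space ?S)"
      by (rule bij_betw_inv_into) (use inj surj in \<open>simp add: bij_betw_def\<close>)
    show "?\<phi> (x + y) = ?\<phi> x + ?\<phi> y" if "x \<in> V" "y \<in> V" for x y
      using that by (intro \<phi>\<Phi> addS \<phi>_in) (simp_all only: \<Phi>_add \<Phi>\<phi>)
    show "?\<phi> (sc c x) = rep_scale ?S c (?\<phi> x)" if "x \<in> V" for c x
    proof -
      have "rep_scale ?S c (?\<phi> x) = (\<lambda>k. pfun_scale c (?\<phi> x k))" by (simp add: sum_of_simples_def)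
      then show ?thesis using that by (intro \<phi>\<Phi>) (simp_all add: scaleS \<phi>_in \<Phi>_scale \<Phi>\<phi>)
    qed
    show "?\<phi> (rep_act W g x) = rep_act ?S g (?\<phi> x)" if "g \<in> perms m" "x \<in> V" for g x
      using that by (intro \<phi>\<Phi> actS \<phi>_in) (simp_all add: \<Phi>_act \<Phi>\<phi>)
  qed
  moreover have "n \<mu> = 0" if "\<mu> \<notin> ?P" for \<mu> using that by (simp add: n_def)
  ultimately show thesis using that by blast
qed

text \<open>
  The frames of the left ideals combine to a frame of their direct sum, and its pullback along the isomorphism computes the trace on \<open>V\<close>.
\<close>

theorem character_of_iso:
  assumes n: "\<And>\<mu>. \<mu> \<notin> partitions m \<Longrightarrow> n \<mu> = 0" and iso: "rep_iso m W (sum_of_simples m n)"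
  shows "character m W = (\<Sum>\<mu>\<in>partitions m. pfun_scale (of_nat (n \<mu>)) (simple_char \<mu>))"
proof
  fix g
  let ?P = "partitions m" and ?S = "sum_of_simples m n"
  show "character m W g = (\<Sum>\<mu>\<in>?P. pfun_scale (of_nat (n \<mu>)) (simple_char \<mu>)) g"
  proof (cases "g \<in> perms m")
    case g: True
    obtain f where f: "bij_betw f V (rep_space ?S)"
      and f_add: "\<And>x y. x \<in> V \<Longrightarrow> y \<in> V \<Longrightarrow> f (x + y) = f x + f y"
      and f_scale: "\<And>c x. x \<in> V \<Longrightarrow> f (sc c x) = rep_scale ?S c (f x)"
      and f_act: "\<And>g x. g \<in> perms m \<Longrightarrow> x \<in> V \<Longrightarrow> f (rep_act W g x) = rep_act ?S g (f x)"
      using iso unfolding rep_iso_def sym_perms by blast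
    let ?f' = "inv_into V f"
    have f'_in: "?f' F \<in> V" and ff': "f (?f' F) = F" if "F \<in> rep_space ?S" for F
      using that f inv_into_into[of F f V] f_inv_into_f[of F f V] by (auto simp: bij_betw_def)
    have S_iff: "F \<in> rep_space ?S \<longleftrightarrow> (\<forall>\<mu> i. if \<mu> \<in> ?P \<and> i < n \<mu> then F (\<mu>, i) \<in> simple_space \<mu> else F (\<mu>, i) = 0)" for F
      by (simp add: sum_of_simples_def)
    let ?I = "SIGMA \<mu>:?P. {..<n \<mu>} \<times> perms m"
    define e where "e = (\<lambda>(\<mu>, i :: nat, h) k. if k = (\<mu>, i) then frame_vec \<mu> h else (0 :: pfun))"
    define \<phi> where "\<phi> = (\<lambda>(\<mu>, i, h) x. f x (\<mu>, i) h)"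
    have e_in: "e t \<in> rep_space ?S" if "t \<in> ?I" for t
      unfolding S_iff
    proof (intro allI)
      fix \<nu> j
      interpret p: vector_space pfun_scale by (rule vector_space_pfun)
      show "if \<nu> \<in> ?P \<and> j < n \<nu> then e t (\<nu>, j) \<in> simple_space \<nu> else e t (\<nu>, j) = 0"
        using that frame_vec_simple_space p.subspace_0[OF subspace_simple_space, of \<nu> m] by (auto simp: e_def)
    qed
    have expand: "F = (\<Sum>(\<mu>, i, h)\<in>?I. (\<lambda>k. pfun_scale (F (\<mu>, i) h) (e (\<mu>, i, h) k)))" if F: "F \<in> rep_space ?S" for F
    proof (rule ext, clarify)
      fix \<nu> j
      have "(\<Sum>(\<mu>, i, h)\<in>?I. (\<lambda>k. pfun_scale (F (\<mu>, i) h) (e (\<mu>, i, h) k))) (\<nu>, j)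
        = (\<Sum>t\<in>?I. case t of (\<mu>, i, h) \<Rightarrow> pfun_scale (F (\<mu>, i) h) (e (\<mu>, i, h) (\<nu>, j)))"
        by (simp add: sum_apply_fun case_prod_unfold)
      also have "\<dots> = (\<Sum>\<mu>\<in>?P. \<Sum>i<n \<mu>. \<Sum>h\<in>perms m. pfun_scale (F (\<mu>, i) h) (e (\<mu>, i, h) (\<nu>, j)))"
        using finite_partitions by (subst sum.Sigma[symmetric]) (auto simp: sum.cartesian_product)
      also have "\<dots> = (\<Sum>\<mu>\<in>?P. \<Sum>i<n \<mu>. if \<mu> = \<nu> \<and> i = j then F (\<nu>, j) else 0)"
      proof (intro sum.cong refl)
        fix \<mu> i assume \<mu>: "\<mu> \<in> ?P" and i: "i \<in> {..<n \<mu>}"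
        show "(\<Sum>h\<in>perms m. pfun_scale (F (\<mu>, i) h) (e (\<mu>, i, h) (\<nu>, j))) = (if \<mu> = \<nu> \<and> i = j then F (\<nu>, j) else 0)"
        proof (cases "\<mu> = \<nu> \<and> i = j")
          case True
          have "F (\<mu>, i) \<in> simple_space \<mu>" using F \<mu> i unfolding S_iff by (meson lessThan_iff)
          from frame_vec_expansion[OF \<mu> this] show ?thesis using True by (simp add: e_def)
        next
          case False
          then show ?thesis by (auto simp: e_def pfun_scale_def fun_eq_iff sum_apply_fun intro!: sum.neutral)
        qed
      qed
      also have "\<dots> = F (\<nu>, j)"
      proof (cases "\<nu> \<in> ?P \<and> j < n \<nu>")
        case True
        then have "(\<Sum>i<n \<mu>. if \<mu> = \<nu> \<and> i = j then F (\<nu>, j) else 0) = (if \<mu> = \<nu> then F (\<nu>, j) else 0)" for \<mu> by auto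
        then show ?thesis using True finite_partitions by simp
      next
        case False
        then have "F (\<nu>, j) = 0" using F unfolding S_iff by meson
        then show ?thesis by (auto intro!: sum.neutral)
      qed
      finally show "F (\<nu>, j) = (\<Sum>(\<mu>, i, h)\<in>?I. (\<lambda>k. pfun_scale (F (\<mu>, i) h) (e (\<mu>, i, h) k))) (\<nu>, j)" ..
    qed
    have finI: "finite ?I" using finite_partitions by auto
    have "character m W g = trace_on sc V (rep_act W g)"
      using g unfolding character_def sym_perms by simp
    also have "\<dots> = (\<Sum>t\<in>?I. \<phi> t (rep_act W g (?f' (e t))))"
      unfolding trace_on_def
    proof (rule trace_on_frame[OF subspace_V finI])
      show "?f' (e t) \<in> V" if "t \<in> ?I" for t using e_in[OF that] by (rule f'_in)
      show "\<phi> t (x + y) = \<phi> t x + \<phi> t y" if "x \<in> V" "y \<in> V" for t x y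
        using f_add[OF that] by (simp add: \<phi>_def case_prod_unfold)
      show "\<phi> t (sc c x) = c * \<phi> t x" if "x \<in> V" for t c x
        using f_scale[OF that] by (simp add: \<phi>_def case_prod_unfold sum_of_simples_def pfun_scale_def)
      show "v = (\<Sum>t\<in>?I. sc (\<phi> t v) (?f' (e t)))" if v: "v \<in> V" for v
      proof (rule inj_onD[OF bij_betw_imp_inj_on[OF f] _ v])
        have inV: "sc (\<phi> t v) (?f' (e t)) \<in> V" if "t \<in> ?I" for t
          using f'_in[OF e_in[OF that]] by (rule subspace_scale[OF subspace_V])
        then show "(\<Sum>t\<in>?I. sc (\<phi> t v) (?f' (e t))) \<in> V" by (intro subspace_sum[OF subspace_V])
        have "f v \<in> rep_space ?S" using f v bij_betwE by blast
        then have "f v = (\<Sum>t\<in>?I. (\<lambda>k. pfun_scale (\<phi> t v) (e t k)))"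
          using expand[of "f v"] by (simp add: \<phi>_def case_prod_unfold)
        also have "\<dots> = (\<Sum>t\<in>?I. f (sc (\<phi> t v) (?f' (e t))))"
        proof (rule sum.cong[OF refl])
          fix t assume t: "t \<in> ?I"
          have "f (sc (\<phi> t v) (?f' (e t))) = rep_scale ?S (\<phi> t v) (e t)"
            using f_scale[OF f'_in[OF e_in[OF t]]] ff'[OF e_in[OF t]] by simp
          then show "(\<lambda>k. pfun_scale (\<phi> t v) (e t k)) = f (sc (\<phi> t v) (?f' (e t)))"
            by (simp add: sum_of_simples_def)
        qed
        also have "\<dots> = f (\<Sum>t\<in>?I. sc (\<phi> t v) (?f' (e t)))"
          by (rule linear_on_sum[OF subspace_V f_add finI inV, symmetric])
        finally show "f v = f (\<Sum>t\<in>?I. sc (\<phi> t v) (?f' (e t)))" .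
      qed
    qed (use g rho_in rho_add rho_scale in auto)
    also have "\<dots> = (\<Sum>(\<mu>, i, h)\<in>?I. frame_vec \<mu> h (inv g \<circ> h))"
    proof (rule sum.cong[OF refl])
      fix t assume t: "t \<in> ?I"
      obtain \<mu> i h where tt: "t = (\<mu>, i, h)" by (metis prod_cases3)
      have "f (rep_act W g (?f' (e t))) = rep_act ?S g (e t)"
        using f_act[OF g f'_in[OF e_in[OF t]]] ff'[OF e_in[OF t]] by simp
      then show "\<phi> t (rep_act W g (?f' (e t))) = (case t of (\<mu>, i, h) \<Rightarrow> frame_vec \<mu> h (inv g \<circ> h))"
        by (simp add: \<phi>_def tt e_def sum_of_simples_def simple_rep_def)
    qed
    also have "\<dots> = (\<Sum>\<mu>\<in>?P. \<Sum>i<n \<mu>. \<Sum>h\<in>perms m. frame_vec \<mu> h (inv g \<circ> h))"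
      using finite_partitions by (subst sum.Sigma[symmetric]) (auto simp: sum.cartesian_product simp del: sum_constant)
    also have "\<dots> = (\<Sum>\<mu>\<in>?P. of_nat (n \<mu>) * simple_char \<mu> g)"
      by (intro sum.cong refl) (simp add: simple_char_formula[OF _ g] frame_vec_def sum_divide_distrib)
    finally show ?thesis by (simp add: sum_apply_fun pfun_scale_def)
  next
    case False
    then have "character m W g = 0" unfolding character_def sym_perms by simp
    moreover have "(\<Sum>\<mu>\<in>?P. pfun_scale (of_nat (n \<mu>)) (simple_char \<mu>)) g = 0"
      unfolding sum_apply_fun pfun_scale_def
      by (intro sum.neutral ballI, subst simple_char_outside[OF False sum_list_partition]) simp_all
    ultimately show ?thesis by simp
  qed
qed

lemma multiplicity_unique:
  assumes n: "\<And>\<mu>. \<mu> \<notin> partitions m \<Longrightarrow> n \<mu> = 0" and iso: "rep_iso m W (sum_of_simples m n)"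
  shows "Defs.multiplicity m W = n"
  unfolding Defs.multiplicity_def
proof (rule the_equality)
  show "(\<forall>\<mu>. \<mu> \<notin> partitions m \<longrightarrow> n \<mu> = 0) \<and> rep_iso m W (sum_of_simples m n)" using n iso by blast
  fix n' assume n': "(\<forall>\<mu>. \<mu> \<notin> partitions m \<longrightarrow> n' \<mu> = 0) \<and> rep_iso m W (sum_of_simples m n')"
  have eq: "(\<Sum>\<mu>\<in>partitions m. pfun_scale (of_nat (n' \<mu>)) (simple_char \<mu>)) = (\<Sum>\<mu>\<in>partitions m. pfun_scale (of_nat (n \<mu>)) (simple_char \<mu>))"
    using character_of_iso[of n'] character_of_iso[of n] n n' iso by simp
  show "n' = n"
  proof
    fix \<mu> show "n' \<mu> = n \<mu>"
    proof (cases "\<mu> \<in> partitions m")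
      case True
      have "rat_of_nat (n' \<mu>) = of_nat (n \<mu>)"
        using arg_cong[OF eq, of "scalar_prod m (simple_char \<mu>)"]
        unfolding scalar_prod_simple_char_combination[OF True] .
      then show ?thesis by simp
    qed (use n n' in auto)
  qed
qed

lemma character_multiplicity:
  "character m W = (\<Sum>\<mu>\<in>partitions m. pfun_scale (of_nat (Defs.multiplicity m W \<mu>)) (simple_char \<mu>))"
proof -
  obtain n where n: "\<And>\<mu>. \<mu> \<notin> partitions m \<Longrightarrow> n \<mu> = 0" "rep_iso m W (sum_of_simples m n)" using decomposition by blast
  then show ?thesis using multiplicity_unique[of n] character_of_iso[of n] by simp
qed

end

section \<open>Weights of representations\<close>

lemma deg_w_le_iff: "deg_w P \<le> ereal (real d) \<longleftrightarrow> P \<in> polys_weight_le d"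
  by (simp add: polys_weight_le_def)

lemma monom_weight_le_deg_w: "t \<in> Poly_Mapping.keys P \<Longrightarrow> ereal (real (monom_weight t)) \<le> deg_w P"
  unfolding deg_w_def by (rule SUP_upper)

lemma scalar_prod_deg_less:
  assumes \<mu>: "\<mu> \<in> partitions m" and deg: "deg_w P < ereal (real (weight \<mu>))"
  shows "scalar_prod m (simple_char \<mu>) (rho m P) = 0"
proof -
  have less: "monom_weight t < weight \<mu>" if "t \<in> Poly_Mapping.keys P" for t
    using le_less_trans[OF monom_weight_le_deg_w[OF that] deg] by simp
  show ?thesis
  proof (cases "weight \<mu>")
    case 0
    then have "Poly_Mapping.keys P = {}" using less by (intro equals0I) simp
    then have "P = 0" by simp
    then show ?thesis by (simp add: rho_0 scalar_prod_perms)
  next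
    case (Suc d)
    then have "P \<in> polys_weight_le d" using less by (auto simp: polys_weight_le_iff light_exponents_def less_Suc_eq_le)
    then show ?thesis using scalar_prod_heavy[OF _ \<mu>] Suc by simp
  qed
qed

lemma polys_in_vars_of_weight:
  assumes "P \<in> polys_weight_le d" "d \<le> k" shows "P \<in> polys_in_vars k"
  unfolding polys_in_vars_def
proof (intro CollectI ballI)
  fix t i assume t: "t \<in> Poly_Mapping.keys P" and i: "i \<in> Poly_Mapping.keys t"
  have "Suc i \<le> Suc i * Poly_Mapping.lookup t i"
    using i mult_le_mono2[of 1 "Poly_Mapping.lookup t i" "Suc i"] by (simp add: in_keys_iff)
  also have "\<dots> \<le> monom_weight t" unfolding monom_weight_def using i by (intro member_le_sum) auto
  also have "\<dots> \<le> d" using assms(1) t by (auto simp: polys_weight_le_iff light_exponents_def)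
  finally show "Suc i \<le> k" using assms(2) by simp
qed

lemma weight_le_pred: "\<mu> \<in> partitions m \<Longrightarrow> weight \<mu> \<le> m - 1"
  by (cases \<mu>) (auto simp: partitions_def weight_def)

lemma polys_weight_le_diff: "P \<in> polys_weight_le d \<Longrightarrow> Q \<in> polys_weight_le d \<Longrightarrow> P - Q \<in> polys_weight_le d"
  unfolding polys_weight_le_iff subset_iff in_keys_iff lookup_minus by (metis diff_zero)

lemma rho_diff: "rho m (P - Q) = rho m P - rho m Q"
  by (auto simp: rho_perms qeval_diff fun_eq_iff)

context representation
begin

abbreviation mult :: "nat list \<Rightarrow> nat" where "mult \<equiv> Defs.multiplicity m W"

lemma scalar_prod_character: "\<mu> \<in> partitions m \<Longrightarrow> scalar_prod m (simple_char \<mu>) (character m W) = of_nat (mult \<mu>)"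
  unfolding character_multiplicity by (rule scalar_prod_simple_char_combination)

lemma rep_weight_le_deg_w:
  assumes "rho m P = character m W" shows "rep_weight m W \<le> deg_w P"
  unfolding rep_weight_def
proof (rule SUP_least, rule ccontr)
  fix \<mu> assume \<mu>: "\<mu> \<in> {\<mu> \<in> partitions m. mult \<mu> \<noteq> 0}" and "\<not> ereal (real (weight \<mu>)) \<le> deg_w P"
  then have "scalar_prod m (simple_char \<mu>) (rho m P) = 0" by (intro scalar_prod_deg_less) auto
  then show False using scalar_prod_character[of \<mu>] assms \<mu> by simp
qed

lemma rep_poly_eq: "rep_poly m W = (\<Sum>\<mu>\<in>partitions m. qscale (of_nat (mult \<mu>)) (frob_poly \<mu>))"
  unfolding rep_poly_def qscale_def qconst_def by simp

lemma rho_rep_poly: "rho m (rep_poly m W) = character m W"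
  unfolding rep_poly_eq rho_combination character_multiplicity
  by (intro sum.cong refl) (simp add: rho_frob_poly_own)

lemma rep_poly_keys:
  assumes "t \<in> Poly_Mapping.keys (rep_poly m W)"
  obtains \<mu> where "\<mu> \<in> partitions m" "mult \<mu> \<noteq> 0" "monom_weight t \<le> weight \<mu>"
proof -
  have "(\<Sum>\<mu>\<in>partitions m. of_nat (mult \<mu>) * Poly_Mapping.lookup (frob_poly \<mu>) t) \<noteq> 0"
    using assms by (simp add: rep_poly_eq in_keys_iff lookup_sum lookup_qscale)
  then obtain \<mu> where \<mu>: "\<mu> \<in> partitions m" "of_nat (mult \<mu>) * Poly_Mapping.lookup (frob_poly \<mu>) t \<noteq> 0"
    using sum.not_neutral_contains_not_neutral by blast
  then have "t \<in> Poly_Mapping.keys (frob_poly \<mu>)" by (simp add: in_keys_iff)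
  then show thesis using that \<mu> frob_poly_weight by auto
qed

lemma deg_w_rep_poly: "deg_w (rep_poly m W) = rep_weight m W"
proof (rule antisym)
  show "deg_w (rep_poly m W) \<le> rep_weight m W"
    unfolding deg_w_def
  proof (rule SUP_least)
    fix t assume "t \<in> Poly_Mapping.keys (rep_poly m W)"
    then obtain \<mu> where \<mu>: "\<mu> \<in> partitions m" "mult \<mu> \<noteq> 0" "monom_weight t \<le> weight \<mu>" by (rule rep_poly_keys)
    then show "ereal (real (monom_weight t)) \<le> rep_weight m W"
      unfolding rep_weight_def by (intro SUP_upper2[of \<mu>]) auto
  qed
  show "rep_weight m W \<le> deg_w (rep_poly m W)"
    using rho_rep_poly by (rule rep_weight_le_deg_w)
qed

lemma rep_poly_vars: "rep_poly m W \<in> polys_in_vars (m - 1)"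
proof (rule polys_in_vars_of_weight)
  show "rep_poly m W \<in> polys_weight_le (m - 1)"
    unfolding polys_weight_le_iff light_exponents_def
  proof (intro subsetI CollectI)
    fix t assume "t \<in> Poly_Mapping.keys (rep_poly m W)"
    then obtain \<mu> where "\<mu> \<in> partitions m" "monom_weight t \<le> weight \<mu>" by (rule rep_poly_keys)
    then show "monom_weight t \<le> m - 1" using weight_le_pred le_trans by blast
  qed
qed simp

lemma rep_weight_cases:
  obtains "rep_weight m W = - \<infinity>" | d where "rep_weight m W = ereal (real d)"
proof (cases "{\<mu> \<in> partitions m. mult \<mu> \<noteq> 0} = {}")
  case True
  have "rep_weight m W = - \<infinity>" unfolding rep_weight_def True by (simp add: bot_ereal_def)
  then show thesis by (rule that(1))
next
  case False
  let ?X = "weight ` {\<mu> \<in> partitions m. mult \<mu> \<noteq> 0}"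
  have X: "finite ?X" "?X \<noteq> {}" using False finite_partitions by auto
  obtain \<mu> where \<mu>: "\<mu> \<in> partitions m" "mult \<mu> \<noteq> 0" "weight \<mu> = Max ?X"
    using Max_in[OF X] by auto
  have "rep_weight m W = ereal (real (Max ?X))"
    unfolding rep_weight_def
  proof (rule antisym)
    show "(SUP \<mu>\<in>{\<mu> \<in> partitions m. mult \<mu> \<noteq> 0}. ereal (real (weight \<mu>))) \<le> ereal (real (Max ?X))"
      using Max_ge[OF X(1)] by (intro SUP_least) auto
    show "ereal (real (Max ?X)) \<le> (SUP \<mu>\<in>{\<mu> \<in> partitions m. mult \<mu> \<noteq> 0}. ereal (real (weight \<mu>)))"
      using \<mu> by (intro SUP_upper2[of \<mu>]) auto
  qed
  then show thesis by (rule that(2))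
qed

text \<open>
  Adding a kernel element \<open>R\<close> of weight at most \<open>d\<close> to a polynomial of weight \<open>d\<close> can cancel its leading part,
  but adding \<open>R\<close> and subtracting \<open>R\<close> cannot both do so.
\<close>

lemma rep_poly_unique_iff:
  "(\<forall>Q. rho m Q = character m W \<and> deg_w Q = rep_weight m W \<longrightarrow> Q = rep_poly m W) \<longleftrightarrow> rep_weight m W \<le> ereal (real m / 2)"
proof (cases rule: rep_weight_cases)
  case 1
  have zero: "Q = 0" if "deg_w Q = - \<infinity>" for Q
  proof -
    have "Poly_Mapping.keys Q = {}" using monom_weight_le_deg_w[of _ Q] that by (intro equals0I) fastforce
    then show ?thesis by simp
  qed
  then have "rep_poly m W = 0" using deg_w_rep_poly 1 by simp
  then show ?thesis using zero 1 by simp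
next
  case (2 d)
  let ?X = "rep_poly m W"
  have X: "?X \<in> polys_weight_le d" using deg_w_rep_poly 2 by (simp add: deg_w_le_iff[symmetric])
  show ?thesis
  proof (cases "2 * d \<le> m")
    case True
    have "Q = ?X" if "rho m Q = character m W" "deg_w Q = rep_weight m W" for Q
    proof -
      have "Q \<in> polys_weight_le d" using that 2 by (simp add: deg_w_le_iff[symmetric])
      then have "Q - ?X \<in> polys_weight_le d" using X by (rule polys_weight_le_diff)
      moreover have "rho m (Q - ?X) = 0" by (simp add: rho_diff that(1) rho_rep_poly)
      ultimately have "Q - ?X = 0" using True by (rule rho_kernel_trivial)
      then show ?thesis by simp
    qed
    then show ?thesis using True 2 by auto
  next
    case False
    then obtain R where R: "R \<in> polys_weight_le d" "rho m R = 0" "R \<noteq> 0" using rho_kernel_nontrivial[of m d] by auto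
    have "Poly_Mapping.keys ?X \<noteq> {}" using deg_w_rep_poly 2 by (auto simp: deg_w_def bot_ereal_def)
    moreover have "\<exists>t\<in>Poly_Mapping.keys ?X. monom_weight t = d"
    proof (rule ccontr)
      assume "\<not> ?thesis"
      then have less: "monom_weight t < d" if "t \<in> Poly_Mapping.keys ?X" for t
        using X that by (force simp: polys_weight_le_iff light_exponents_def le_less)
      then have "d \<noteq> 0" using \<open>Poly_Mapping.keys ?X \<noteq> {}\<close> by fastforce
      then have "?X \<in> polys_weight_le (d - 1)" using less by (force simp: polys_weight_le_iff light_exponents_def)
      then have "ereal (real d) \<le> ereal (real (d - 1))" using deg_w_rep_poly 2 by (simp add: deg_w_le_iff[symmetric])
      then show False using \<open>d \<noteq> 0\<close> by simp
    qed
    then obtain t where t: "t \<in> Poly_Mapping.keys ?X" "monom_weight t = d" by auto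
    have other: False if uniq: "\<forall>Q. rho m Q = character m W \<and> deg_w Q = rep_weight m W \<longrightarrow> Q = ?X"
      and R: "R \<in> polys_weight_le d" "rho m R = 0" "R \<noteq> 0" and nz: "Poly_Mapping.lookup (?X - R) t \<noteq> 0" for R
    proof -
      have "?X - R \<in> polys_weight_le d" using polys_weight_le_diff[OF X R(1)] .
      moreover have "ereal (real d) \<le> deg_w (?X - R)"
        using monom_weight_le_deg_w[of t "?X - R"] nz t(2) by (simp add: in_keys_iff)
      ultimately have "deg_w (?X - R) = rep_weight m W" using 2 by (auto simp: deg_w_le_iff[symmetric])
      moreover have "rho m (?X - R) = character m W" using R(2) rho_rep_poly by (simp add: rho_diff)
      ultimately have "?X - R = ?X" using uniq by blast
      then show False using R(3) by simp
    qed
    have "\<not> (\<forall>Q. rho m Q = character m W \<and> deg_w Q = rep_weight m W \<longrightarrow> Q = ?X)"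
    proof
      assume uniq: "\<forall>Q. rho m Q = character m W \<and> deg_w Q = rep_weight m W \<longrightarrow> Q = ?X"
      have z: "Poly_Mapping.lookup ?X t - Poly_Mapping.lookup R t = 0"
        using other[OF uniq R] by (auto simp: lookup_minus)
      have "0 - R \<in> polys_weight_le d" using R(1) by (intro polys_weight_le_diff) (auto simp: polys_weight_le_iff)
      moreover have "rho m (0 - R) = 0" using R(2) by (simp only: rho_diff rho_0 diff_self)
      ultimately have "Poly_Mapping.lookup (?X - (0 - R)) t = 0"
        using other[OF uniq, of "0 - R"] R(3) by fastforce
      then have "Poly_Mapping.lookup ?X t + Poly_Mapping.lookup R t = 0" by (simp add: lookup_add)
      with z show False using t(1) by (simp add: in_keys_iff)
    qed
    moreover have "\<not> rep_weight m W \<le> ereal (real m / 2)" using False 2 by simp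
    ultimately show ?thesis by blast
  qed
qed

end

theorem theorem3p1p1:
  shows
    "(\<forall>d m :: nat.
        rho m ` polys_weight_le d =
          module.span pfun_scale {simple_char \<mu> | \<mu>. \<mu> \<in> partitions m \<and> weight \<mu> \<le> d} \<and>
        ({P \<in> polys_weight_le d. rho m P = 0} = {0} \<longleftrightarrow> real d \<le> real m / 2)) \<and>
     (\<forall>P :: qpoly.
        (\<forall>m m' :: nat. deg_w P \<le> ereal (real m) \<and> deg_w P \<le> ereal (real m') \<longrightarrow>
           scalar_prod m (rho m 1) (rho m P) = scalar_prod m' (rho m' 1) (rho m' P)) \<and>
        (\<forall>m :: nat. \<forall>\<mu>\<in>partitions m. deg_w P < ereal (real (weight \<mu>)) \<longrightarrow>
           scalar_prod m (simple_char \<mu>) (rho m P) = 0) \<and>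
        (\<forall>(m :: nat) (W :: 'v::ab_group_add rep). is_rep m W \<and> rho m P = character m W \<longrightarrow>
           rep_weight m W \<le> deg_w P)) \<and>
     (\<forall>(m :: nat) (W :: 'v::ab_group_add rep). is_rep m W \<longrightarrow>
        rep_poly m W \<in> polys_in_vars (m - 1) \<and>
        rho m (rep_poly m W) = character m W \<and>
        deg_w (rep_poly m W) = rep_weight m W \<and>
        ((\<forall>Q :: qpoly. rho m Q = character m W \<and> deg_w Q = rep_weight m W \<longrightarrow>
            Q = rep_poly m W) \<longleftrightarrow> rep_weight m W \<le> ereal (real m / 2)))"
proof (intro conjI allI impI ballI)
  fix d m :: nat
  show "rho m ` polys_weight_le d = module.span pfun_scale {simple_char \<mu> | \<mu>. \<mu> \<in> partitions m \<and> weight \<mu> \<le> d}"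
    by (rule rho_image)
  have "0 \<in> {P \<in> polys_weight_le d. rho m P = 0}" by (simp add: polys_weight_le_iff rho_0)
  moreover have "\<exists>P\<in>polys_weight_le d. rho m P = 0 \<and> P \<noteq> 0" if "m < 2 * d"
    using rho_kernel_nontrivial[OF that] by metis
  ultimately show "{P \<in> polys_weight_le d. rho m P = 0} = {0} \<longleftrightarrow> real d \<le> real m / 2"
    using rho_kernel_trivial[of _ d m] by (cases "2 * d \<le> m") auto
next
  fix P :: qpoly and m m' :: nat
  assume "deg_w P \<le> ereal (real m) \<and> deg_w P \<le> ereal (real m')"
  then have "P \<in> polys_weight_le (min m m')" by (simp add: min_def polys_weight_le_def)
  then show "scalar_prod m (rho m 1) (rho m P) = scalar_prod m' (rho m' 1) (rho m' P)"
    by (rule scalar_prod_one_constant) auto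
next
  fix P :: qpoly and m :: nat and \<mu> assume "\<mu> \<in> partitions m" "deg_w P < ereal (real (weight \<mu>))"
  then show "scalar_prod m (simple_char \<mu>) (rho m P) = 0" by (rule scalar_prod_deg_less)
next
  fix P :: qpoly and m :: nat and W :: "'v rep" assume W: "is_rep m W \<and> rho m P = character m W"
  then interpret representation m W by unfold_locales simp
  show "rep_weight m W \<le> deg_w P" using W by (intro rep_weight_le_deg_w) simp
next
  fix m :: nat and W :: "'v rep" assume "is_rep m W"
  then interpret representation m W by unfold_locales
  show "rep_poly m W \<in> polys_in_vars (m - 1)" "rho m (rep_poly m W) = character m W"
    "deg_w (rep_poly m W) = rep_weight m W"
    "(\<forall>Q :: qpoly. rho m Q = character m W \<and> deg_w Q = rep_weight m W \<longrightarrow> Q = rep_poly m W) \<longleftrightarrow> rep_weight m W \<le> ereal (real m / 2)"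
    by (rule rep_poly_vars rho_rep_poly deg_w_rep_poly rep_poly_unique_iff)+
qed

end
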